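(* Let $\omega\in D(\kappa,\nu)$ for some $\kappa>0$, $\nu\ge l$. Let $(S_t)_{t\in\mathbb R}$ be the flow generated by a finite-dimensional analytic exact symplectic vector-field $$\frac{du}{dt}=f(u),$$ where $u:I\subset\mathbb R\to\mathcal M$. Assume that there exists an embedding $K\in ND(\rho)$ for some $\rho>0$ (non-degeneracy with respect to the time-one map $F=S_1$) such that $S_1\circ K(\theta)=K(\theta+\omega)$ for all $\theta\in\mathbb T^l$. Then for all $t\in\mathbb R$ we have $$S_t\circ K(\theta)=K(\theta+\omega t).$$
   Context: $D(\kappa,\nu)$ is the set of $\omega\in\mathbb R^l$ with $|\omega\cdot k-n|^{-1}\le\kappa|k|^\nu$ for all $k\in\mathbb Z^l\setminus\{0\}$, $n\in\mathbb Z$, where $|k|=|k_1|+\dots+|k_l|$. $\mathbb T^l=\mathbb R^l/\mathbb Z^l$, $T_\omega(\theta)=\theta+\omega$, $\mathrm{avg}(f)=\int_{\mathbb T^l}f(\theta)\,d\theta$. $D_\rho=\{z\in\mathbb C^l/\mathbb Z^l: |\mathrm{Im}\,z_i|\le\rho,\ i=1,\dots,l\}$. $\mathcal A_\rho$ is the space of continuous functions on $D_\rho$, analytic in the interior. $\mathcal M$ is $\mathbb R^{2d}$ or $\mathbb R^{2d-2l}\times\mathbb R^l\times\mathbb T^l$, $d\ge l$; its complex extension is denoted by the same letter. $\mathcal M$ carries an analytic exact symplectic form $\Omega=d\alpha$; $J(z)$ is the matrix with $\Omega_z(\xi,\eta)=\langle\xi,J(z)\eta\rangle$. A vector-field $X$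 is exact symplectic if $\mathcal L_X\alpha=dW$ for some smooth function $W$ on $\mathcal M$ ($\mathcal L$ the Lie derivative). For an embedding $K:D_\rho\supset\mathbb T^l\to\mathcal M$, $K\in\mathcal A_\rho$, and a map $F$ (here $F=S_1$) set $N(\theta)=[DK(\theta)^\top DK(\theta)]^{-1}$, $P(\theta)=DK(\theta)N(\theta)$, $G(\theta)=[J(K)^{-1}DK](\theta+\omega)$, $Q(\theta)=DK(\theta+\omega)^\top J(K(\theta+\omega))G(\theta)$, $$A(\theta)=P(\theta+\omega)^\top\big[\,DF(K(\theta))J(K(\theta))^{-1}P(\theta)-J(K(\theta+\omega))^{-1}P(\theta+\omega)\,\big].$$ $K\in ND(\rho)$ (non-degenerate) means: (i) Spectral condition: for all $\theta$ there is a splitting $T_{K(\theta)}\mathcal M=\mathcal E^s_{K(\theta)}\oplus\mathcal E^c_{K(\theta)}\oplus\mathcal E^u_{K(\theta)}$, analytic in $\theta$ (with projections $\Pi^{s,c,u}_{K(\theta)}$ analytic in $\theta$), invariant: $DF(K(\theta))\mathcal E^{s,c,u}_{K(\theta)}=\mathcal E^{s,c,u}_{K(\theta+\omega)}$; and there exist $0<\mu_1,\mu_2<1$, $\mu_3>1$ with $\mu_1\mu_3<1$, $\mu_2\mu_3<1$, and $C_h>0$ such that, writing $M^n(\theta)=DF(K(\theta+(n-1)\omega))\cdots DF(K(\theta))$ and $M^{-n}(\theta)=DF(K(\theta-n\omega))^{-1}\cdots DF(K(\theta-\omega))^{-1}$, for all $\theta\in D_\rho$: $v\in\mathcal E^s_{K(\theta)}$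 iff $|M^n(\theta)v|\le C_h\mu_1^n|v|$ for all $n\ge1$; $v\in\mathcal E^u_{K(\theta)}$ iff $|M^{-n}(\theta)v|\le C_h\mu_2^n|v|$ for all $n\ge1$; $v\in\mathcal E^c_{K(\theta)}$ iff $|M^n(\theta)v|\le C_h\mu_3^n|v|$ and $|M^{-n}(\theta)v|\le C_h\mu_3^n|v|$ for all $n\ge1$. (ii) $\dim\mathcal E^c_{K(\theta)}=2l$. (iii) Twist condition: $\mathrm{avg}(Q)$ and $\mathrm{avg}(A)$ are non-singular.
   Formalization: The conclusion is proved for some ω' in ω + ℤ^l, independent of t and θ, in place of ω itself: the hypotheses fix ω only modulo ℤ^l, and the claim fails for a wrong representative (e.g. f(I,θ)=(0,I), K(θ)=(I₀,θ), ω=I₀+1). *)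

theory Defs
  imports "HOL-Analysis.Analysis"
begin

section \<open>Tori, cylinders and their complex extensions\<close>

text \<open>
  The torus \<open>\<real>\<^sup>l/\<int>\<^sup>l\<close> and the phase space are represented on their universal covers.
  The phase space has coordinates indexed by \<open>'n\<close>; the set \<open>ang\<close> collects the
  angular ones, so points of \<open>\<real>\<^sup>n\<close> equal up to integer shifts of the coordinates in \<open>ang\<close>
  are the same point of the phase space. \<open>ang = {}\<close> gives \<open>\<real>\<^bsup>2d\<^esup>\<close>, \<open>card ang = l\<close> gives
  \<open>\<real>\<^bsup>2d-2l\<^esup> \<times> \<real>\<^sup>l \<times> \<T>\<^sup>l\<close> up to the order of the coordinates, and \<open>ang = UNIV\<close> is a full torus.
  Functions and tensors on the quotient are invariant functions on the cover; maps into the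
  quotient are given by lifts.
\<close>

definition same_point :: "'n set \<Rightarrow> 'a::ring_1 ^ 'n \<Rightarrow> 'a ^ 'n \<Rightarrow> bool" where
  "same_point ang x y \<longleftrightarrow> (\<forall>i. if i \<in> ang then x $ i - y $ i \<in> \<int> else x $ i = y $ i)"

definition invariant_fun :: "'n set \<Rightarrow> ('a::ring_1 ^ 'n \<Rightarrow> 'b) \<Rightarrow> bool" where
  "invariant_fun ang g \<longleftrightarrow> (\<forall>x y. same_point ang x y \<longrightarrow> g x = g y)"

definition cvec :: "real ^ 'n \<Rightarrow> complex ^ 'n" where
  "cvec x = (\<chi> i. complex_of_real (x $ i))"

text \<open>The set \<open>D\<^sub>\<rho>\<close>, lifted to \<open>\<complex>\<^sup>l\<close>.\<close>

definition strip :: "real \<Rightarrow> (complex ^ 'l) set" where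
  "strip \<rho> = {z. \<forall>i. \<bar>Im (z $ i)\<bar> \<le> \<rho>}"

section \<open>Regularity\<close>

definition holomorphic_several :: "(complex ^ 'n \<Rightarrow> complex) \<Rightarrow> (complex ^ 'n) set \<Rightarrow> bool" where
  "holomorphic_several g U \<longleftrightarrow> open U \<and>
     (\<forall>z\<in>U. \<exists>g'. (g has_derivative g') (at z) \<and> (\<forall>c v. g' (c *s v) = c * g' v))"

text \<open>Membership in \<open>\<A>\<^sub>\<rho>\<close>, apart from periodicity, which is imposed separately.\<close>

definition strip_analytic :: "real \<Rightarrow> (complex ^ 'l \<Rightarrow> complex) \<Rightarrow> bool" where
  "strip_analytic \<rho> g \<longleftrightarrow>
     continuous_on (strip \<rho>) g \<and> holomorphic_several g (interior (strip \<rho>))"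

text \<open>Real analyticity on all of \<open>\<real>\<^sup>n\<close>, by holomorphic extension to a complex neighbourhood.\<close>

definition real_analytic :: "(real ^ 'n \<Rightarrow> real) \<Rightarrow> bool" where
  "real_analytic g \<longleftrightarrow> (\<exists>U h. range cvec \<subseteq> U \<and> holomorphic_several h U \<and>
     (\<forall>x. h (cvec x) = complex_of_real (g x)))"

primrec Ck :: "nat \<Rightarrow> ('a::real_normed_vector \<Rightarrow> 'b::real_normed_vector) \<Rightarrow> bool" where
  "Ck 0 g \<longleftrightarrow> continuous_on UNIV g"
| "Ck (Suc k) g \<longleftrightarrow> (\<forall>x. g differentiable (at x)) \<and>
     (\<forall>v. Ck k (\<lambda>x. frechet_derivative g (at x) v))"

definition smooth_fun :: "('a::real_normed_vector \<Rightarrow> 'b::real_normed_vector) \<Rightarrow> bool" where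
  "smooth_fun g \<longleftrightarrow> (\<forall>k. Ck k g)"

section \<open>Exact symplectic structure and vector fields\<close>

text \<open>A 1-form \<open>\<alpha>\<close> is given by its coefficient vector: \<open>\<alpha>\<^sub>z(\<eta>) = \<alpha> z \<bullet> \<eta>\<close>.\<close>

definition ext_deriv :: "(real ^ 'n \<Rightarrow> real ^ 'n) \<Rightarrow> real ^ 'n \<Rightarrow> real ^ 'n \<Rightarrow> real ^ 'n \<Rightarrow> real" where
  "ext_deriv \<alpha> z \<xi> \<eta> =
     frechet_derivative \<alpha> (at z) \<xi> \<bullet> \<eta> - frechet_derivative \<alpha> (at z) \<eta> \<bullet> \<xi>"

text \<open>In coordinates, \<open>(\<L>\<^sub>X \<alpha>)\<^sub>j = \<Sum>\<^sub>i X\<^sub>i \<partial>\<^sub>i\<alpha>\<^sub>j + \<alpha>\<^sub>i \<partial>\<^sub>jX\<^sub>i\<close>.\<close>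

definition lie_deriv ::
  "(real ^ 'n \<Rightarrow> real ^ 'n) \<Rightarrow> (real ^ 'n \<Rightarrow> real ^ 'n) \<Rightarrow> real ^ 'n \<Rightarrow> real ^ 'n \<Rightarrow> real" where
  "lie_deriv X \<alpha> z \<eta> =
     frechet_derivative \<alpha> (at z) (X z) \<bullet> \<eta> + \<alpha> z \<bullet> frechet_derivative X (at z) \<eta>"

definition exact_symplectic_form ::
  "'n set \<Rightarrow> (real ^ 'n \<Rightarrow> real ^ 'n) \<Rightarrow> (real ^ 'n \<Rightarrow> real ^ 'n ^ 'n) \<Rightarrow> bool" where
  "exact_symplectic_form ang \<alpha> J \<longleftrightarrow>
     smooth_fun \<alpha> \<and> invariant_fun ang \<alpha> \<and>
     (\<forall>z \<xi> \<eta>. ext_deriv \<alpha> z \<xi> \<eta> = \<xi> \<bullet> (J z *v \<eta>)) \<and>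
     (\<forall>i j. real_analytic (\<lambda>z. J z $ i $ j)) \<and>
     (\<forall>z. invertible (J z))"

definition analytic_vector_field :: "'n set \<Rightarrow> (real ^ 'n \<Rightarrow> real ^ 'n) \<Rightarrow> bool" where
  "analytic_vector_field ang X \<longleftrightarrow>
     invariant_fun ang X \<and> (\<forall>i. real_analytic (\<lambda>z. X z $ i))"

definition exact_symplectic_field ::
  "'n set \<Rightarrow> (real ^ 'n \<Rightarrow> real ^ 'n) \<Rightarrow> (real ^ 'n \<Rightarrow> real ^ 'n) \<Rightarrow> bool" where
  "exact_symplectic_field ang \<alpha> X \<longleftrightarrow>
     (\<exists>W :: real ^ 'n \<Rightarrow> real. smooth_fun W \<and> invariant_fun ang W \<and>
        (\<forall>z \<eta>. lie_deriv X \<alpha> z \<eta> = frechet_derivative W (at z) \<eta>))"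

text \<open>The flow of \<open>du/dt = X(u)\<close>, lifted to the cover.\<close>

definition is_flow ::
  "(real ^ 'n \<Rightarrow> real ^ 'n) \<Rightarrow> (real \<Rightarrow> real ^ 'n \<Rightarrow> real ^ 'n) \<Rightarrow> bool" where
  "is_flow X S \<longleftrightarrow>
     (\<forall>x. S 0 x = x \<and> (\<forall>t. ((\<lambda>t. S t x) has_vector_derivative X (S t x)) (at t)))"

section \<open>Diophantine vectors\<close>

text \<open>\<open>\<omega> \<bullet> k \<noteq> n\<close> is implicit in \<open>|\<omega> \<bullet> k - n|\<^bsup>-1\<^esup> \<le> \<kappa> |k|\<^sup>\<nu>\<close>, but here \<open>inverse 0 = 0\<close>.\<close>

definition diophantine :: "real \<Rightarrow> real \<Rightarrow> (real ^ 'l) set" where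
  "diophantine \<kappa> \<nu> = {\<omega>. \<forall>(k :: int ^ 'l) (n :: int). k \<noteq> 0 \<longrightarrow>
     (let r = (\<Sum>i\<in>UNIV. \<omega> $ i * of_int (k $ i)) - of_int n in
      r \<noteq> 0 \<and> inverse \<bar>r\<bar> \<le> \<kappa> * (\<Sum>i\<in>UNIV. \<bar>of_int (k $ i)\<bar>) powr \<nu>)}"

section \<open>Embedded tori and non-degeneracy\<close>

definition torus_map :: "'n set \<Rightarrow> (real ^ 'l \<Rightarrow> real ^ 'n) \<Rightarrow> bool" where
  "torus_map ang K \<longleftrightarrow>
     (\<forall>\<theta> \<theta>'. same_point UNIV \<theta> \<theta>' \<longrightarrow> same_point ang (K \<theta>) (K \<theta>'))"

text \<open>As the torus is compact, an injective immersion is an embedding.\<close>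

definition torus_embedding :: "'n set \<Rightarrow> (real ^ 'l \<Rightarrow> real ^ 'n) \<Rightarrow> bool" where
  "torus_embedding ang K \<longleftrightarrow>
     torus_map ang K \<and>
     (\<forall>\<theta> \<theta>'. same_point ang (K \<theta>) (K \<theta>') \<longrightarrow> same_point UNIV \<theta> \<theta>') \<and>
     (\<forall>\<theta>. K differentiable (at \<theta>) \<and> inj (frechet_derivative K (at \<theta>)))"

text \<open>\<open>Kc\<close> is the extension of \<open>K\<close> to \<open>D\<^sub>\<rho>\<close> witnessing \<open>K \<in> \<A>\<^sub>\<rho>\<close>.\<close>

definition strip_extension ::
  "'n set \<Rightarrow> real \<Rightarrow> (real ^ 'l \<Rightarrow> real ^ 'n) \<Rightarrow> (complex ^ 'l \<Rightarrow> complex ^ 'n) \<Rightarrow> bool" where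
  "strip_extension ang \<rho> K Kc \<longleftrightarrow>
     (\<forall>\<theta>. Kc (cvec \<theta>) = cvec (K \<theta>)) \<and>
     (\<forall>i. strip_analytic \<rho> (\<lambda>z. Kc z $ i)) \<and>
     (\<forall>z\<in>strip \<rho>. \<forall>w. same_point UNIV w z \<longrightarrow> same_point ang (Kc w) (Kc z))"

text \<open>
  \<open>Fc\<close> is the extension of \<open>F\<close> to a complex neighbourhood \<open>U\<close> of the real phase space;
  as \<open>U\<close> is connected, \<open>F\<close> determines \<open>Fc\<close> on \<open>U\<close>.
\<close>

definition complex_extension ::
  "'n set \<Rightarrow> (real ^ 'n \<Rightarrow> real ^ 'n) \<Rightarrow> (complex ^ 'n) set \<Rightarrow> (complex ^ 'n \<Rightarrow> complex ^ 'n) \<Rightarrow> bool"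
  where
  "complex_extension ang F U Fc \<longleftrightarrow>
     connected U \<and> range cvec \<subseteq> U \<and>
     (\<forall>z\<in>U. \<forall>w. same_point ang w z \<longrightarrow> w \<in> U) \<and>
     (\<forall>i. holomorphic_several (\<lambda>z. Fc z $ i) U) \<and>
     (\<forall>x. Fc (cvec x) = cvec (F x))"

text \<open>For a matrix function \<open>A\<close> on the torus, \<open>cocycle_fwd A \<omega> n\<close> and \<open>cocycle_bwd A \<omega> n\<close> are
  \<open>M\<^sup>n\<close> and \<open>M\<^bsup>-n\<^esup>\<close>; below, \<open>A = DF \<circ> K\<close>.\<close>

primrec cocycle_fwd ::
  "(complex ^ 'l \<Rightarrow> complex ^ 'n ^ 'n) \<Rightarrow> real ^ 'l \<Rightarrow> nat \<Rightarrow> complex ^ 'l \<Rightarrow> complex ^ 'n ^ 'n" where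
  "cocycle_fwd A \<omega> 0 \<theta> = mat 1"
| "cocycle_fwd A \<omega> (Suc n) \<theta> = A (\<theta> + cvec (real n *\<^sub>R \<omega>)) ** cocycle_fwd A \<omega> n \<theta>"

primrec cocycle_bwd ::
  "(complex ^ 'l \<Rightarrow> complex ^ 'n ^ 'n) \<Rightarrow> real ^ 'l \<Rightarrow> nat \<Rightarrow> complex ^ 'l \<Rightarrow> complex ^ 'n ^ 'n" where
  "cocycle_bwd A \<omega> 0 \<theta> = mat 1"
| "cocycle_bwd A \<omega> (Suc n) \<theta> =
     matrix_inv (A (\<theta> - cvec (real (Suc n) *\<^sub>R \<omega>))) ** cocycle_bwd A \<omega> n \<theta>"

text \<open>By uniqueness of the decomposition, \<open>Ps\<close>, \<open>Pc\<close>, \<open>Pu\<close> are the matrices of the projections.\<close>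

definition splitting3 ::
  "(complex ^ 'n) set \<Rightarrow> (complex ^ 'n) set \<Rightarrow> (complex ^ 'n) set \<Rightarrow>
   complex ^ 'n ^ 'n \<Rightarrow> complex ^ 'n ^ 'n \<Rightarrow> complex ^ 'n ^ 'n \<Rightarrow> bool" where
  "splitting3 Es Ec Eu Ps Pc Pu \<longleftrightarrow>
     vec.subspace Es \<and> vec.subspace Ec \<and> vec.subspace Eu \<and>
     (\<forall>v. \<exists>!(a, b, c). a \<in> Es \<and> b \<in> Ec \<and> c \<in> Eu \<and> v = a + b + c) \<and>
     (\<forall>v. Ps *v v \<in> Es \<and> Pc *v v \<in> Ec \<and> Pu *v v \<in> Eu \<and> v = Ps *v v + Pc *v v + Pu *v v)"

definition spectral_condition ::
  "(complex ^ 'l \<Rightarrow> complex ^ 'n ^ 'n) \<Rightarrow> real ^ 'l \<Rightarrow> real \<Rightarrow>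
   (complex ^ 'l \<Rightarrow> (complex ^ 'n) set) \<Rightarrow> (complex ^ 'l \<Rightarrow> (complex ^ 'n) set) \<Rightarrow>
   (complex ^ 'l \<Rightarrow> (complex ^ 'n) set) \<Rightarrow> bool" where
  "spectral_condition A \<omega> \<rho> Es Ec Eu \<longleftrightarrow>
     invariant_fun UNIV Es \<and> invariant_fun UNIV Ec \<and> invariant_fun UNIV Eu \<and>
     (\<exists>Ps Pc Pu. \<forall>i j.
        strip_analytic \<rho> (\<lambda>\<theta>. Ps \<theta> $ i $ j) \<and> strip_analytic \<rho> (\<lambda>\<theta>. Pc \<theta> $ i $ j) \<and>
        strip_analytic \<rho> (\<lambda>\<theta>. Pu \<theta> $ i $ j) \<and>
        (\<forall>\<theta>\<in>strip \<rho>. splitting3 (Es \<theta>) (Ec \<theta>) (Eu \<theta>) (Ps \<theta>) (Pc \<theta>) (Pu \<theta>))) \<and>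
     (\<forall>\<theta>\<in>strip \<rho>. \<forall>E\<in>{Es, Ec, Eu}. (\<lambda>v. A \<theta> *v v) ` E \<theta> = E (\<theta> + cvec \<omega>)) \<and>
     (\<exists>\<mu>1 \<mu>2 \<mu>3 C :: real.
        0 < \<mu>1 \<and> \<mu>1 < 1 \<and> 0 < \<mu>2 \<and> \<mu>2 < 1 \<and> 1 < \<mu>3 \<and> \<mu>1 * \<mu>3 < 1 \<and> \<mu>2 * \<mu>3 < 1 \<and> 0 < C \<and>
        (\<forall>\<theta>\<in>strip \<rho>. \<forall>v.
           (v \<in> Es \<theta> \<longleftrightarrow> (\<forall>n\<ge>1. norm (cocycle_fwd A \<omega> n \<theta> *v v) \<le> C * \<mu>1 ^ n * norm v)) \<and>
           (v \<in> Eu \<theta> \<longleftrightarrow> (\<forall>n\<ge>1. norm (cocycle_bwd A \<omega> n \<theta> *v v) \<le> C * \<mu>2 ^ n * norm v)) \<and>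
           (v \<in> Ec \<theta> \<longleftrightarrow>
              (\<forall>n\<ge>1. norm (cocycle_fwd A \<omega> n \<theta> *v v) \<le> C * \<mu>3 ^ n * norm v \<and>
                     norm (cocycle_bwd A \<omega> n \<theta> *v v) \<le> C * \<mu>3 ^ n * norm v))))"

abbreviation DK :: "(real ^ 'l \<Rightarrow> real ^ 'n) \<Rightarrow> real ^ 'l \<Rightarrow> real ^ 'l ^ 'n" where
  "DK K \<theta> \<equiv> jacobian K (at \<theta>)"

definition N_mat :: "(real ^ 'l \<Rightarrow> real ^ 'n) \<Rightarrow> real ^ 'l \<Rightarrow> real ^ 'l ^ 'l" where
  "N_mat K \<theta> = matrix_inv (transpose (DK K \<theta>) ** DK K \<theta>)"

definition P_mat :: "(real ^ 'l \<Rightarrow> real ^ 'n) \<Rightarrow> real ^ 'l \<Rightarrow> real ^ 'l ^ 'n" where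
  "P_mat K \<theta> = DK K \<theta> ** N_mat K \<theta>"

definition G_mat ::
  "(real ^ 'n \<Rightarrow> real ^ 'n ^ 'n) \<Rightarrow> real ^ 'l \<Rightarrow> (real ^ 'l \<Rightarrow> real ^ 'n) \<Rightarrow>
   real ^ 'l \<Rightarrow> real ^ 'l ^ 'n" where
  "G_mat J \<omega> K \<theta> = matrix_inv (J (K (\<theta> + \<omega>))) ** DK K (\<theta> + \<omega>)"

definition Q_mat ::
  "(real ^ 'n \<Rightarrow> real ^ 'n ^ 'n) \<Rightarrow> real ^ 'l \<Rightarrow> (real ^ 'l \<Rightarrow> real ^ 'n) \<Rightarrow>
   real ^ 'l \<Rightarrow> real ^ 'l ^ 'l" where
  "Q_mat J \<omega> K \<theta> = transpose (DK K (\<theta> + \<omega>)) ** J (K (\<theta> + \<omega>)) ** G_mat J \<omega> K \<theta>"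

definition A_mat ::
  "(real ^ 'n \<Rightarrow> real ^ 'n ^ 'n) \<Rightarrow> (real ^ 'n \<Rightarrow> real ^ 'n) \<Rightarrow> real ^ 'l \<Rightarrow>
   (real ^ 'l \<Rightarrow> real ^ 'n) \<Rightarrow> real ^ 'l \<Rightarrow> real ^ 'l ^ 'l" where
  "A_mat J F \<omega> K \<theta> = transpose (P_mat K (\<theta> + \<omega>)) **
     (jacobian F (at (K \<theta>)) ** matrix_inv (J (K \<theta>)) ** P_mat K \<theta>
      - matrix_inv (J (K (\<theta> + \<omega>))) ** P_mat K (\<theta> + \<omega>))"

definition avg :: "(real ^ 'l \<Rightarrow> 'b::euclidean_space) \<Rightarrow> 'b" where
  "avg g = integral (cbox 0 1) g"

definition twist_condition ::
  "(real ^ 'n \<Rightarrow> real ^ 'n ^ 'n) \<Rightarrow> (real ^ 'n \<Rightarrow> real ^ 'n) \<Rightarrow> real ^ 'l \<Rightarrow>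
   (real ^ 'l \<Rightarrow> real ^ 'n) \<Rightarrow> bool" where
  "twist_condition J F \<omega> K \<longleftrightarrow>
     invertible (avg (Q_mat J \<omega> K)) \<and> invertible (avg (A_mat J F \<omega> K))"

definition ND ::
  "'n set \<Rightarrow> (real ^ 'n \<Rightarrow> real ^ 'n ^ 'n) \<Rightarrow> (real ^ 'n \<Rightarrow> real ^ 'n) \<Rightarrow> real ^ 'l \<Rightarrow> real \<Rightarrow>
   (real ^ 'l \<Rightarrow> real ^ 'n) set" where
  "ND ang J F \<omega> \<rho> = {K. torus_embedding ang K \<and>
     (\<exists>Kc U Fc. strip_extension ang \<rho> K Kc \<and> complex_extension ang F U Fc \<and> Kc ` strip \<rho> \<subseteq> U \<and>
        (\<exists>Es Ec Eu. spectral_condition (\<lambda>\<theta>. jacobian Fc (at (Kc \<theta>))) \<omega> \<rho> Es Ec Eu \<and>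
           (\<forall>\<theta>\<in>strip \<rho>. vec.dim (Ec \<theta>) = 2 * CARD('l)))) \<and>
     twist_condition J F \<omega> K}"

text \<open>
  The rotation \<open>T\<^sub>\<omega>\<close>, hence \<open>K \<in> ND\<close> and \<open>S\<^sub>1 \<circ> K = K \<circ> T\<^sub>\<omega>\<close>, depend on \<open>\<omega>\<close> only modulo \<open>\<int>\<^sup>l\<close>, whereas
  \<open>\<theta> + t \<omega>\<close> does not. A statement about \<open>S\<^sub>t \<circ> K\<close> for all real \<open>t\<close> therefore has to be about a
  suitable representative \<open>\<omega>'\<close> of \<open>\<omega>\<close>, that is, \<open>same_point UNIV \<omega>' \<omega>\<close>. For instance, if
  \<open>S t (I, \<theta>) = (I, \<theta> + t I)\<close> on \<open>\<real> \<times> \<T>\<close> and \<open>K \<theta> = (I\<^sub>0, \<theta>)\<close>, then \<open>S\<^sub>1 \<circ> K = K \<circ> T\<^sub>\<omega>\<close> for every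
  \<open>\<omega> \<in> I\<^sub>0 + \<int>\<close>, but \<open>S\<^sub>t (K \<theta>) = K (\<theta> + t \<omega>)\<close> for all \<open>t\<close> only for \<open>\<omega> = I\<^sub>0\<close>.
\<close>

end

theory Submission
  imports Defs "HOL-Complex_Analysis.Cauchy_Integral_Formula"
begin

text \<open>
  Write \<open>D \<theta>\<close> for the derivative of \<open>K\<close> at \<open>\<theta>\<close>, \<open>F\<close> for the time-one map, and \<open>\<Omega>\<close> for the
  symplectic form. The plan is to show that the vector field is tangent to the torus and
  constant in the coordinate \<open>\<theta>\<close>:
  \<open>f (K \<theta>) = D \<theta> a\<close> for one vector \<open>a\<close>. Then \<open>t \<mapsto> K (\<theta> + t a)\<close> solves the differential
  equation, so it is the orbit of \<open>K \<theta>\<close>; comparing \<open>t = 1\<close> with the conjugacy, injectivity of the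
  embedding gives \<open>a = \<omega>\<close> modulo \<open>\<int>\<^sup>l\<close>, and \<open>a\<close> is the required representative of \<open>\<omega>\<close>.

  Differentiating \<open>F \<circ> S\<^sub>t = S\<^sub>t \<circ> F\<close> at \<open>t = 0\<close> shows that \<open>V \<theta> = f (K \<theta>)\<close> is carried by the
  cocycle \<open>DF (K \<theta>)\<close> to \<open>V (\<theta> + \<omega>)\<close>, exactly as the columns of \<open>D \<theta>\<close> are. Both sections are
  periodic, hence bounded along orbits in both time directions, and the rate conditions
  \<open>\<mu>\<^sub>1 \<mu>\<^sub>3 < 1\<close>, \<open>\<mu>\<^sub>2 \<mu>\<^sub>3 < 1\<close> force them into the centre bundle
  (\<open>bounded_section_in_Ec\<close>). Inside the centre space, three facts place \<open>V\<close> in the range of \<open>D \<theta>\<close>: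

  \<^item> The centre space is symplectic. The cocycle preserves \<open>\<Omega>\<close>, and \<open>\<Omega>\<close> of a stable or
    unstable vector with a central one shrinks like \<open>(\<mu>\<^sub>1 \<mu>\<^sub>3)\<^sup>n\<close> or \<open>(\<mu>\<^sub>2 \<mu>\<^sub>3)\<^sup>n\<close> along the orbit,
    so it vanishes; nondegeneracy of \<open>\<Omega>\<close> therefore descends to the centre space
    (\<open>Ec_nondegenerate\<close>).
  \<^item> The range of \<open>D \<theta>\<close> is isotropic. By invariance and minimality of the rotation, the pull-back of
    \<open>\<Omega>\<close> to the torus has constant coefficients; being the exterior derivative of a periodic
    1-form, it is zero (\<open>isotropic\<close>).
  \<^item> \<open>V\<close> is \<open>\<Omega>\<close>-orthogonal to the range of \<open>D \<theta>\<close>. The field is Hamiltonian with a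
    globally defined energy \<open>W - \<alpha> \<bullet> f\<close>. Energy is conserved by the flow, so it is invariant under
    the rotation on the torus and thus constant there; its derivative along the torus is
    \<open>\<Omega>(V, D \<theta> \<xi>)\<close> (\<open>field_orthogonal_to_torus\<close>).

  The centre space has dimension \<open>2l\<close>, so an isotropic subspace of dimension \<open>l\<close> is
  maximal isotropic, and \<open>V \<theta> = D \<theta> a\<close> for some \<open>a\<close> at a single \<open>\<theta>\<close> (\<open>lagrangian_maximal\<close>).
  Both sides being carried along by the same injective cocycle, the set of \<open>\<theta>\<close> where this equation
  holds for that \<open>a\<close> is closed and invariant under the rotation, so it is everything.

  What remains is the supporting analysis: analytic functions are smooth (by Cauchy's integral formula), the
  time-one map preserves \<open>\<Omega>\<close> (by a direct estimate on nearby orbits), and orbits of the rotation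
  are dense (by Kronecker's theorem).
\<close>

section \<open>Holomorphic functions of several variables\<close>

lemma norm_vector_smult: "norm (c *s v) = norm c * norm (v :: complex ^ 'n)"
  by (simp add: norm_vec_def L2_set_def norm_mult power_mult_distrib real_sqrt_mult
      flip: sum_distrib_left)

lemma holomorphic_several_has_derivative:
  assumes "holomorphic_several g U" "z \<in> U"
  shows "(g has_derivative frechet_derivative g (at z)) (at z)"
    and "frechet_derivative g (at z) (c *s v) = c * frechet_derivative g (at z) v"
proof -
  obtain g' where g': "(g has_derivative g') (at z)" "\<And>c v. g' (c *s v) = c * g' v"
    using assms unfolding holomorphic_several_def by blast
  have "frechet_derivative g (at z) = g'"
    using g'(1) frechet_derivative_at by metis
  with g' show "(g has_derivative frechet_derivative g (at z)) (at z)"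
    "frechet_derivative g (at z) (c *s v) = c * frechet_derivative g (at z) v" by auto
qed

lemma holomorphic_several_continuous_on:
  "holomorphic_several g U \<Longrightarrow> continuous_on U g"
  by (meson continuous_at_imp_continuous_on has_derivative_continuous
      holomorphic_several_has_derivative(1))

lemma bounded_linear_smult: "bounded_linear (\<lambda>\<zeta>. \<zeta> *s (v :: complex ^ 'n))"
  by (rule bounded_linear_intro[where K="norm v"])
     (auto simp: vec_eq_iff algebra_simps norm_vector_smult)

text \<open>
  Cauchy's formula for the derivative, applied to the one-variable function
  \<open>\<zeta> \<mapsto> g (z + \<zeta> v)\<close>. Expressing a derivative of \<open>g\<close> as an integral of values of \<open>g\<close> is what
  gives it the regularity of \<open>g\<close>.
\<close>

lemma cauchy_directional_derivative:
  fixes z v :: "complex ^ 'n"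
  assumes hol: "holomorphic_several g U" and r: "r > 0"
    and sub: "\<And>\<zeta>. norm \<zeta> \<le> r \<Longrightarrow> z + \<zeta> *s v \<in> U"
  shows "((\<lambda>t. g (z + circlepath 0 r t *s v) / circlepath 0 r t) has_integral
           frechet_derivative g (at z) v) (cbox 0 1)"
proof -
  define h where "h = (\<lambda>\<zeta>. g (z + \<zeta> *s v))"
  have der: "(h has_field_derivative frechet_derivative g (at (z + \<zeta> *s v)) v) (at \<zeta>)"
    if "norm \<zeta> \<le> r" for \<zeta>
  proof -
    have 1: "((\<lambda>\<zeta>. z + \<zeta> *s v) has_derivative (\<lambda>c. c *s v)) (at \<zeta>)"
      by (rule derivative_eq_intros bounded_linear.has_derivative[OF bounded_linear_smult] refl | simp)+
    have "(h has_derivative (\<lambda>c. frechet_derivative g (at (z + \<zeta> *s v)) (c *s v))) (at \<zeta>)"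
      unfolding h_def
      by (rule has_derivative_compose[OF 1 holomorphic_several_has_derivative(1)[OF hol sub[OF that]]])
    moreover have "(\<lambda>c. frechet_derivative g (at (z + \<zeta> *s v)) (c *s v)) =
        (*) (frechet_derivative g (at (z + \<zeta> *s v)) v)"
      by (simp add: fun_eq_iff holomorphic_several_has_derivative(2)[OF hol sub[OF that]])
    ultimately show ?thesis by (simp add: has_field_derivative_def)
  qed
  have "h holomorphic_on ball 0 r"
    unfolding holomorphic_on_open[OF open_ball] using der by force
  moreover have "continuous_on (cball 0 r) h"
    using der DERIV_isCont by (intro continuous_at_imp_continuous_on) force
  ultimately have C: "((\<lambda>u. h u / (u - 0) ^ Suc 1) has_contour_integral
      ((2 * pi * \<i>) / (fact 1) * (deriv ^^ 1) h 0)) (circlepath 0 r)"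
    by (intro Cauchy_has_contour_integral_higher_derivative_circlepath) (auto simp: r)
  have dh: "deriv h 0 = frechet_derivative g (at z) v"
    using DERIV_imp_deriv[OF der[of 0]] r by simp
  have nz: "circlepath 0 r t \<noteq> 0" for t
    using r by (simp add: circlepath)
  have "((\<lambda>t. h (circlepath 0 r t) / circlepath 0 r t ^ 2 * vector_derivative (circlepath 0 r) (at t within {0..1}))
     has_integral (2 * pi * \<i> * frechet_derivative g (at z) v)) {0..1}"
    using C unfolding has_contour_integral_def by (simp add: dh power2_eq_square)
  then have "((\<lambda>t. (2 * pi * \<i>) * (h (circlepath 0 r t) / circlepath 0 r t))
     has_integral (2 * pi * \<i> * frechet_derivative g (at z) v)) {0..1}"
  proof (rule has_integral_eq[rotated])
    fix t :: real assume t: "t \<in> {0..1}"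
    have "vector_derivative (circlepath 0 r) (at t within {0..1}) = 2 * pi * \<i> * circlepath 0 r t"
      using vector_derivative_circlepath01[of t 0 r] t by (simp add: circlepath)
    then show "h (circlepath 0 r t) / circlepath 0 r t ^ 2 * vector_derivative (circlepath 0 r) (at t within {0..1})
      = (2 * pi * \<i>) * (h (circlepath 0 r t) / circlepath 0 r t)"
      using nz[of t] by (simp add: field_simps power2_eq_square)
  qed
  from has_integral_divide[OF this, of "2 * pi * \<i>"]
  have "((\<lambda>t. h (circlepath 0 r t) / circlepath 0 r t) has_integral
     (frechet_derivative g (at z) v)) {0..1}" by simp
  then show ?thesis by (simp add: h_def)
qed

text \<open>
  One radius serves for all centres near \<open>z0\<close>, so that the integral formula can be
  differentiated with respect to the centre.
\<close>

lemma circlepath_neighbourhood: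
  fixes z0 v :: "complex ^ 'n"
  assumes "open U" "z0 \<in> U"
  obtains e r where "e > 0" "r > 0" "ball z0 e \<subseteq> U"
    "\<And>z \<zeta>. z \<in> ball z0 e \<Longrightarrow> norm \<zeta> \<le> r \<Longrightarrow> z + \<zeta> *s v \<in> U"
proof -
  obtain e where e: "e > 0" "ball z0 e \<subseteq> U"
    using assms openE by blast
  define r where "r = e / 2 / (norm v + 1)"
  have "r > 0" unfolding r_def using e by (intro divide_pos_pos) (auto simp: add_nonneg_pos)
  have rv: "r * norm v < e / 2"
  proof -
    have "r * norm v < r * (norm v + 1)" using \<open>r > 0\<close> by simp
    also have "\<dots> = e / 2"
      unfolding r_def by (metis add_nonneg_pos less_irrefl nonzero_eq_divide_eq norm_ge_zero zero_less_one)
    finally show ?thesis .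
  qed
  show thesis
  proof (rule that[of "e/2" r])
    show "ball z0 (e/2) \<subseteq> U" using e by auto
    fix z \<zeta> assume z: "z \<in> ball z0 (e/2)" and \<zeta>: "norm (\<zeta>::complex) \<le> r"
    have "norm (\<zeta> *s v) \<le> r * norm v"
      by (simp add: norm_vector_smult mult_right_mono \<zeta>)
    then have "dist (z + \<zeta> *s v) z < e / 2" using rv by (simp add: dist_norm)
    with z have "dist z0 (z + \<zeta> *s v) < e"
      by (metis dist_commute dist_triangle_half_l mem_ball)
    then show "z + \<zeta> *s v \<in> U" using e by auto
  qed (use e \<open>r > 0\<close> in auto)
qed

lemma continuous_on_circlepath_shift:
  fixes v :: "complex ^ 'n"
  assumes "continuous_on U F" "\<And>z t. z \<in> B \<Longrightarrow> z + circlepath 0 r t *s v \<in> U"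
  shows "continuous_on (B \<times> cbox 0 1) (\<lambda>(z, t). F (z + circlepath 0 r t *s v))"
proof -
  have "continuous_on (B \<times> cbox 0 1) (\<lambda>p. fst p + circlepath 0 r (snd p) *s v)"
    unfolding circlepath
    by (intro continuous_intros bounded_linear.continuous_on[OF bounded_linear_smult])
  then show ?thesis unfolding case_prod_beta
    by (rule continuous_on_compose2[OF assms(1)]) (use assms(2) in auto)
qed

text \<open>
  A preliminary to differentiating under the integral sign, which needs a continuous
  derivative of the integrand.
\<close>

lemma holomorphic_several_derivative_continuous:
  fixes g :: "complex ^ 'n \<Rightarrow> complex"
  assumes hol: "holomorphic_several g U"
  shows "continuous_on U (\<lambda>z. frechet_derivative g (at z) v)"
proof (rule continuous_at_imp_continuous_on, rule ballI)
  fix z0 assume z0: "z0 \<in> U"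
  have opn: "open U" using hol by (simp add: holomorphic_several_def)
  obtain e r where er: "e > 0" "r > 0" "ball z0 e \<subseteq> U"
    "\<And>z \<zeta>. z \<in> ball z0 e \<Longrightarrow> norm \<zeta> \<le> r \<Longrightarrow> z + \<zeta> *s v \<in> U"
    by (rule circlepath_neighbourhood[OF opn z0, of v]) blast
  have nc: "norm (circlepath 0 r t) \<le> r" "circlepath 0 r t \<noteq> 0" for t
    using er by (auto simp: circlepath norm_mult)
  have "continuous_on (ball z0 e) (\<lambda>z. integral (cbox 0 1)
          (\<lambda>t. g (z + circlepath 0 r t *s v) / circlepath 0 r t))"
  proof (rule integral_continuous_on_param)
    show "continuous_on (ball z0 e \<times> cbox 0 1)
       (\<lambda>(z, t). g (z + circlepath 0 r t *s v) / circlepath 0 r t)"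
      using continuous_on_circlepath_shift[OF holomorphic_several_continuous_on[OF hol], of "ball z0 e" r v]
        er(4) nc
      unfolding case_prod_beta
      by (intro continuous_intros) (auto simp: circlepath intro!: continuous_intros)
  qed
  then have "continuous_on (ball z0 e) (\<lambda>z. frechet_derivative g (at z) v)"
    by (rule continuous_on_eq)
       (use cauchy_directional_derivative[OF hol er(2)] er(4) in \<open>blast intro: integral_unique\<close>)
  then show "continuous (at z0) (\<lambda>z. frechet_derivative g (at z) v)"
    using er(1) by (simp add: continuous_on_eq_continuous_at)
qed

text \<open>
  By differentiation under the integral sign in Cauchy's formula; complex linearity of the
  new derivative is inherited from the integrand.
\<close>

lemma holomorphic_several_derivative:
  fixes g :: "complex ^ 'n \<Rightarrow> complex"
  assumes hol: "holomorphic_several g U"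
  shows "holomorphic_several (\<lambda>z. frechet_derivative g (at z) v) U"
  unfolding holomorphic_several_def
proof (intro conjI ballI)
  show opn: "open U" using hol by (simp add: holomorphic_several_def)
  fix z0 assume z0: "z0 \<in> U"
  obtain e r where er: "e > 0" "r > 0" "ball z0 e \<subseteq> U"
    "\<And>z \<zeta>. z \<in> ball z0 e \<Longrightarrow> norm \<zeta> \<le> r \<Longrightarrow> z + \<zeta> *s v \<in> U"
    by (rule circlepath_neighbourhood[OF opn z0, of v]) blast
  have nc: "norm (circlepath 0 r t) \<le> r" "circlepath 0 r t \<noteq> 0" for t
    using er by (auto simp: circlepath norm_mult)
  define g' where "g' = (\<lambda>z. Blinfun (frechet_derivative g (at z)))"
  have g'_apply: "blinfun_apply (g' z) = frechet_derivative g (at z)" if "z \<in> U" for z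
    unfolding g'_def
    using holomorphic_several_has_derivative(1)[OF hol that]
    by (simp add: bounded_linear_Blinfun_apply has_derivative_bounded_linear)
  have cont_g': "continuous_on U g'"
    by (rule continuous_on_blinfun_componentwise)
       (metis (mono_tags, lifting) continuous_on_cong g'_apply
         holomorphic_several_derivative_continuous[OF hol])
  define fx where "fx = (\<lambda>z t. blinfun_mult_right (inverse (circlepath 0 r t)) o\<^sub>L g' (z + circlepath 0 r t *s v))"
  have fx_apply: "fx z t w = frechet_derivative g (at (z + circlepath 0 r t *s v)) w / circlepath 0 r t"
    if "z \<in> ball z0 e" for z t w
    unfolding fx_def using er(4)[OF that nc(1)] by (simp add: g'_apply divide_inverse mult.commute)
  have cont_fx: "continuous_on (ball z0 e \<times> cbox 0 1) (\<lambda>(z, t). fx z t)"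
  proof -
    have 1: "continuous_on (ball z0 e \<times> cbox 0 1) (\<lambda>p. g' (fst p + circlepath 0 r (snd p) *s v))"
      using continuous_on_circlepath_shift[OF cont_g', of "ball z0 e" r v] er(4) nc
      by (simp add: case_prod_beta)
    have 2: "continuous_on (ball z0 e \<times> cbox 0 1) (\<lambda>p. inverse (circlepath 0 r (snd p)))"
      by (intro continuous_intros) (auto simp: nc, auto simp: circlepath intro!: continuous_intros)
    show ?thesis unfolding fx_def case_prod_beta
      by (intro continuous_intros 1 bounded_linear.continuous_on[OF bounded_linear_blinfun_mult_right 2])
  qed
  have L: "((\<lambda>z. integral (cbox 0 1) (\<lambda>t. g (z + circlepath 0 r t *s v) / circlepath 0 r t))
     has_derivative integral (cbox 0 1) (fx z0)) (at z0 within ball z0 e)"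
  proof (rule leibniz_rule)
    fix z t assume z: "z \<in> ball z0 e" and t: "t \<in> cbox 0 (1::real)"
    have 1: "((\<lambda>z. z + circlepath 0 r t *s v) has_derivative (\<lambda>w. w)) (at z within ball z0 e)"
      by (auto intro!: derivative_eq_intros)
    have "((\<lambda>z. g (z + circlepath 0 r t *s v)) has_derivative
        frechet_derivative g (at (z + circlepath 0 r t *s v))) (at z within ball z0 e)"
      using has_derivative_compose[OF 1 holomorphic_several_has_derivative(1)[OF hol er(4)[OF z nc(1)]]]
      by simp
    then have "((\<lambda>z. g (z + circlepath 0 r t *s v) / circlepath 0 r t) has_derivative
        (\<lambda>w. frechet_derivative g (at (z + circlepath 0 r t *s v)) w / circlepath 0 r t)) (at z within ball z0 e)"
      unfolding divide_inverse by (rule has_derivative_mult_left)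
    moreover have "(\<lambda>w. frechet_derivative g (at (z + circlepath 0 r t *s v)) w / circlepath 0 r t) = blinfun_apply (fx z t)"
      using fx_apply[OF z] by auto
    ultimately show "((\<lambda>z. g (z + circlepath 0 r t *s v) / circlepath 0 r t) has_derivative
        blinfun_apply (fx z t)) (at z within ball z0 e)" by simp
  next
    fix z assume z: "z \<in> ball z0 e"
    show "(\<lambda>t. g (z + circlepath 0 r t *s v) / circlepath 0 r t) integrable_on cbox 0 1"
      using cauchy_directional_derivative[OF hol er(2)] er(4)[OF z] by blast
  qed (use cont_fx er in auto)
  have "((\<lambda>z. frechet_derivative g (at z) v) has_derivative integral (cbox 0 1) (fx z0)) (at z0 within ball z0 e)"
  proof (rule has_derivative_transform[OF _ _ L])
    fix z assume z: "z \<in> ball z0 e"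
    show "frechet_derivative g (at z) v = integral (cbox 0 1) (\<lambda>t. g (z + circlepath 0 r t *s v) / circlepath 0 r t)"
      using integral_unique[OF cauchy_directional_derivative[OF hol er(2) er(4)[OF z]]] by simp
  qed (use er in auto)
  then have D: "((\<lambda>z. frechet_derivative g (at z) v) has_derivative integral (cbox 0 1) (fx z0)) (at z0)"
    using er by (simp add: at_within_open[of z0 "ball z0 e"])
  have int: "fx z0 integrable_on cbox 0 1"
  proof (rule integrable_continuous)
    have "continuous_on (cbox 0 1) (\<lambda>t. (\<lambda>(z, t). fx z t) (z0, t))"
      by (rule continuous_on_compose2[OF cont_fx]) (use er in \<open>auto intro!: continuous_intros\<close>)
    then show "continuous_on (cbox 0 1) (fx z0)" by simp
  qed
  have "blinfun_apply (integral (cbox 0 1) (fx z0)) (c *s w) = c * blinfun_apply (integral (cbox 0 1) (fx z0)) w" for c w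
  proof -
    have ap: "blinfun_apply (integral (cbox 0 1) (fx z0)) w = integral (cbox 0 1) (\<lambda>t. fx z0 t w)" for w
      by (rule blinfun_apply_integral[OF int])
    have "(\<lambda>t. fx z0 t (c *s w)) = (\<lambda>t. c * fx z0 t w)"
      using fx_apply[of z0] er holomorphic_several_has_derivative(2)[OF hol er(4)[OF _ nc(1)]]
      by auto
    then show ?thesis unfolding ap by simp
  qed
  with D show "\<exists>g'. ((\<lambda>z. frechet_derivative g (at z) v) has_derivative g') (at z0) \<and>
      (\<forall>c w. g' (c *s w) = c * g' w)" by blast
qed

lemma bounded_linear_cvec: "bounded_linear cvec"
proof -
  have "linear cvec"
    by (rule linearI; simp add: cvec_def vec_eq_iff; simp add: scaleR_conv_of_real)
  then show ?thesis by (simp add: linear_conv_bounded_linear)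
qed

text \<open>
  The complex derivative of the extension maps real vectors to real numbers at real points,
  because it extends a real-valued function there. So it is itself an extension of the real
  derivative, and the class of real analytic functions is closed under directional
  derivatives.
\<close>

lemma real_analytic_derivative:
  fixes g :: "real ^ 'n \<Rightarrow> real"
  assumes "real_analytic g"
  shows "(g has_derivative frechet_derivative g (at x)) (at x)"
    and "real_analytic (\<lambda>x. frechet_derivative g (at x) v)"
proof -
  obtain U h where U: "range cvec \<subseteq> U" and hol: "holomorphic_several h U"
    and h: "\<And>x. h (cvec x) = complex_of_real (g x)"
    using assms unfolding real_analytic_def by blast
  have hd: "((\<lambda>x. complex_of_real (g x)) has_derivative
      (\<lambda>v. frechet_derivative h (at (cvec x)) (cvec v))) (at x)" for x
    using has_derivative_compose[OF bounded_linear.has_derivative[OF bounded_linear_cvec has_derivative_ident]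
        holomorphic_several_has_derivative(1)[OF hol, of "cvec x"]] U
    by (auto simp: h)
  have gd: "(g has_derivative (\<lambda>v. Re (frechet_derivative h (at (cvec x)) (cvec v)))) (at x)" for x
    using bounded_linear.has_derivative[OF bounded_linear_Re hd] by simp
  then have fg: "frechet_derivative g (at x) = (\<lambda>v. Re (frechet_derivative h (at (cvec x)) (cvec v)))" for x
    using frechet_derivative_at by metis
  show gd': "(g has_derivative frechet_derivative g (at x)) (at x)" for x
    unfolding fg by (rule gd)
  have "(\<lambda>v. frechet_derivative h (at (cvec x)) (cvec v)) = (\<lambda>v. complex_of_real (frechet_derivative g (at x) v))" for x
    by (rule has_derivative_unique[OF hd]) (rule bounded_linear.has_derivative[OF bounded_linear_of_real gd'])
  then have "frechet_derivative h (at (cvec x)) (cvec v) = complex_of_real (frechet_derivative g (at x) v)" for x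
    by metis
  then show "real_analytic (\<lambda>x. frechet_derivative g (at x) v)"
    unfolding real_analytic_def using U holomorphic_several_derivative[OF hol] by blast
qed

lemma real_analytic_imp_smooth: 
  fixes g :: "real ^ 'n \<Rightarrow> real"
  assumes "real_analytic g"
  shows "smooth_fun g"
proof -
  have "Ck k g" for k
    using assms
  proof (induction k arbitrary: g)
    case 0
    then show ?case
      by (auto intro!: continuous_at_imp_continuous_on has_derivative_continuous real_analytic_derivative(1))
  next
    case (Suc k)
    then show ?case
      using real_analytic_derivative[OF Suc.prems] by (auto simp: differentiable_def)
  qed
  then show ?thesis by (simp add: smooth_fun_def)
qed

section \<open>Calculus of smooth functions\<close>

lemma smooth_fun_has_derivative:
  assumes "smooth_fun g"
  shows "(g has_derivative frechet_derivative g (at x)) (at x)"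
proof -
  have "Ck (Suc 0) g" using assms by (simp only: smooth_fun_def)
  then show ?thesis using frechet_derivative_works by auto
qed

lemma smooth_fun_derivative:
  assumes "smooth_fun g"
  shows "smooth_fun (\<lambda>x. frechet_derivative g (at x) v)"
proof -
  have "Ck (Suc k) g" for k using assms by (simp only: smooth_fun_def)
  then show ?thesis by (simp add: smooth_fun_def)
qed

lemma smooth_fun_continuous_on: "smooth_fun g \<Longrightarrow> continuous_on S g"
  by (metis Ck.simps(1) continuous_on_subset smooth_fun_def top_greatest)

lemma has_derivative_vec:
  fixes g :: "'m::finite \<Rightarrow> 'a::real_normed_vector \<Rightarrow> 'b::real_normed_vector"
  assumes "\<And>i. (g i has_derivative g' i) (at x)"
  shows "((\<lambda>x. \<chi> i. g i x) has_derivative (\<lambda>v. \<chi> i. g' i v)) (at x)"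
proof (rule has_derivativeI)
  have bl: "bounded_linear (g' i)" for i using assms has_derivative_bounded_linear by blast
  obtain B where B: "\<And>i v. norm (g' i v) \<le> norm v * B i"
    using bounded_linear.bounded[OF bl] by metis
  show "bounded_linear (\<lambda>v. \<chi> i. g' i v)"
  proof (rule bounded_linear_intro[where K="\<Sum>i\<in>UNIV. B i"])
    fix v :: 'a
    have "norm (\<chi> i. g' i v) \<le> (\<Sum>i\<in>UNIV. norm (g' i v))"
      unfolding norm_vec_def by (simp add: L2_set_le_sum)
    also have "\<dots> \<le> norm v * (\<Sum>i\<in>UNIV. B i)"
      unfolding sum_distrib_left by (rule sum_mono) (rule B)
    finally show "norm (\<chi> i. g' i v) \<le> norm v * (\<Sum>i\<in>UNIV. B i)" .
  qed (simp_all add: vec_eq_iff linear_simps[OF bl])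
  show "((\<lambda>y. ((\<chi> i. g i y) - (\<chi> i. g i x) - (\<chi> i. g' i (y - x))) /\<^sub>R norm (y - x)) \<longlongrightarrow> 0) (at x)"
    by (rule vec_tendstoI) (use assms in \<open>simp add: has_derivative_at_within\<close>)
qed

lemma smooth_fun_vec:
  fixes g :: "'a::real_normed_vector \<Rightarrow> 'b::real_normed_vector ^ 'm"
  assumes "\<And>i. smooth_fun (\<lambda>x. g x $ i)"
  shows "smooth_fun g"
proof -
  have "Ck k g" if "\<And>i. smooth_fun (\<lambda>x. g x $ i)" for k and g :: "'a \<Rightarrow> 'b ^ 'm"
    using that
  proof (induction k arbitrary: g)
    case 0
    have "continuous_on UNIV (\<lambda>x. \<chi> i. g x $ i)"
      by (intro continuous_on_vec_lambda smooth_fun_continuous_on 0)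
    then show ?case by simp
  next
    case (Suc k)
    have "(g has_derivative (\<lambda>v. \<chi> i. frechet_derivative (\<lambda>x. g x $ i) (at x) v)) (at x)" for x
    proof -
      have "((\<lambda>x. \<chi> i. g x $ i) has_derivative (\<lambda>v. \<chi> i. frechet_derivative (\<lambda>x. g x $ i) (at x) v)) (at x)"
        by (rule has_derivative_vec) (rule smooth_fun_has_derivative[OF Suc.prems])
      then show ?thesis by simp
    qed
    moreover from this have "frechet_derivative g (at x) = (\<lambda>v. \<chi> i. frechet_derivative (\<lambda>x. g x $ i) (at x) v)" for x
      using frechet_derivative_at by metis
    moreover have "Ck k (\<lambda>x. \<chi> i. frechet_derivative (\<lambda>x. g x $ i) (at x) v)" for v
      by (rule Suc.IH) (simp add: smooth_fun_derivative[OF Suc.prems])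
    ultimately show ?case by (auto simp: differentiable_def)
  qed
  with assms show ?thesis by (auto simp: smooth_fun_def)
qed

text \<open>
  The mean value theorem applied once in each direction. The left-hand side is symmetric in
  \<open>v\<close> and \<open>w\<close>, which is why mixed derivatives agree.
\<close>

lemma second_difference:
  fixes \<phi> :: "'a::real_normed_vector \<Rightarrow> real"
  assumes sm: "smooth_fun \<phi>" and h: "h > 0"
  obtains s t where "0 < s" "s < h" "0 < t" "t < h"
    "\<phi> (x + h *\<^sub>R v + h *\<^sub>R w) - \<phi> (x + h *\<^sub>R v) - \<phi> (x + h *\<^sub>R w) + \<phi> x =
       h * h * frechet_derivative (\<lambda>x. frechet_derivative \<phi> (at x) v) (at (x + s *\<^sub>R v + t *\<^sub>R w)) w"
proof -
  let ?\<phi>v = "\<lambda>x. frechet_derivative \<phi> (at x) v"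
  have line: "((\<lambda>s. \<psi> (y + s *\<^sub>R u)) has_real_derivative frechet_derivative \<psi> (at (y + s *\<^sub>R u)) u) (at s)"
    if "smooth_fun \<psi>" for \<psi> :: "'a \<Rightarrow> real" and y u s
  proof -
    have 1: "((\<lambda>s. y + s *\<^sub>R u) has_derivative (\<lambda>c. c *\<^sub>R u)) (at s)"
      by (auto intro!: derivative_eq_intros)
    have "((\<lambda>s. \<psi> (y + s *\<^sub>R u)) has_derivative (\<lambda>c. frechet_derivative \<psi> (at (y + s *\<^sub>R u)) (c *\<^sub>R u))) (at s)"
      by (rule has_derivative_compose[OF 1 smooth_fun_has_derivative[OF that]])
    moreover have "frechet_derivative \<psi> (at (y + s *\<^sub>R u)) (c *\<^sub>R u) = frechet_derivative \<psi> (at (y + s *\<^sub>R u)) u * c" for c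
      using linear_scale[OF has_derivative_linear[OF smooth_fun_has_derivative[OF that]]] by (simp add: mult.commute)
    ultimately show ?thesis by (simp add: has_field_derivative_def)
  qed
  have D: "((\<lambda>s. \<phi> ((x + h *\<^sub>R w) + s *\<^sub>R v) - \<phi> (x + s *\<^sub>R v)) has_real_derivative
      (?\<phi>v ((x + h *\<^sub>R w) + s *\<^sub>R v) - ?\<phi>v (x + s *\<^sub>R v))) (at s)" for s
    by (rule DERIV_diff[OF line[OF sm] line[OF sm]])
  obtain s where s: "0 < s" "s < h" "(\<phi> ((x + h *\<^sub>R w) + h *\<^sub>R v) - \<phi> (x + h *\<^sub>R v)) - (\<phi> ((x + h *\<^sub>R w) + 0 *\<^sub>R v) - \<phi> (x + 0 *\<^sub>R v))
     = (h - 0) * (?\<phi>v ((x + h *\<^sub>R w) + s *\<^sub>R v) - ?\<phi>v (x + s *\<^sub>R v))"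
    using MVT2[OF h, of "\<lambda>s. \<phi> ((x + h *\<^sub>R w) + s *\<^sub>R v) - \<phi> (x + s *\<^sub>R v)", OF D] by blast
  obtain t where t: "0 < t" "t < h" "?\<phi>v ((x + s *\<^sub>R v) + h *\<^sub>R w) - ?\<phi>v ((x + s *\<^sub>R v) + 0 *\<^sub>R w) =
      (h - 0) * frechet_derivative ?\<phi>v (at (x + s *\<^sub>R v + t *\<^sub>R w)) w"
    using MVT2[OF h, of "\<lambda>t. ?\<phi>v ((x + s *\<^sub>R v) + t *\<^sub>R w)", OF line[OF smooth_fun_derivative[OF sm]]] by blast
  show thesis
    by (rule that[OF s(1,2) t(1,2)]) (use s(3) t(3) in \<open>simp add: algebra_simps\<close>)
qed

lemma symmetric_second_derivative_real:
  fixes \<phi> :: "'a::real_normed_vector \<Rightarrow> real"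
  assumes sm: "smooth_fun \<phi>"
  shows "frechet_derivative (\<lambda>x. frechet_derivative \<phi> (at x) v) (at x) w =
         frechet_derivative (\<lambda>x. frechet_derivative \<phi> (at x) w) (at x) v"
proof -
  define A where "A = (\<lambda>v w x. frechet_derivative (\<lambda>x. frechet_derivative \<phi> (at x) v) (at x) w)"
  have cont: "\<exists>d>0. \<forall>y. dist y x < d \<longrightarrow> \<bar>A v w y - A v w x\<bar> < e" if "e > 0" for v w e
  proof -
    have "isCont (A v w) x"
      using smooth_fun_continuous_on[OF smooth_fun_derivative[OF smooth_fun_derivative[OF sm]], of UNIV v w]
      by (simp add: A_def continuous_on_eq_continuous_at)
    then show ?thesis using that by (auto simp: continuous_at_eps_delta dist_real_def)
  qed
  have "\<bar>A v w x - A w v x\<bar> \<le> 0 + e" if e: "e > 0" for e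
  proof -
    obtain d where d: "d > 0" "\<And>y. dist y x < d \<Longrightarrow> \<bar>A v w y - A v w x\<bar> < e / 2"
       "\<And>y. dist y x < d \<Longrightarrow> \<bar>A w v y - A w v x\<bar> < e / 2"
    proof -
      obtain d1 where d1: "d1 > 0" "\<And>y. dist y x < d1 \<Longrightarrow> \<bar>A v w y - A v w x\<bar> < e / 2"
        using cont[of "e/2" v w] e by auto
      obtain d2 where d2: "d2 > 0" "\<And>y. dist y x < d2 \<Longrightarrow> \<bar>A w v y - A w v x\<bar> < e / 2"
        using cont[of "e/2" w v] e by auto
      show thesis by (rule that[of "min d1 d2"]) (use d1 d2 in auto)
    qed
    \<comment> \<open>All intermediate points of both second differences are then within \<open>d\<close> of \<open>x\<close>.\<close>
    define h where "h = d / (norm v + norm w + 1)"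
    have den: "norm v + norm w + 1 > 0" by (simp add: add_nonneg_pos)
    have h: "h > 0" "h * (norm v + norm w) < d"
      using d(1) den by (auto simp: h_def field_simps)
    have close: "dist (x + s *\<^sub>R v + t *\<^sub>R w) x < d" if "0 < s" "s < h" "0 < t" "t < h" for s t
    proof -
      have "norm (s *\<^sub>R v + t *\<^sub>R w) \<le> s * norm v + t * norm w"
        using norm_triangle_ineq[of "s *\<^sub>R v" "t *\<^sub>R w"] that by simp
      also have "\<dots> \<le> h * norm v + h * norm w"
        by (intro add_mono mult_right_mono) (use that in auto)
      finally show ?thesis using h by (simp add: dist_norm algebra_simps)
    qed
    obtain s t where st: "0 < s" "s < h" "0 < t" "t < h"
      "\<phi> (x + h *\<^sub>R v + h *\<^sub>R w) - \<phi> (x + h *\<^sub>R v) - \<phi> (x + h *\<^sub>R w) + \<phi> x = h * h * A v w (x + s *\<^sub>R v + t *\<^sub>R w)"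
      unfolding A_def by (rule second_difference[OF sm h(1)]) blast
    obtain s' t' where st': "0 < s'" "s' < h" "0 < t'" "t' < h"
      "\<phi> (x + h *\<^sub>R w + h *\<^sub>R v) - \<phi> (x + h *\<^sub>R w) - \<phi> (x + h *\<^sub>R v) + \<phi> x = h * h * A w v (x + s' *\<^sub>R w + t' *\<^sub>R v)"
      unfolding A_def by (rule second_difference[OF sm h(1)]) blast
    have "x + h *\<^sub>R w + h *\<^sub>R v = x + h *\<^sub>R v + h *\<^sub>R w" by (simp add: algebra_simps)
    from st'(5)[unfolded this] have "h * h * A v w (x + s *\<^sub>R v + t *\<^sub>R w) = h * h * A w v (x + s' *\<^sub>R w + t' *\<^sub>R v)"
      using st(5) by linarith
    then have eq: "A v w (x + s *\<^sub>R v + t *\<^sub>R w) = A w v (x + s' *\<^sub>R w + t' *\<^sub>R v)" using h(1) by simp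
    have "dist (x + s' *\<^sub>R w + t' *\<^sub>R v) x < d"
      using close[OF st'(3,4,1,2)] by (simp add: algebra_simps)
    from d(3)[OF this] d(2)[OF close[OF st(1-4)]] eq show ?thesis by linarith
  qed
  then have "\<bar>A v w x - A w v x\<bar> \<le> 0" by (rule field_le_epsilon)
  then show ?thesis by (simp add: A_def)
qed

lemma frechet_derivative_bounded_linear:
  assumes "bounded_linear L" "smooth_fun g"
  shows "frechet_derivative (\<lambda>x. L (g x)) (at x) = (\<lambda>v. L (frechet_derivative g (at x) v))"
  using bounded_linear.has_derivative[OF assms(1) smooth_fun_has_derivative[OF assms(2)]]
    frechet_derivative_at by metis

lemma smooth_fun_bounded_linear:
  assumes L: "bounded_linear L" and "smooth_fun g"
  shows "smooth_fun (\<lambda>x. L (g x))"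
proof -
  have "Ck k (\<lambda>x. L (g x))" for k
    using assms(2)
  proof (induction k arbitrary: g)
    case 0
    then show ?case by (simp add: bounded_linear.continuous_on[OF L] smooth_fun_continuous_on)
  next
    case (Suc k)
    have "(\<lambda>x. L (g x)) differentiable at x" for x
      using bounded_linear.has_derivative[OF L smooth_fun_has_derivative[OF Suc.prems]]
      by (auto simp: differentiable_def)
    then show ?case
      using Suc.IH[OF smooth_fun_derivative[OF Suc.prems]] frechet_derivative_bounded_linear[OF L Suc.prems]
      by simp
  qed
  then show ?thesis by (simp add: smooth_fun_def)
qed

lemma symmetric_second_derivative:
  fixes g :: "'a::real_normed_vector \<Rightarrow> 'b::euclidean_space"
  assumes sm: "smooth_fun g"
  shows "frechet_derivative (\<lambda>x. frechet_derivative g (at x) v) (at x) w =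
         frechet_derivative (\<lambda>x. frechet_derivative g (at x) w) (at x) v"
proof (rule euclidean_eqI)
  fix b :: 'b
  have "frechet_derivative (\<lambda>x. frechet_derivative g (at x) v) (at x) w \<bullet> b =
      frechet_derivative (\<lambda>x. frechet_derivative (\<lambda>x. g x \<bullet> b) (at x) v) (at x) w" for v w
    by (simp add: frechet_derivative_bounded_linear[OF bounded_linear_inner_left] sm smooth_fun_derivative)
  then show "frechet_derivative (\<lambda>x. frechet_derivative g (at x) v) (at x) w \<bullet> b =
      frechet_derivative (\<lambda>x. frechet_derivative g (at x) w) (at x) v \<bullet> b"
    using symmetric_second_derivative_real[OF smooth_fun_bounded_linear[OF bounded_linear_inner_left sm]]
    by simp
qed

text \<open>
  Directional derivatives are continuous one direction at a time; in finite dimension this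
  already gives continuity in the operator norm, from which uniform estimates on compact
  sets follow.
\<close>

lemma smooth_fun_blinfun_derivative:
  fixes g :: "'a::euclidean_space \<Rightarrow> 'b::real_normed_vector"
  assumes sm: "smooth_fun g"
  obtains g' where "continuous_on UNIV g'" "\<And>x. blinfun_apply (g' x) = frechet_derivative g (at x)"
    "\<And>x. (g has_derivative blinfun_apply (g' x)) (at x)"
proof -
  define g' where "g' = (\<lambda>x. Blinfun (frechet_derivative g (at x)))"
  have ap: "blinfun_apply (g' x) = frechet_derivative g (at x)" for x
    unfolding g'_def
    by (rule bounded_linear_Blinfun_apply[OF has_derivative_bounded_linear[OF smooth_fun_has_derivative[OF sm]]])
  have "continuous_on UNIV g'"
    by (rule continuous_on_blinfun_componentwise)
       (simp add: ap smooth_fun_continuous_on[OF smooth_fun_derivative[OF sm]])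
  then show thesis using that ap smooth_fun_has_derivative[OF sm] by simp
qed

section \<open>Flows of locally Lipschitz vector fields\<close>

text \<open>
  \<open>\<parallel>y\<parallel>\<^sup>2 exp (- 2 L t)\<close> is nonincreasing.
\<close>

lemma gronwall_exponential_bound:
  fixes y :: "real \<Rightarrow> 'a::real_inner"
  assumes der: "\<And>t. t \<in> {0..T} \<Longrightarrow> (y has_vector_derivative y' t) (at t)"
    and bound: "\<And>t. t \<in> {0..T} \<Longrightarrow> norm (y' t) \<le> L * norm (y t)"
    and t: "t \<in> {0..T}"
  shows "norm (y t) \<le> norm (y 0) * exp (L * t)"
proof -
  define E where "E = (\<lambda>s. (y s \<bullet> y s) * exp (- 2 * L * s))"
  have "E t \<le> E 0"
  proof (rule DERIV_nonpos_imp_nonincreasing[where f=E and a=0 and b=t])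
    fix s assume s: "0 \<le> s" "s \<le> t"
    have "((\<lambda>s. y s \<bullet> y s) has_vector_derivative (y s \<bullet> y' s + y' s \<bullet> y s)) (at s)"
      by (rule bounded_bilinear.has_vector_derivative[OF bounded_bilinear_inner])
         (use der s t in auto)
    then have "((\<lambda>s. y s \<bullet> y s) has_real_derivative 2 * (y s \<bullet> y' s)) (at s)"
      by (simp add: has_real_derivative_iff_has_vector_derivative inner_commute)
    then have "(E has_real_derivative
        2 * (y s \<bullet> y' s) * exp (- 2 * L * s) + exp (- 2 * L * s) * (- 2 * L) * (y s \<bullet> y s)) (at s)"
      unfolding E_def by (auto intro!: derivative_eq_intros)
    moreover have "y s \<bullet> y' s \<le> L * (y s \<bullet> y s)"
    proof -
      have "y s \<bullet> y' s \<le> norm (y s) * norm (y' s)" by (rule norm_cauchy_schwarz)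
      also have "\<dots> \<le> norm (y s) * (L * norm (y s))"
        using bound s t by (intro mult_left_mono) auto
      finally show ?thesis by (simp add: dot_square_norm power2_eq_square algebra_simps)
    qed
    then have "2 * (y s \<bullet> y' s) * exp (- 2 * L * s) + exp (- 2 * L * s) * (- 2 * L) * (y s \<bullet> y s) \<le> 0"
    proof -
      have "2 * exp (- 2 * L * s) * (y s \<bullet> y' s - L * (y s \<bullet> y s)) \<le> 0"
        using \<open>y s \<bullet> y' s \<le> L * (y s \<bullet> y s)\<close> by (intro mult_nonneg_nonpos) auto
      then show ?thesis by (simp add: algebra_simps)
    qed
    ultimately show "\<exists>d. (E has_real_derivative d) (at s) \<and> d \<le> 0" by blast
  qed (use t in auto)
  then have "(norm (y t))\<^sup>2 * exp (- 2 * L * t) \<le> (norm (y 0))\<^sup>2"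
    by (simp add: E_def dot_square_norm)
  then have "(norm (y t))\<^sup>2 * exp (- 2 * L * t) * exp (2 * L * t) \<le> (norm (y 0))\<^sup>2 * exp (2 * L * t)"
    by (rule mult_right_mono) simp
  moreover have "(norm (y t))\<^sup>2 * exp (- 2 * L * t) * exp (2 * L * t) = (norm (y t))\<^sup>2"
    by (simp add: mult.assoc flip: exp_add)
  moreover have "exp (2 * L * t) = (exp (L * t))\<^sup>2"
    by (simp add: power2_eq_square flip: exp_add)
  ultimately have "(norm (y t))\<^sup>2 \<le> (norm (y 0) * exp (L * t))\<^sup>2"
    by (simp only: power_mult_distrib)
  then show ?thesis by (rule power2_le_imp_le) simp
qed

text \<open>
  The differential inequality is only known while \<open>y\<close> stays in the unit ball. It cannot
  leave: at the first time with \<open>\<parallel>y\<parallel> = 1\<close> the exponential bound would still give a value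
  below \<open>1\<close>. This is how orbits starting close to a given one are kept close, with a vector
  field that is only locally Lipschitz.
\<close>

lemma gronwall_in_unit_tube:
  fixes y :: "real \<Rightarrow> 'a::real_inner"
  assumes der: "\<And>t. t \<in> {0..T} \<Longrightarrow> (y has_vector_derivative y' t) (at t)"
    and bound: "\<And>t. t \<in> {0..T} \<Longrightarrow> norm (y t) \<le> 1 \<Longrightarrow> norm (y' t) \<le> L * norm (y t)"
    and L: "L \<ge> 0" and small: "norm (y 0) * exp (L * T) < 1"
    and t: "t \<in> {0..T}"
  shows "norm (y t) \<le> norm (y 0) * exp (L * t)" "norm (y t) \<le> 1"
proof -
  have cont: "continuous_on {0..T} (\<lambda>s. norm (y s))"
    using der by (intro continuous_on_norm continuous_at_imp_continuous_on ballI)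
      (auto dest: has_vector_derivative_continuous)
  have y0: "norm (y 0) < 1"
  proof -
    have "norm (y 0) * 1 \<le> norm (y 0) * exp (L * T)"
      using t L by (intro mult_left_mono) auto
    then show ?thesis using small by simp
  qed
  have no1: "norm (y s) \<noteq> 1" if "s \<in> {0..T}" for s
  proof
    assume "norm (y s) = 1"
    define B where "B = {s \<in> {0..T}. norm (y s) = 1}"
    have "B = {0..T} \<inter> (\<lambda>s. norm (y s)) -` {1}" by (auto simp: B_def)
    then have cB: "compact B"
      using continuous_closed_preimage[OF cont, of "{1}"]
      by (metis closed_atLeastAtMost closed_singleton compact_Icc compact_Int_closed inf.idem inf_assoc)
    have "B \<noteq> {}" using that \<open>norm (y s) = 1\<close> by (auto simp: B_def)
    obtain \<tau> where \<tau>: "\<tau> \<in> B" "\<And>s. s \<in> B \<Longrightarrow> \<tau> \<le> s"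
      using compact_attains_inf[OF cB \<open>B \<noteq> {}\<close>] by auto
    have le1: "norm (y r) \<le> 1" if r: "r \<in> {0..\<tau>}" for r
    proof (rule ccontr)
      assume "\<not> norm (y r) \<le> 1"
      then obtain x where "0 \<le> x" "x \<le> r" "norm (y x) = 1"
        using IVT'[of "\<lambda>s. norm (y s)" 0 1 r] y0 r \<tau>(1) continuous_on_subset[OF cont, of "{0..r}"]
        by (auto simp: B_def)
      moreover from this have "x \<in> B" using r \<tau>(1) by (auto simp: B_def)
      ultimately have "x = r" using \<tau>(2)[of x] r by auto
      then show False using \<open>norm (y x) = 1\<close> \<open>\<not> norm (y r) \<le> 1\<close> by simp
    qed
    have "norm (y \<tau>) \<le> norm (y 0) * exp (L * \<tau>)"
      by (rule gronwall_exponential_bound[where T=\<tau> and y'=y'])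
         (use \<tau>(1) le1 der bound in \<open>auto simp: B_def\<close>)
    also have "\<dots> \<le> norm (y 0) * exp (L * T)"
      using \<tau>(1) L by (intro mult_left_mono) (auto simp: B_def mult_left_mono)
    finally show False using small \<tau>(1) by (simp add: B_def)
  qed
  have lt1: "norm (y s) < 1" if s: "s \<in> {0..T}" for s
  proof (rule ccontr)
    assume "\<not> norm (y s) < 1"
    then obtain x where "0 \<le> x" "x \<le> s" "norm (y x) = 1"
      using IVT'[of "\<lambda>s. norm (y s)" 0 1 s] y0 s continuous_on_subset[OF cont, of "{0..s}"]
      by auto
    then show False using no1[of x] s by auto
  qed
  show "norm (y t) \<le> 1" using lt1[OF t] by simp
  show "norm (y t) \<le> norm (y 0) * exp (L * t)"
    by (rule gronwall_exponential_bound[OF der _ t]) (use bound lt1 in \<open>auto simp: less_imp_le\<close>)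
qed

definition lipschitz_on_balls :: "('a::real_normed_vector \<Rightarrow> 'b::real_normed_vector) \<Rightarrow> bool" where
  "lipschitz_on_balls f \<longleftrightarrow> (\<forall>R. \<exists>L\<ge>0. \<forall>x\<in>cball 0 R. \<forall>y\<in>cball 0 R. norm (f x - f y) \<le> L * norm (x - y))"

lemma smooth_fun_lipschitz_on_balls:
  fixes g :: "'a::euclidean_space \<Rightarrow> 'b::real_normed_vector"
  assumes "smooth_fun g"
  shows "lipschitz_on_balls g"
  unfolding lipschitz_on_balls_def
proof
  fix R :: real
  obtain g' where g': "continuous_on UNIV g'" "\<And>x. (g has_derivative blinfun_apply (g' x)) (at x)"
    using smooth_fun_blinfun_derivative[OF assms] by metis
  have "compact (g' ` cball 0 R)"
    by (intro compact_continuous_image continuous_on_subset[OF g'(1)]) auto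
  then obtain B where B: "B > 0" "\<And>x. x \<in> cball 0 R \<Longrightarrow> norm (g' x) \<le> B"
    using bounded_pos[of "g' ` cball 0 R"] compact_imp_bounded by auto
  have "norm (g x - g y) \<le> B * norm (x - y)" if "x \<in> cball 0 R" "y \<in> cball 0 R" for x y
    using that
    by (intro differentiable_bound[where S="cball 0 R" and f'="\<lambda>x. blinfun_apply (g' x)"])
       (auto simp: has_derivative_at_withinI[OF g'(2)] norm_blinfun.rep_eq[symmetric] B(2))
  then show "\<exists>L\<ge>0. \<forall>x\<in>cball 0 R. \<forall>y\<in>cball 0 R. norm (g x - g y) \<le> L * norm (x - y)"
    using B(1) by (intro exI[of _ B]) auto
qed

lemma smooth_fun_uniform_linearization:
  fixes g :: "'a::euclidean_space \<Rightarrow> 'b::real_normed_vector"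
  assumes "smooth_fun g" "\<epsilon> > 0"
  obtains \<delta> where "\<delta> > 0"
    "\<And>(p :: 'a) y. p \<in> cball 0 R \<Longrightarrow> norm y < \<delta> \<Longrightarrow>
       norm (g (p + y) - g p - frechet_derivative g (at p) y) \<le> \<epsilon> * norm y"
proof -
  obtain g' where g': "continuous_on UNIV g'" "\<And>x. blinfun_apply (g' x) = frechet_derivative g (at x)"
      "\<And>x. (g has_derivative blinfun_apply (g' x)) (at x)"
    using smooth_fun_blinfun_derivative[OF assms(1)] by metis
  have "uniformly_continuous_on (cball 0 (R + 1)) g'"
    by (intro compact_uniformly_continuous continuous_on_subset[OF g'(1)]) auto
  then obtain d where d: "d > 0" "\<And>(p :: 'a) q. p \<in> cball 0 (R + 1) \<Longrightarrow> q \<in> cball 0 (R + 1) \<Longrightarrow> dist q p < d \<Longrightarrow> dist (g' q) (g' p) < \<epsilon>"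
    using assms(2) unfolding uniformly_continuous_on_def by metis
  show thesis
  proof (rule that[of "min d 1"])
    fix p y :: 'a assume p: "p \<in> cball 0 R" and y: "norm y < min d 1"
    have "norm (g (p + y) - g p - blinfun_apply (g' p) ((p + y) - p)) \<le> norm ((p + y) - p) * \<epsilon>"
    proof (rule differentiable_bound_linearization[where S="cball p (norm y)" and f'="\<lambda>x. blinfun_apply (g' x)"])
      fix t :: real assume "t \<in> {0..1}"
      then show "p + t *\<^sub>R (p + y - p) \<in> cball p (norm y)"
        by (auto simp: dist_norm mult_left_le_one_le)
    next
      fix x assume x: "x \<in> cball p (norm y)"
      have "norm x \<le> norm p + norm y" using x by (metis add.commute add_le_cancel_left dist_commute dist_norm dist_triangle_le mem_cball norm_triangle_sub order_trans)
      then have "dist (g' x) (g' p) < \<epsilon>"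
        using x p y by (intro d(2)) (auto simp: dist_commute)
      then show "onorm (blinfun_apply (g' x) - blinfun_apply (g' p)) \<le> \<epsilon>"
        by (simp add: dist_norm norm_blinfun.rep_eq minus_blinfun.rep_eq fun_diff_def)
    qed (use g'(3) in \<open>auto intro: has_derivative_at_withinI\<close>)
    then show "norm (g (p + y) - g p - frechet_derivative g (at p) y) \<le> \<epsilon> * norm y"
      by (simp add: g'(2) mult.commute)
  qed (use d in auto)
qed

lemma ode_unique_forward:
  fixes u v :: "real \<Rightarrow> 'a::euclidean_space"
  assumes lip: "lipschitz_on_balls f"
    and u: "\<And>t. (u has_vector_derivative f (u t)) (at t)"
    and v: "\<And>t. (v has_vector_derivative f (v t)) (at t)"
    and 0: "u 0 = v 0" and t: "t \<ge> 0"
  shows "u t = v t"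
proof -
  have cont: "continuous_on {0..t} u" "continuous_on {0..t} v"
    using u v has_vector_derivative_continuous by (blast intro: continuous_at_imp_continuous_on)+
  then have "bounded (u ` {0..t} \<union> v ` {0..t})"
    by (simp add: compact_continuous_image compact_imp_bounded)
  then obtain R where R: "\<And>s. s \<in> {0..t} \<Longrightarrow> u s \<in> cball 0 R \<and> v s \<in> cball 0 R"
    unfolding bounded_iff by fastforce
  obtain L where L: "\<And>x y. x \<in> cball 0 R \<Longrightarrow> y \<in> cball 0 R \<Longrightarrow> norm (f x - f y) \<le> L * norm (x - y)"
    using lip unfolding lipschitz_on_balls_def by metis
  have "norm (u t - v t) \<le> norm (u 0 - v 0) * exp (L * t)"
    by (rule gronwall_exponential_bound[where T=t and y'="\<lambda>s. f (u s) - f (v s)"])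
       (use t R L in \<open>auto intro!: has_vector_derivative_diff u v\<close>)
  then show ?thesis using 0 by simp
qed

lemma has_vector_derivative_affine_time:
  assumes "\<And>t. (u has_vector_derivative u' t) (at t)"
  shows "((\<lambda>t. u (c * t + b)) has_vector_derivative c *\<^sub>R u' (c * t + b)) (at t)"
proof -
  have "((\<lambda>t. c * t + b) has_vector_derivative c) (at t)"
    by (auto intro!: derivative_eq_intros simp flip: has_real_derivative_iff_has_vector_derivative)
  from vector_diff_chain_at[OF this assms] show ?thesis by (simp add: o_def)
qed

text \<open>
  Backward uniqueness is forward uniqueness for the reversed field.
\<close>

lemma ode_unique:
  fixes u v :: "real \<Rightarrow> 'a::euclidean_space"
  assumes lip: "lipschitz_on_balls f"
    and u: "\<And>t. (u has_vector_derivative f (u t)) (at t)"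
    and v: "\<And>t. (v has_vector_derivative f (v t)) (at t)"
    and 0: "u 0 = v 0"
  shows "u t = v t"
proof (cases "t \<ge> 0")
  case True then show ?thesis using ode_unique_forward[OF lip u v 0] by simp
next
  case False
  have "lipschitz_on_balls (\<lambda>x. - f x)"
    using lip unfolding lipschitz_on_balls_def by (simp add: norm_minus_commute)
  moreover have "((\<lambda>t. u (- t)) has_vector_derivative - f (u (- t))) (at t)"
      "((\<lambda>t. v (- t)) has_vector_derivative - f (v (- t))) (at t)" for t
    using has_vector_derivative_affine_time[OF u, of "-1" 0] has_vector_derivative_affine_time[OF v, of "-1" 0]
    by simp_all
  ultimately have "u (- (- t)) = v (- (- t))"
    by (rule ode_unique_forward[where u="\<lambda>t. u (- t)" and v="\<lambda>t. v (- t)" and f="\<lambda>x. - f x"])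
       (use 0 False in auto)
  then show ?thesis by simp
qed

lemma flow_has_derivative:
  "is_flow f S \<Longrightarrow> ((\<lambda>t. S t x) has_vector_derivative f (S t x)) (at t)"
  by (simp add: is_flow_def)

lemma flow_add:
  fixes f :: "real ^ 'n \<Rightarrow> real ^ 'n"
  assumes lip: "lipschitz_on_balls f" and S: "is_flow f S"
  shows "S s (S t x) = S (s + t) x"
proof (rule ode_unique[OF lip, where u="\<lambda>s. S s (S t x)" and v="\<lambda>s. S (s + t) x"])
  show "((\<lambda>s. S s (S t x)) has_vector_derivative f (S s (S t x))) (at s)" for s
    by (rule flow_has_derivative[OF S])
  show "((\<lambda>s. S (s + t) x) has_vector_derivative f (S (s + t) x)) (at s)" for s
    using has_vector_derivative_affine_time[OF flow_has_derivative[OF S], where c=1 and b=t] by simp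
  show "S 0 (S t x) = S (0 + t) x" using S by (simp add: is_flow_def)
qed

lemma difference_quotient_tendsto:
  assumes "(g has_derivative g') (at x)"
  shows "((\<lambda>h. (1 / h) *\<^sub>R (g (x + h *\<^sub>R \<xi>) - g x)) \<longlongrightarrow> g' \<xi>) (at 0)"
proof -
  have 1: "((\<lambda>h. x + h *\<^sub>R \<xi>) has_derivative (\<lambda>h. h *\<^sub>R \<xi>)) (at 0)"
    by (auto intro!: derivative_eq_intros)
  have "((\<lambda>h. g (x + h *\<^sub>R \<xi>)) has_derivative (\<lambda>h. g' (h *\<^sub>R \<xi>))) (at 0)"
    using has_derivative_compose[OF 1, of g g'] assms by simp
  then have "((\<lambda>h. norm (g (x + (0 + h) *\<^sub>R \<xi>) - g (x + 0 *\<^sub>R \<xi>) - g' (h *\<^sub>R \<xi>)) / norm h) \<longlongrightarrow> 0) (at 0)"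
    unfolding has_derivative_at by blast
  then have lim0: "((\<lambda>h. norm (g (x + h *\<^sub>R \<xi>) - g x - g' (h *\<^sub>R \<xi>)) / norm h) \<longlongrightarrow> 0) (at 0)" by simp
  have "((\<lambda>h. norm ((1 / h) *\<^sub>R (g (x + h *\<^sub>R \<xi>) - g x) - g' \<xi>)) \<longlongrightarrow> 0) (at 0)"
  proof (rule Lim_transform_eventually[OF lim0])
    have "norm (g (x + h *\<^sub>R \<xi>) - g x - g' (h *\<^sub>R \<xi>)) / norm h =
       norm ((1 / h) *\<^sub>R (g (x + h *\<^sub>R \<xi>) - g x) - g' \<xi>)" if "h \<noteq> 0" for h
    proof -
      have "(1 / h) *\<^sub>R (g (x + h *\<^sub>R \<xi>) - g x) - g' \<xi> = (1 / h) *\<^sub>R (g (x + h *\<^sub>R \<xi>) - g x - g' (h *\<^sub>R \<xi>))"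
        using that by (simp add: linear_scale[OF has_derivative_linear[OF assms]] scaleR_diff_right)
      then show ?thesis by simp
    qed
    then show "\<forall>\<^sub>F h in at 0. norm (g (x + h *\<^sub>R \<xi>) - g x - g' (h *\<^sub>R \<xi>)) / norm h =
       norm ((1 / h) *\<^sub>R (g (x + h *\<^sub>R \<xi>) - g x) - g' \<xi>)"
      by (simp add: eventually_at_filter)
  qed
  then show ?thesis by (simp add: LIM_zero_iff tendsto_norm_zero_iff)
qed

lemma bounded_bilinear_matrix_vector: "bounded_bilinear ((*v) :: real ^ 'n ^ 'm \<Rightarrow> real ^ 'n \<Rightarrow> real ^ 'm)"
  unfolding bilinear_conv_bounded_bilinear[symmetric] bilinear_def
  by (auto intro!: linearI simp: algebra_simps matrix_vector_mult_add_rdistrib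
      scaleR_matrix_vector_assoc matrix_vector_mult_scaleR)

section \<open>Exact symplectic vector fields\<close>

text \<open>
  The derivative of \<open>z \<mapsto> Dg\<^sub>z(X\<^sub>z)\<close>, whose argument moves with \<open>z\<close>. Expanding \<open>X\<close> in a basis
  reduces it to fixed directions, and symmetry of second derivatives puts the moving
  argument last.
\<close>

lemma directional_along_field_has_derivative:
  fixes g :: "'a::euclidean_space \<Rightarrow> 'b::euclidean_space" and X :: "'a \<Rightarrow> 'a"
  assumes g: "smooth_fun g" and X: "smooth_fun X"
  shows "((\<lambda>z. frechet_derivative g (at z) (X z)) has_derivative
     (\<lambda>\<xi>. frechet_derivative (\<lambda>z. frechet_derivative g (at z) \<xi>) (at z) (X z)
          + frechet_derivative g (at z) (frechet_derivative X (at z) \<xi>))) (at z)"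
proof -
  let ?D = "\<lambda>b z. frechet_derivative g (at z) b"
  have lin: "linear (frechet_derivative h (at z))" if "smooth_fun h" for h :: "'a \<Rightarrow> 'b" and z
    by (rule has_derivative_linear[OF smooth_fun_has_derivative[OF that]])
  have expand: "L w = (\<Sum>b\<in>Basis. (w \<bullet> b) *\<^sub>R L b)" if "linear L" for L :: "'a \<Rightarrow> 'b" and w
  proof -
    have "L w = L (\<Sum>b\<in>Basis. (w \<bullet> b) *\<^sub>R b)" by (simp add: euclidean_representation)
    also have "\<dots> = (\<Sum>b\<in>Basis. (w \<bullet> b) *\<^sub>R L b)"
      using that by (simp add: linear_sum linear_scale)
    finally show ?thesis .
  qed
  have "((\<lambda>z. \<Sum>b\<in>Basis. (X z \<bullet> b) *\<^sub>R ?D b z) has_derivative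
      (\<lambda>\<xi>. \<Sum>b\<in>Basis. (X z \<bullet> b) *\<^sub>R frechet_derivative (?D b) (at z) \<xi> +
           (frechet_derivative X (at z) \<xi> \<bullet> b) *\<^sub>R ?D b z)) (at z)"
    by (intro has_derivative_sum has_derivative_scaleR has_derivative_inner_left
        smooth_fun_has_derivative smooth_fun_derivative g X)
  moreover have "(\<lambda>z. ?D (X z) z) = (\<lambda>z. \<Sum>b\<in>Basis. (X z \<bullet> b) *\<^sub>R ?D b z)"
    by (rule ext) (rule expand[OF lin[OF g]])
  moreover have "(\<Sum>b\<in>Basis. (X z \<bullet> b) *\<^sub>R frechet_derivative (?D b) (at z) \<xi>) =
      frechet_derivative (?D \<xi>) (at z) (X z)" for \<xi>
    unfolding expand[OF lin[OF smooth_fun_derivative[OF g]], of \<xi> z "X z"]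
    by (intro sum.cong refl) (simp add: symmetric_second_derivative[OF g, of _ z \<xi>])
  moreover have "(\<Sum>b\<in>Basis. (frechet_derivative X (at z) \<xi> \<bullet> b) *\<^sub>R ?D b z) =
      ?D (frechet_derivative X (at z) \<xi>) z" for \<xi>
    by (rule expand[OF lin[OF g], symmetric])
  ultimately show ?thesis by (simp add: sum.distrib)
qed

text \<open>
  \<open>\<L>\<^sub>X (d\<alpha>) = d (\<L>\<^sub>X \<alpha>) = d (dW) = 0\<close> in coordinates: the \<open>\<xi>\<close>-derivative of
  \<open>(\<L>\<^sub>X \<alpha>)(\<eta>) = dW(\<eta>)\<close> is antisymmetrized in \<open>\<xi>\<close> and \<open>\<eta>\<close>, and the terms with a symmetric
  second derivative of \<open>W\<close> or \<open>X\<close> cancel.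
\<close>

lemma lie_derivative_of_exterior_derivative_eq_0:
  fixes \<alpha> X :: "real ^ 'n \<Rightarrow> real ^ 'n"
  assumes \<alpha>: "smooth_fun \<alpha>" and X: "smooth_fun X" and W: "smooth_fun W" and J: "smooth_fun J"
    and \<Omega>: "\<And>z \<xi> \<eta>. ext_deriv \<alpha> z \<xi> \<eta> = \<xi> \<bullet> (J z *v \<eta>)"
    and lie: "\<And>z \<eta>. lie_deriv X \<alpha> z \<eta> = frechet_derivative W (at z) \<eta>"
  shows "frechet_derivative X (at z) \<xi> \<bullet> (J z *v \<eta>) + \<xi> \<bullet> (frechet_derivative J (at z) (X z) *v \<eta>)
     + \<xi> \<bullet> (J z *v frechet_derivative X (at z) \<eta>) = 0"
proof -
  let ?a = "\<lambda>v z. frechet_derivative \<alpha> (at z) v" and ?x = "\<lambda>v z. frechet_derivative X (at z) v"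
  let ?aa = "\<lambda>v w. frechet_derivative (?a v) (at z) w" and ?xx = "\<lambda>v w. frechet_derivative (?x v) (at z) w"
  have WW: "frechet_derivative (\<lambda>z. frechet_derivative W (at z) \<eta>) (at z) \<xi> =
      ?aa \<xi> (X z) \<bullet> \<eta> + ?a (?x \<xi> z) z \<bullet> \<eta> + ?a \<xi> z \<bullet> ?x \<eta> z + \<alpha> z \<bullet> ?xx \<eta> \<xi>" for \<xi> \<eta>
  proof -
    have "((\<lambda>z. lie_deriv X \<alpha> z \<eta>) has_derivative
       (\<lambda>\<xi>. (?aa \<xi> (X z) + ?a (?x \<xi> z) z) \<bullet> \<eta> + (\<alpha> z \<bullet> ?xx \<eta> \<xi> + ?a \<xi> z \<bullet> ?x \<eta> z))) (at z)"
      unfolding lie_deriv_def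
      by (intro has_derivative_add has_derivative_inner_left has_derivative_inner
          directional_along_field_has_derivative smooth_fun_has_derivative smooth_fun_derivative \<alpha> X)
    then have "frechet_derivative (\<lambda>z. lie_deriv X \<alpha> z \<eta>) (at z) =
       (\<lambda>\<xi>. (?aa \<xi> (X z) + ?a (?x \<xi> z) z) \<bullet> \<eta> + (\<alpha> z \<bullet> ?xx \<eta> \<xi> + ?a \<xi> z \<bullet> ?x \<eta> z))"
      by (rule frechet_derivative_at[symmetric])
    then show ?thesis by (simp add: lie inner_add_left)
  qed
  have sym: "?aa \<xi> (X z) \<bullet> \<eta> + ?a (?x \<xi> z) z \<bullet> \<eta> + ?a \<xi> z \<bullet> ?x \<eta> z =
      ?aa \<eta> (X z) \<bullet> \<xi> + ?a (?x \<eta> z) z \<bullet> \<xi> + ?a \<eta> z \<bullet> ?x \<xi> z"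
    using WW[of \<eta> \<xi>] WW[of \<xi> \<eta>] symmetric_second_derivative[OF W, of \<eta> z \<xi>]
      symmetric_second_derivative[OF X, of \<eta> z \<xi>] by simp
  have "((\<lambda>z. \<xi> \<bullet> (J z *v \<eta>)) has_derivative (\<lambda>w. \<xi> \<bullet> (frechet_derivative J (at z) w *v \<eta>))) (at z)"
    by (intro has_derivative_inner_right bounded_linear.has_derivative[OF
          bounded_bilinear.bounded_linear_left[OF bounded_bilinear_matrix_vector]] smooth_fun_has_derivative J)
  moreover have "((\<lambda>z. \<xi> \<bullet> (J z *v \<eta>)) has_derivative (\<lambda>w. ?aa \<xi> w \<bullet> \<eta> - ?aa \<eta> w \<bullet> \<xi>)) (at z)"
    unfolding \<Omega>[symmetric] ext_deriv_def
    by (intro has_derivative_diff has_derivative_inner_left smooth_fun_has_derivative smooth_fun_derivative \<alpha>)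
  ultimately have "(\<lambda>w. \<xi> \<bullet> (frechet_derivative J (at z) w *v \<eta>)) = (\<lambda>w. ?aa \<xi> w \<bullet> \<eta> - ?aa \<eta> w \<bullet> \<xi>)"
    by (rule has_derivative_unique)
  then have JX: "\<xi> \<bullet> (frechet_derivative J (at z) (X z) *v \<eta>) = ?aa \<xi> (X z) \<bullet> \<eta> - ?aa \<eta> (X z) \<bullet> \<xi>"
    by metis
  show ?thesis unfolding JX \<Omega>[symmetric] ext_deriv_def using sym by simp
qed

text \<open>
  Finite differences take the place of the variational equation. Let \<open>y\<close>, \<open>z\<close> be the
  separations from the orbit \<open>p\<close> of \<open>x\<close> of the orbits starting at \<open>x + h \<xi>\<close>, \<open>x + h \<eta>\<close>. They
  are of size \<open>h\<close> uniformly on \<open>[0, 1]\<close>, and they satisfy the linearized equation up to an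
  error \<open>\<epsilon> h\<close>. As the Lie derivative of the form vanishes, \<open>\<Omega>\<^sub>p(y, z)\<close> changes by at most a
  multiple of \<open>\<epsilon> h\<^sup>2\<close> between the times \<open>0\<close> and \<open>1\<close>. Dividing by \<open>h\<^sup>2\<close> and letting \<open>h\<close> and
  then \<open>\<epsilon>\<close> tend to \<open>0\<close> gives the claim.
\<close>

lemma flow_map_symplectic:
  fixes f :: "real ^ 'n \<Rightarrow> real ^ 'n"
  assumes f: "smooth_fun f" and J: "smooth_fun J" and S: "is_flow f S"
    and lie: "\<And>z \<xi> \<eta>. frechet_derivative f (at z) \<xi> \<bullet> (J z *v \<eta>)
       + \<xi> \<bullet> (frechet_derivative J (at z) (f z) *v \<eta>) + \<xi> \<bullet> (J z *v frechet_derivative f (at z) \<eta>) = 0"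
    and der: "(S 1 has_derivative F') (at x)"
  shows "F' \<xi> \<bullet> (J (S 1 x) *v F' \<eta>) = \<xi> \<bullet> (J x *v \<eta>)"
proof -
  define p where "p = (\<lambda>t. S t x)"
  have p': "(p has_vector_derivative f (p t)) (at t)" for t
    unfolding p_def by (rule flow_has_derivative[OF S])
  have contp: "continuous_on {0..1} p"
    using p' has_vector_derivative_continuous by (blast intro: continuous_at_imp_continuous_on)
  have "bounded (p ` {0..1})"
    by (rule compact_imp_bounded[OF compact_continuous_image[OF contp]]) simp
  then obtain R where "\<forall>q \<in> p ` {0..1}. norm q \<le> R"
    unfolding bounded_iff by blast
  then have R: "p t \<in> cball 0 R" if "t \<in> {0..1}" for t
    using that by simp
  obtain C where C: "C > 0" "\<And>A (v :: real ^ 'n). norm ((A :: real ^ 'n ^ 'n) *v v) \<le> norm A * norm v * C"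
    using bounded_bilinear.pos_bounded[OF bounded_bilinear_matrix_vector] by blast
  have "bounded ((\<lambda>t. J (p t)) ` {0..1})"
    by (intro compact_imp_bounded compact_continuous_image continuous_on_compose2[OF smooth_fun_continuous_on[OF J, of UNIV] contp]) auto
  then obtain B where B: "B > 0" "\<And>t. t \<in> {0..1} \<Longrightarrow> norm (J (p t)) \<le> B"
    unfolding bounded_pos by auto
  define M where "M = B * C"
  have M: "M > 0" "\<bar>u \<bullet> (J (p t) *v v)\<bar> \<le> M * norm u * norm v" if "t \<in> {0..1}" for t u v
  proof -
    show "M > 0" using B C by (simp add: M_def)
    have "\<bar>u \<bullet> (J (p t) *v v)\<bar> \<le> norm u * norm (J (p t) *v v)" by (rule Cauchy_Schwarz_ineq2)
    also have "\<dots> \<le> norm u * (norm (J (p t)) * norm v * C)" by (intro mult_left_mono C) auto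
    also have "\<dots> \<le> norm u * (B * norm v * C)"
      using B(2)[OF that] C(1) by (intro mult_left_mono mult_right_mono) auto
    finally show "\<bar>u \<bullet> (J (p t) *v v)\<bar> \<le> M * norm u * norm v" by (simp add: M_def algebra_simps)
  qed
  \<comment> \<open>The ball of radius \<open>R + 1\<close> contains the unit tube around the orbit of \<open>x\<close>.\<close>
  obtain L where L: "L \<ge> 0" "\<And>x y. x \<in> cball 0 (R + 1) \<Longrightarrow> y \<in> cball 0 (R + 1) \<Longrightarrow> norm (f x - f y) \<le> L * norm (x - y)"
    using smooth_fun_lipschitz_on_balls[OF f] unfolding lipschitz_on_balls_def by meson
  define c where "c = exp L"
  define y where "y = (\<lambda>h \<xi> t. S t (x + h *\<^sub>R \<xi>) - p t)"
  have y': "(y h \<xi> has_vector_derivative f (p t + y h \<xi> t) - f (p t)) (at t)" for h \<xi> t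
    using has_vector_derivative_diff[OF flow_has_derivative[OF S] p'] by (simp add: y_def)
  have y0: "y h \<xi> 0 = h *\<^sub>R \<xi>" for h \<xi>
    using S by (simp add: y_def p_def is_flow_def)
  have ybound: "norm (y h \<xi> t) \<le> h * norm \<xi> * c" "norm (y h \<xi> t) \<le> 1"
    if h: "h > 0" "h * norm \<xi> * c < 1" and t: "t \<in> {0..1}" for h \<xi> t
  proof -
    have ly: "norm (f (p s + y h \<xi> s) - f (p s)) \<le> L * norm (y h \<xi> s)" if "s \<in> {0..1}" "norm (y h \<xi> s) \<le> 1" for s
    proof -
      have "norm (p s + y h \<xi> s) \<le> R + 1"
        using norm_triangle_ineq[of "p s" "y h \<xi> s"] R[OF that(1)] that(2) by simp
      then show ?thesis using L(2)[of "p s + y h \<xi> s" "p s"] R[OF that(1)] by simp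
    qed
    have small: "norm (y h \<xi> 0) * exp (L * 1) < 1" using h by (simp add: y0 c_def)
    show "norm (y h \<xi> t) \<le> 1" by (rule gronwall_in_unit_tube[OF y' ly L(1) small t])
    have "norm (y h \<xi> t) \<le> norm (y h \<xi> 0) * exp (L * t)"
      by (rule gronwall_in_unit_tube[OF y' ly L(1) small t])
    also have "\<dots> \<le> norm (y h \<xi> 0) * c"
      unfolding c_def using t L(1) by (intro mult_left_mono) (auto simp: mult_left_le)
    finally show "norm (y h \<xi> t) \<le> h * norm \<xi> * c" using h by (simp add: y0)
  qed
  define \<Delta> where "\<Delta> = F' \<xi> \<bullet> (J (S 1 x) *v F' \<eta>) - \<xi> \<bullet> (J x *v \<eta>)"
  have "\<bar>\<Delta>\<bar> \<le> \<epsilon> * (2 * M * (norm \<xi> * c) * (norm \<eta> * c))" if \<epsilon>: "\<epsilon> > 0" for \<epsilon>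
  proof -
    obtain \<delta> where \<delta>: "\<delta> > 0" "\<And>p y. p \<in> cball 0 R \<Longrightarrow> norm y < \<delta> \<Longrightarrow>
        norm (f (p + y) - f p - frechet_derivative f (at p) y) \<le> \<epsilon> * norm y"
      by (rule smooth_fun_uniform_linearization[OF f \<epsilon>, of R]) blast
    \<comment> \<open>For \<open>h < h0\<close> both separations stay in the unit ball and below \<open>\<delta>\<close> on \<open>[0, 1]\<close>.\<close>
    define h0 where "h0 = min 1 \<delta> / ((norm \<xi> + norm \<eta> + 1) * c)"
    have c0: "c > 0" by (simp add: c_def)
    have den: "(norm \<xi> + norm \<eta> + 1) * c > 0" using c0 by (intro mult_pos_pos) (auto simp: add_nonneg_pos)
    have h0: "h0 > 0" using \<delta>(1) den by (simp add: h0_def)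
    have est: "\<bar>((1/h) *\<^sub>R y h \<xi> 1) \<bullet> (J (S 1 x) *v ((1/h) *\<^sub>R y h \<eta> 1)) - \<xi> \<bullet> (J x *v \<eta>)\<bar>
        \<le> \<epsilon> * (2 * M * (norm \<xi> * c) * (norm \<eta> * c))" if h: "0 < h" "h < h0" for h
    proof -
      have "h * ((norm \<xi> + norm \<eta> + 1) * c) < min 1 \<delta>"
        using h den by (simp add: h0_def pos_less_divide_eq)
      moreover have "h * norm \<xi> * c \<le> h * ((norm \<xi> + norm \<eta> + 1) * c)" "h * norm \<eta> * c \<le> h * ((norm \<xi> + norm \<eta> + 1) * c)"
        using h(1) c0 by (auto simp: algebra_simps)
      ultimately have small: "h * norm \<xi> * c < 1" "h * norm \<eta> * c < 1" "h * norm \<xi> * c < \<delta>" "h * norm \<eta> * c < \<delta>"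
        by auto
      define r where "r = (\<lambda>\<zeta> t. f (p t + y h \<zeta> t) - f (p t) - frechet_derivative f (at (p t)) (y h \<zeta> t))"
      have rb: "norm (r \<zeta> t) \<le> \<epsilon> * (h * norm \<zeta> * c)"
        if "h * norm \<zeta> * c < 1" "h * norm \<zeta> * c < \<delta>" "t \<in> {0..1}" for \<zeta> t
      proof -
        have "norm (y h \<zeta> t) < \<delta>" using ybound(1)[OF h(1) that(1,3)] that(2) by simp
        then have "norm (r \<zeta> t) \<le> \<epsilon> * norm (y h \<zeta> t)"
          unfolding r_def by (rule \<delta>(2)[OF R[OF that(3)]])
        also have "\<dots> \<le> \<epsilon> * (h * norm \<zeta> * c)" using ybound(1)[OF h(1) that(1,3)] \<epsilon> by simp
        finally show ?thesis .
      qed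
      \<comment> \<open>\<open>G\<close> is the form on the two separations. In its derivative the linear parts of the equations
          for the separations cancel by \<open>lie\<close>, which leaves the remainders \<open>r\<close>.\<close>
      define G where "G = (\<lambda>t. y h \<xi> t \<bullet> (J (p t) *v y h \<eta> t))"
      define G' where "G' = (\<lambda>t. r \<xi> t \<bullet> (J (p t) *v y h \<eta> t) + y h \<xi> t \<bullet> (J (p t) *v r \<eta> t))"
      have GD: "(G has_real_derivative G' t) (at t)" for t
      proof -
        have Jp: "((\<lambda>t. J (p t)) has_vector_derivative frechet_derivative J (at (p t)) (f (p t))) (at t)"
          using vector_derivative_diff_chain_within[OF p'[of t]
              has_derivative_at_withinI[OF smooth_fun_has_derivative[OF J]]]
          by (simp add: o_def)
        have "(G has_vector_derivative
            (y h \<xi> t \<bullet> (J (p t) *v (f (p t + y h \<eta> t) - f (p t)) + frechet_derivative J (at (p t)) (f (p t)) *v y h \<eta> t)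
             + (f (p t + y h \<xi> t) - f (p t)) \<bullet> (J (p t) *v y h \<eta> t))) (at t)"
          unfolding G_def
          by (intro bounded_bilinear.has_vector_derivative[OF bounded_bilinear_inner]
              bounded_bilinear.has_vector_derivative[OF bounded_bilinear_matrix_vector] Jp y')
        moreover have "y h \<xi> t \<bullet> (J (p t) *v (f (p t + y h \<eta> t) - f (p t)) + frechet_derivative J (at (p t)) (f (p t)) *v y h \<eta> t)
             + (f (p t + y h \<xi> t) - f (p t)) \<bullet> (J (p t) *v y h \<eta> t) = G' t"
          using lie[of "p t" "y h \<xi> t" "y h \<eta> t"]
          by (simp add: G'_def r_def inner_diff_left inner_add_right matrix_vector_mult_diff_distrib inner_diff_right)
        ultimately show ?thesis by (simp add: has_real_derivative_iff_has_vector_derivative)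
      qed
      have G'b: "\<bar>G' t\<bar> \<le> \<epsilon> * (2 * M * (norm \<xi> * c) * (norm \<eta> * c)) * h\<^sup>2" if t: "t \<in> {0..1}" for t
      proof -
        have "\<bar>G' t\<bar> \<le> M * norm (r \<xi> t) * norm (y h \<eta> t) + M * norm (y h \<xi> t) * norm (r \<eta> t)"
          unfolding G'_def by (rule order_trans[OF abs_triangle_ineq add_mono[OF M(2)[OF t] M(2)[OF t]]])
        also have "\<dots> \<le> M * (\<epsilon> * (h * norm \<xi> * c)) * (h * norm \<eta> * c) + M * (h * norm \<xi> * c) * (\<epsilon> * (h * norm \<eta> * c))"
          using M(1)[OF t] h(1) c0 \<epsilon>
          by (intro add_mono mult_mono rb ybound small t h) (auto intro!: mult_nonneg_nonneg)
        also have "\<dots> = \<epsilon> * (2 * M * (norm \<xi> * c) * (norm \<eta> * c)) * h\<^sup>2"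
          by (simp add: power2_eq_square algebra_simps)
        finally show ?thesis .
      qed
      obtain s where s: "0 < s" "s < 1" "G 1 - G 0 = (1 - 0) * G' s"
        using MVT2[of 0 1 G G'] GD by auto
      have "\<bar>G 1 - G 0\<bar> \<le> \<epsilon> * (2 * M * (norm \<xi> * c) * (norm \<eta> * c)) * h\<^sup>2"
        using s G'b[of s] by simp
      moreover have "G 0 = h\<^sup>2 * (\<xi> \<bullet> (J x *v \<eta>))"
        using S by (simp add: G_def y0 p_def is_flow_def matrix_vector_mult_scaleR power2_eq_square)
      moreover have "G 1 = h\<^sup>2 * (((1/h) *\<^sub>R y h \<xi> 1) \<bullet> (J (S 1 x) *v ((1/h) *\<^sub>R y h \<eta> 1)))"
        using h by (simp add: G_def p_def matrix_vector_mult_scaleR power2_eq_square)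
      ultimately have "\<bar>h\<^sup>2 * (((1/h) *\<^sub>R y h \<xi> 1) \<bullet> (J (S 1 x) *v ((1/h) *\<^sub>R y h \<eta> 1)) - \<xi> \<bullet> (J x *v \<eta>))\<bar>
         \<le> h\<^sup>2 * (\<epsilon> * (2 * M * (norm \<xi> * c) * (norm \<eta> * c)))"
        by (simp add: right_diff_distrib mult.commute)
      then show ?thesis using h(1) by (simp only: abs_mult abs_power2) (simp add: mult_le_cancel_left_pos)
    qed
    have q: "((\<lambda>h. (1/h) *\<^sub>R y h \<zeta> 1) \<longlongrightarrow> F' \<zeta>) (at_right 0)" for \<zeta>
      using tendsto_mono[OF _ difference_quotient_tendsto[OF der, of \<zeta>], of "at_right 0"]
      by (simp add: y_def p_def at_le)
    have "((\<lambda>h. \<bar>((1/h) *\<^sub>R y h \<xi> 1) \<bullet> (J (S 1 x) *v ((1/h) *\<^sub>R y h \<eta> 1)) - \<xi> \<bullet> (J x *v \<eta>)\<bar>) \<longlongrightarrow> \<bar>\<Delta>\<bar>) (at_right 0)"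
      unfolding \<Delta>_def
      by (intro tendsto_intros q bounded_bilinear.tendsto[OF bounded_bilinear_matrix_vector])
    moreover have "\<forall>\<^sub>F h in at_right 0. \<bar>((1/h) *\<^sub>R y h \<xi> 1) \<bullet> (J (S 1 x) *v ((1/h) *\<^sub>R y h \<eta> 1)) - \<xi> \<bullet> (J x *v \<eta>)\<bar>
        \<le> \<epsilon> * (2 * M * (norm \<xi> * c) * (norm \<eta> * c))"
      using eventually_at_right_less[of "0::real"] eventually_at_right_field[of "\<lambda>h. h < h0" "0::real"] h0 est
      by (smt (verit) eventually_at_right_field)
    ultimately show ?thesis by (rule tendsto_upperbound) simp
  qed
  then have bound: "\<bar>\<Delta>\<bar> \<le> \<epsilon> * K" if "\<epsilon> > 0" "K = 2 * M * (norm \<xi> * c) * (norm \<eta> * c)" for \<epsilon> K using that by blast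
  have "\<bar>\<Delta>\<bar> \<le> 0 + e" if "e > 0" for e
  proof -
    define K where "K = 2 * M * (norm \<xi> * c) * (norm \<eta> * c)"
    have K: "K \<ge> 0" using M(1)[of 0] by (simp add: K_def c_def)
    have "\<bar>\<Delta>\<bar> \<le> (e / (K + 1)) * K" by (rule bound[OF _ K_def]) (use that K in \<open>simp add: add_nonneg_pos\<close>)
    also have "\<dots> \<le> e" using that K by (simp add: field_simps)
    finally show ?thesis by simp
  qed
  then have "\<bar>\<Delta>\<bar> \<le> 0" by (rule field_le_epsilon)
  then show ?thesis by (simp add: \<Delta>_def)
qed

text \<open>
  From Cartan's formula \<open>\<L>\<^sub>X \<alpha> = i\<^sub>X d\<alpha> + d(\<alpha>(X))\<close>, if \<open>\<L>\<^sub>X \<alpha> = dW\<close> then this function is an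
  energy for \<open>X\<close>. It inherits the periodicity of \<open>W\<close>, \<open>\<alpha>\<close> and \<open>X\<close>, so it descends to the
  phase space: a merely symplectic field would have an energy only locally.
\<close>

definition hamiltonian :: "(real ^ 'n \<Rightarrow> real) \<Rightarrow> (real ^ 'n \<Rightarrow> real ^ 'n) \<Rightarrow> (real ^ 'n \<Rightarrow> real ^ 'n) \<Rightarrow> real ^ 'n \<Rightarrow> real" where
  "hamiltonian W \<alpha> X z = W z - \<alpha> z \<bullet> X z"

lemma hamiltonian_has_derivative:
  assumes \<alpha>: "smooth_fun \<alpha>" and X: "smooth_fun X" and W: "smooth_fun W"
    and lie: "\<And>z \<eta>. lie_deriv X \<alpha> z \<eta> = frechet_derivative W (at z) \<eta>"
  shows "(hamiltonian W \<alpha> X has_derivative ext_deriv \<alpha> z (X z)) (at z)"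
proof -
  have "(hamiltonian W \<alpha> X has_derivative (\<lambda>\<eta>. frechet_derivative W (at z) \<eta> -
      (\<alpha> z \<bullet> frechet_derivative X (at z) \<eta> + frechet_derivative \<alpha> (at z) \<eta> \<bullet> X z))) (at z)"
    unfolding hamiltonian_def
    by (intro has_derivative_diff has_derivative_inner smooth_fun_has_derivative assms)
  moreover have "(\<lambda>\<eta>. frechet_derivative W (at z) \<eta> -
      (\<alpha> z \<bullet> frechet_derivative X (at z) \<eta> + frechet_derivative \<alpha> (at z) \<eta> \<bullet> X z)) = ext_deriv \<alpha> z (X z)"
    by (simp add: fun_eq_iff ext_deriv_def lie_deriv_def flip: lie)
  ultimately show ?thesis by simp
qed

text \<open>
  Along the flow, the derivative of the energy is \<open>\<Omega>(X, X) = 0\<close>.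
\<close>

lemma hamiltonian_conserved:
  assumes H: "\<And>z. (hamiltonian W \<alpha> X has_derivative ext_deriv \<alpha> z (X z)) (at z)" and S: "is_flow X S"
  shows "hamiltonian W \<alpha> X (S t x) = hamiltonian W \<alpha> X x"
proof -
  have "((\<lambda>t. hamiltonian W \<alpha> X (S t x)) has_vector_derivative 0) (at t)" for t
    using vector_derivative_diff_chain_within[OF flow_has_derivative[OF S]
              has_derivative_at_withinI[OF H], of x t]
    by (simp add: o_def ext_deriv_def)
  then obtain c where "hamiltonian W \<alpha> X (S t x) = c" for t
    using has_vector_derivative_zero_constant[of UNIV "\<lambda>t. hamiltonian W \<alpha> X (S t x)"] by auto
  moreover have "S 0 x = x" using S by (simp add: is_flow_def)
  ultimately show ?thesis by metis
qed

section \<open>Rotations of the torus\<close>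

definition rationally_independent :: "real ^ 'l \<Rightarrow> bool" where
  "rationally_independent \<omega> \<longleftrightarrow>
     (\<forall>(k :: int ^ 'l) (n :: int). (\<Sum>i\<in>UNIV. \<omega> $ i * of_int (k $ i)) = of_int n \<longrightarrow> k = 0)"

lemma diophantine_rationally_independent:
  "\<omega> \<in> diophantine \<kappa> \<nu> \<Longrightarrow> rationally_independent \<omega>"
  by (auto simp: diophantine_def rationally_independent_def Let_def)

text \<open>
  Kronecker's theorem for the components of \<open>\<omega>\<close> together with \<open>1\<close>. That theorem speaks of a
  family indexed by \<open>{..n}\<close> that is injective and independent over \<open>\<int>\<close>, so the coordinates
  have to be enumerated; injectivity is the special case of relations with at most two
  nonzero coefficients.
\<close>

lemma rotation_orbit_dense:
  fixes \<omega> x :: "real ^ 'l"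
  assumes \<omega>: "rationally_independent \<omega>" and "e > 0"
  obtains k :: int and m :: "'l \<Rightarrow> int" where "\<And>i. \<bar>of_int k * \<omega> $ i - of_int (m i) - x $ i\<bar> < e"
proof -
  obtain en where en: "bij_betw en {..<CARD('l)} (UNIV :: 'l set)"
    by (metis bij_betw_from_nat_into_finite finite)
  let ?n = "CARD('l)"
  define \<theta> where "\<theta> = (\<lambda>i. if i < ?n then \<omega> $ en i else 1)"
  interpret M: Modules.module "\<lambda>r x. real_of_int r * x"
    by (simp add: Modules.module.intro distrib_left distrib_right mult.assoc)
  have en_eq: "en i = en j \<longleftrightarrow> i = j" if "i < ?n" "j < ?n" for i j
    using en that by (auto simp: bij_betw_def inj_on_def)
  have rel: "\<And>k n. (\<Sum>i\<in>UNIV. \<omega> $ i * of_int (k i)) = of_int n \<Longrightarrow> k i = 0" for i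
  proof -
    fix k :: "'l \<Rightarrow> int" and n
    assume "(\<Sum>i\<in>UNIV. \<omega> $ i * of_int (k i)) = of_int n"
    then have "(\<Sum>i\<in>UNIV. \<omega> $ i * of_int ((\<chi> i. k i) $ i)) = of_int n" by simp
    then have "(\<chi> i. k i) = 0" using \<omega> unfolding rationally_independent_def by blast
    then show "k i = 0" by (metis vec_lambda_beta zero_index)
  qed
  \<comment> \<open>The family handed to Kronecker's theorem is injective, as \<open>\<omega>\<^sub>a = 1\<close> and \<open>\<omega>\<^sub>a = \<omega>\<^sub>b\<close> are integer relations.\<close>
  have not1: "\<omega> $ a \<noteq> 1" for a
  proof
    assume "\<omega> $ a = 1"
    then have "(\<Sum>i\<in>UNIV. \<omega> $ i * of_int (if i = a then 1 else 0)) = of_int 1"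
      by (simp add: if_distrib cong: if_cong)
    from rel[OF this, of a] show False by simp
  qed
  have neq: "\<omega> $ a \<noteq> \<omega> $ b" if "a \<noteq> b" for a b
  proof
    assume eq: "\<omega> $ a = \<omega> $ b"
    have "\<omega> $ i * of_int ((if i = a then 1 else 0) - (if i = b then 1 else 0)) =
        (if i = a then \<omega> $ a else 0) - (if i = b then \<omega> $ b else 0)" for i
      by simp
    then have "(\<Sum>i\<in>UNIV. \<omega> $ i * of_int ((if i = a then 1 else 0) - (if i = b then 1 else 0))) = of_int 0"
      using eq by (simp only: sum_subtractf) simp
    from rel[OF this, of a] show False using that by simp
  qed
  have inj: "inj_on \<theta> {..?n}"
  proof (rule inj_onI)
    fix i j assume ij: "i \<in> {..?n}" "j \<in> {..?n}" "\<theta> i = \<theta> j"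
    consider "i < ?n" "j < ?n" | "i = ?n" "j < ?n" | "i < ?n" "j = ?n" | "i = j"
      using ij(1,2) by force
    then show "i = j"
    proof cases
      case 1
      then have "\<omega> $ en i = \<omega> $ en j" using ij(3) by (simp add: \<theta>_def)
      then show ?thesis using neq en_eq[OF 1] by blast
    qed (use ij(3) not1 in \<open>auto simp: \<theta>_def\<close>)
  qed
  have "M.independent (\<theta> ` {..?n})"
    unfolding M.independent_explicit_module
  proof (intro allI impI)
    fix t :: "real set" and u v
    assume t: "finite t" "t \<subseteq> \<theta> ` {..?n}" and 0: "(\<Sum>v\<in>t. real_of_int (u v) * v) = 0" and v: "v \<in> t"
    define u' where "u' = (\<lambda>v. if v \<in> t then u v else 0)"
    have "0 = (\<Sum>v\<in>t. real_of_int (u' v) * v)" using 0 by (simp add: u'_def)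
    also have "\<dots> = (\<Sum>v\<in>\<theta> ` {..?n}. real_of_int (u' v) * v)"
      by (rule sum.mono_neutral_left) (use t in \<open>auto simp: u'_def\<close>)
    also have "\<dots> = (\<Sum>i\<le>?n. real_of_int (u' (\<theta> i)) * \<theta> i)"
      using sum.reindex[OF inj] by simp
    also have "\<dots> = (\<Sum>i<?n. real_of_int (u' (\<theta> i)) * \<theta> i) + of_int (u' 1)"
      by (simp add: \<theta>_def flip: lessThan_Suc_atMost)
    also have "(\<Sum>i<?n. real_of_int (u' (\<theta> i)) * \<theta> i) = (\<Sum>i<?n. \<omega> $ en i * of_int (u' (\<omega> $ en i)))"
      by (rule sum.cong) (auto simp: \<theta>_def)
    also have "\<dots> = (\<Sum>i\<in>UNIV. \<omega> $ i * of_int (u' (\<omega> $ i)))"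
      by (rule sum.reindex_bij_betw[OF en])
    finally have eq: "(\<Sum>i\<in>UNIV. \<omega> $ i * of_int (u' (\<omega> $ i))) = of_int (- u' 1)" by simp
    have z: "u' (\<omega> $ i) = 0" for i by (rule rel[OF eq])
    then have "u' 1 = 0" using eq by simp
    with z have "u' (\<theta> i) = 0" for i by (simp add: \<theta>_def)
    then have "u' v = 0" using t v by auto
    then show "u v = 0" using v by (simp add: u'_def)
  qed
  then obtain k m where km: "\<And>i. i < ?n \<Longrightarrow> \<bar>of_int k * \<theta> i - of_int (m i) - x $ en i\<bar> < e"
    using Kronecker_thm_2[OF _ inj _ \<open>e > 0\<close>, of "\<lambda>i. x $ en i"] by (auto simp: \<theta>_def)
  show thesis
  proof (rule that)
    fix i :: 'l
    obtain j where j: "j < ?n" "en j = i" using en by (metis UNIV_I bij_betw_iff_bijections lessThan_iff)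
    show "\<bar>of_int k * \<omega> $ i - of_int (m (inv_into {..<?n} en i)) - x $ i\<bar> < e"
      using km[OF j(1)] j bij_betw_inv_into_left[OF en, of j] by (simp add: \<theta>_def)
  qed
qed

text \<open>
  Minimality of the rotation. Invariance is required in both time directions because
  Kronecker's theorem approximates with a multiple \<open>k\<close> of \<open>\<omega>\<close> of either sign.
\<close>

lemma closed_rotation_invariant_eq_UNIV:
  fixes \<omega> :: "real ^ 'l"
  assumes \<omega>: "rationally_independent \<omega>" and cl: "closed S" and x0: "x0 \<in> S"
    and per: "\<And>x y. same_point UNIV x y \<Longrightarrow> x \<in> S \<Longrightarrow> y \<in> S"
    and rot: "\<And>x. x + \<omega> \<in> S \<longleftrightarrow> x \<in> S"
  shows "S = UNIV"
proof -
  have orbit: "x0 + of_int k *\<^sub>R \<omega> \<in> S" for k :: int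
  proof (induction k rule: int_induct[where k=0])
    case base show ?case using x0 by simp
  next
    case (step1 i)
    then show ?case using rot[of "x0 + of_int i *\<^sub>R \<omega>"] by (simp add: algebra_simps)
  next
    case (step2 i)
    then show ?case using rot[of "x0 + of_int (i - 1) *\<^sub>R \<omega>"] by (simp add: algebra_simps)
  qed
  have "y \<in> S" for y
  proof -
    have "\<exists>z\<in>S. dist z y < e" if e: "e > 0" for e
    proof -
      \<comment> \<open>The distance is estimated by the sum of the \<open>l\<close> coordinate errors.\<close>
      have e': "e / (real CARD('l) + 1) > 0" using e by simp
      obtain k :: int and m :: "'l \<Rightarrow> int" where km: "\<And>i. \<bar>of_int k * \<omega> $ i - of_int (m i) - (y - x0) $ i\<bar> < e / (real CARD('l) + 1)"
        using rotation_orbit_dense[OF \<omega> e'] by blast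
      define z where "z = x0 + of_int k *\<^sub>R \<omega> - (\<chi> i. of_int (m i))"
      have "z \<in> S" by (rule per[OF _ orbit[of k]]) (simp add: z_def same_point_def)
      moreover have "norm (z - y) \<le> (\<Sum>i\<in>UNIV. \<bar>(z - y) $ i\<bar>)" by (rule norm_le_l1_cart)
      moreover have "\<dots> \<le> (\<Sum>i\<in>(UNIV :: 'l set). e / (real CARD('l) + 1))"
        by (rule sum_mono) (use km in \<open>simp add: z_def algebra_simps less_imp_le\<close>)
      moreover have "\<dots> < e" using e by (simp add: field_simps)
      ultimately have "dist z y < e" by (simp only: dist_norm)
      with \<open>z \<in> S\<close> show ?thesis by blast
    qed
    then show ?thesis using closed_approachable[OF cl] by blast
  qed
  then show ?thesis by auto
qed

lemma rotation_invariant_constant: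
  fixes g :: "real ^ 'l \<Rightarrow> 'b::t2_space"
  assumes \<omega>: "rationally_independent \<omega>" and cont: "continuous_on UNIV g"
    and per: "\<And>x y. same_point UNIV x y \<Longrightarrow> g x = g y"
    and rot: "\<And>x. g (x + \<omega>) = g x"
  shows "g x = g y"
proof -
  have "{x. g x = g y} = UNIV"
    by (rule closed_rotation_invariant_eq_UNIV[OF \<omega>, where ?x0.0=y])
       (use per rot in \<open>auto intro!: closed_Collect_eq cont continuous_on_const\<close>)
  then show ?thesis by auto
qed

lemma periodic_bounded:
  fixes g :: "real ^ 'l \<Rightarrow> 'b::real_normed_vector"
  assumes cont: "continuous_on UNIV g" and per: "\<And>x y. same_point UNIV x y \<Longrightarrow> g x = g y"
  obtains b where "b > 0" "\<And>x. norm (g x) \<le> b"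
proof -
  have "bounded (g ` cbox 0 1)"
    by (intro compact_imp_bounded compact_continuous_image continuous_on_subset[OF cont]) auto
  then obtain b where b: "b > 0" "\<And>x. x \<in> cbox 0 1 \<Longrightarrow> norm (g x) \<le> b"
    unfolding bounded_pos by auto
  have "norm (g x) \<le> b" for x
  proof -
    have "same_point UNIV x (\<chi> i. frac (x $ i))"
      by (simp add: same_point_def frac_def)
    moreover have "(\<chi> i. frac (x $ i)) \<in> cbox 0 1"
      by (auto simp: mem_box_cart less_imp_le frac_lt_1)
    ultimately show ?thesis using b(2) per by metis
  qed
  with b that show thesis by blast
qed

text \<open>
  Two lifts of one continuous map to the quotient differ by a continuous function with
  integer components. This is how identities modulo \<open>\<int>\<close> are differentiated.
\<close>

lemma continuous_lifts_differ_by_constant: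
  fixes g h :: "real ^ 'l \<Rightarrow> real ^ 'n"
  assumes cont: "continuous_on UNIV g" "continuous_on UNIV h"
    and same: "\<And>x. same_point ang (g x) (h x)"
  obtains m where "\<And>x. g x = h x + m"
proof -
  have "(\<lambda>x. g x $ i - h x $ i) constant_on UNIV" for i
  proof (rule continuous_discrete_range_constant)
    show "continuous_on UNIV (\<lambda>x. g x $ i - h x $ i)"
      by (intro continuous_intros cont)
    have int: "g x $ i - h x $ i \<in> \<int>" for x
      using same[of x] by (auto simp: same_point_def split: if_splits dest!: spec[of _ i])
    show "\<exists>e>0. \<forall>y. y \<in> UNIV \<and> g y $ i - h y $ i \<noteq> g x $ i - h x $ i \<longrightarrow>
       e \<le> norm ((g y $ i - h y $ i) - (g x $ i - h x $ i))" for x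
    proof (intro exI[of _ 1] conjI allI impI)
      fix y assume y: "y \<in> UNIV \<and> g y $ i - h y $ i \<noteq> g x $ i - h x $ i"
      show "1 \<le> norm ((g y $ i - h y $ i) - (g x $ i - h x $ i))"
        using Ints_nonzero_abs_ge1[OF Ints_diff[OF int[of y] int[of x]]] y by simp
    qed simp
  qed (rule connected_UNIV)
  then have "\<exists>c. \<forall>x. g x $ i - h x $ i = c" for i by (simp add: constant_on_def)
  then obtain c where "\<And>i x. g x $ i - h x $ i = c i" by metis
  then have "g x = h x + (\<chi> i. c i)" for x by (simp add: vec_eq_iff algebra_simps)
  then show thesis using that by blast
qed

lemma frechet_derivative_translate:
  fixes g :: "'a::real_normed_vector \<Rightarrow> 'b::real_normed_vector"
  assumes g: "\<And>x. (g has_derivative frechet_derivative g (at x)) (at x)"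
    and eq: "\<And>x. g (x + k) = g x + m"
  shows "frechet_derivative g (at (x + k)) = frechet_derivative g (at x)"
proof -
  have 1: "((\<lambda>x. x + k) has_derivative (\<lambda>v. v)) (at x)"
    by (auto intro!: derivative_eq_intros)
  have "((\<lambda>x. g (x + k)) has_derivative frechet_derivative g (at (x + k))) (at x)"
    using has_derivative_compose[OF 1, of g "frechet_derivative g (at (x + k))"] g by simp
  moreover have "((\<lambda>x. g (x + k)) has_derivative frechet_derivative g (at x)) (at x)"
    unfolding eq using g[of x] by (auto intro!: derivative_eq_intros)
  ultimately show ?thesis by (rule has_derivative_unique)
qed

lemma invariant_fun_derivative:
  fixes g :: "real ^ 'n \<Rightarrow> 'b::real_normed_vector"
  assumes g: "smooth_fun g" and inv: "invariant_fun ang g"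
  shows "invariant_fun ang (\<lambda>x. frechet_derivative g (at x))"
  unfolding invariant_fun_def
proof (intro allI impI)
  fix x y :: "real ^ 'n" assume xy: "same_point ang x y"
  have "g (z + (x - y)) = g z + 0" for z
    using inv xy unfolding invariant_fun_def by (simp add: same_point_def)
  from frechet_derivative_translate[OF smooth_fun_has_derivative[OF g] this, of y]
  show "frechet_derivative g (at x) = frechet_derivative g (at y)" by simp
qed

lemma torus_map_derivative_periodic:
  fixes K :: "real ^ 'l \<Rightarrow> real ^ 'n"
  assumes K: "smooth_fun K" "torus_map ang K" and xy: "same_point UNIV x y"
  shows "frechet_derivative K (at x) = frechet_derivative K (at y)"
proof -
  have cK: "continuous_on UNIV K" by (rule smooth_fun_continuous_on[OF K(1)])
  have cK': "continuous_on UNIV (\<lambda>z. K (z + (x - y)))"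
    by (rule continuous_on_compose2[OF cK]) (auto intro!: continuous_intros)
  have "same_point ang (K (z + (x - y))) (K z)" for z
    using K(2) xy unfolding torus_map_def by (simp add: same_point_def)
  then obtain m where "\<And>z. K (z + (x - y)) = K z + m"
    by (rule continuous_lifts_differ_by_constant[OF cK' cK]) blast
  from frechet_derivative_translate[OF smooth_fun_has_derivative[OF K(1)] this, of y]
  show ?thesis by simp
qed

text \<open>
  Think of \<open>g\<close> and \<open>h\<close> as the \<open>v\<close>- and \<open>u\<close>-components of a 1-form on a 2-torus with periods
  \<open>u\<close>, \<open>v\<close>; then \<open>c\<close> is its exterior derivative, whose integral over the torus is \<open>0\<close> by
  Stokes' theorem. Concretely, the integral \<open>B s\<close> of \<open>g\<close> over the loop \<open>t \<mapsto> s u + t v\<close> has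
  derivative \<open>c\<close>, since \<open>h\<close> takes equal values at the two ends of the loop; and \<open>B 1 = B 0\<close>
  by periodicity of \<open>g\<close>.
\<close>

lemma constant_exterior_derivative_eq_0:
  fixes g h :: "real ^ 'l \<Rightarrow> real"
  assumes g: "\<And>x. (g has_derivative g' x) (at x)" and h: "\<And>x. (h has_derivative h' x) (at x)"
    and cont: "continuous_on UNIV (\<lambda>x. g' x u)"
    and per: "\<And>x. g (x + u) = g x" "\<And>x. h (x + v) = h x"
    and c: "\<And>x. g' x u - h' x v = c"
  shows "c = 0"
proof -
  define B where "B = (\<lambda>s. integral (cbox 0 1) (\<lambda>t. g (s *\<^sub>R u + t *\<^sub>R v)))"
  have line: "((\<lambda>t. \<phi> (y + t *\<^sub>R w)) has_real_derivative \<phi>' (y + t *\<^sub>R w) w) (at t)"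
    if "\<And>x. (\<phi> has_derivative \<phi>' x) (at x)" for \<phi> :: "real ^ 'l \<Rightarrow> real" and \<phi>' y t w
  proof -
    have 1: "((\<lambda>t. y + t *\<^sub>R w) has_derivative (\<lambda>a. a *\<^sub>R w)) (at t)"
      by (auto intro!: derivative_eq_intros)
    have "((\<lambda>t. \<phi> (y + t *\<^sub>R w)) has_derivative (\<lambda>a. \<phi>' (y + t *\<^sub>R w) (a *\<^sub>R w))) (at t)"
      by (rule has_derivative_compose[OF 1 that])
    then show ?thesis
      by (simp add: has_field_derivative_def linear_scale[OF has_derivative_linear[OF that]] mult.commute[of _ "\<phi>' _ _"])
  qed
  have contg: "continuous_on UNIV g"
    using g has_derivative_continuous by (blast intro: continuous_at_imp_continuous_on)
  have BD: "(B has_real_derivative c) (at s)" for s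
  proof -
    have "(B has_real_derivative integral (cbox 0 1) (\<lambda>t. g' (s *\<^sub>R u + t *\<^sub>R v) u)) (at s within UNIV)"
      unfolding B_def
    proof (rule leibniz_rule_field_derivative)
      show "((\<lambda>s. g (s *\<^sub>R u + t *\<^sub>R v)) has_field_derivative g' (s *\<^sub>R u + t *\<^sub>R v) u) (at s within UNIV)" for s t
        using line[OF g, of "t *\<^sub>R v" u s] by (simp add: add.commute)
      show "(\<lambda>t. g (s *\<^sub>R u + t *\<^sub>R v)) integrable_on cbox 0 1" for s
        by (intro integrable_continuous continuous_on_compose2[OF contg]) (auto intro!: continuous_intros)
      show "continuous_on (UNIV \<times> cbox 0 1) (\<lambda>(s, t). g' (s *\<^sub>R u + t *\<^sub>R v) u)"
        unfolding case_prod_beta by (intro continuous_on_compose2[OF cont]) (auto intro!: continuous_intros)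
    qed auto
    moreover have "((\<lambda>t. c + h' (s *\<^sub>R u + t *\<^sub>R v) v) has_integral c + (h (s *\<^sub>R u + 1 *\<^sub>R v) - h (s *\<^sub>R u + 0 *\<^sub>R v))) {0..1}"
    proof (intro has_integral_add)
      show "((\<lambda>t. h' (s *\<^sub>R u + t *\<^sub>R v) v) has_integral h (s *\<^sub>R u + 1 *\<^sub>R v) - h (s *\<^sub>R u + 0 *\<^sub>R v)) {0..1}"
        by (rule fundamental_theorem_of_calculus)
           (use line[OF h] in \<open>auto simp flip: has_real_derivative_iff_has_vector_derivative intro: has_field_derivative_at_within\<close>)
      show "((\<lambda>t::real. c) has_integral c) {0..1}" using has_integral_const_real[of c 0 1] by simp
    qed
    then have "integral (cbox 0 1) (\<lambda>t. g' (s *\<^sub>R u + t *\<^sub>R v) u) = c"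
    proof -
      have "(\<lambda>t. g' (s *\<^sub>R u + t *\<^sub>R v) u) = (\<lambda>t. c + h' (s *\<^sub>R u + t *\<^sub>R v) v)"
        using c by (simp add: fun_eq_iff algebra_simps)
      moreover assume "((\<lambda>t. c + h' (s *\<^sub>R u + t *\<^sub>R v) v) has_integral c + (h (s *\<^sub>R u + 1 *\<^sub>R v) - h (s *\<^sub>R u + 0 *\<^sub>R v))) {0..1}"
      ultimately show ?thesis using per(2)[of "s *\<^sub>R u"] by (simp add: integral_unique)
    qed
    ultimately show ?thesis by simp
  qed
  have "B 1 = B 0"
    unfolding B_def using per(1) by (simp add: add.commute[of u])
  moreover obtain s where "B 1 - B 0 = (1 - 0) * c"
    using MVT2[of 0 1 B "\<lambda>_. c"] BD by auto
  ultimately show ?thesis by simp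
qed

section \<open>Isotropic subspaces\<close>

text \<open>
  The subspaces \<open>J L\<close> and \<open>E\<^sup>\<bottom>\<close> (Euclidean complement) are both contained in \<open>L\<^sup>\<bottom>\<close>, the
  first by isotropy. They meet only in \<open>0\<close>, as \<open>J x \<in> E\<^sup>\<bottom>\<close> means that \<open>x\<close> is orthogonal to
  \<open>E\<close> for the form, so \<open>x = 0\<close> by nondegeneracy. Comparing dimensions,
  \<open>dim L + (n - dim E) \<le> n - dim L\<close>.
\<close>

lemma isotropic_dim_le:
  fixes J :: "real ^ 'n ^ 'n"
  assumes E: "subspace E" and L: "subspace L" "L \<subseteq> E"
    and iso: "\<And>x y. x \<in> L \<Longrightarrow> y \<in> L \<Longrightarrow> x \<bullet> (J *v y) = 0"
    and nondeg: "\<And>x. x \<in> E \<Longrightarrow> (\<And>w. w \<in> E \<Longrightarrow> w \<bullet> (J *v x) = 0) \<Longrightarrow> x = 0"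
  shows "2 * dim L \<le> dim E"
proof -
  define Z where "Z = (*v) J ` L"
  define P where "P = {y \<in> UNIV. \<forall>x\<in>E. orthogonal x y}"
  define Q where "Q = {y \<in> UNIV. \<forall>x\<in>L. orthogonal x y}"
  have P: "subspace P" "dim P + dim E = CARD('n)"
    using dim_subspace_orthogonal_to_vectors[OF E subspace_UNIV]
    by (auto simp: P_def orthogonal_def inner_add_right intro!: subspaceI)
  have Q: "subspace Q" "dim Q + dim L = CARD('n)"
    using dim_subspace_orthogonal_to_vectors[OF L(1) subspace_UNIV]
    by (auto simp: Q_def orthogonal_def inner_add_right intro!: subspaceI)
  have Z: "subspace Z"
    unfolding Z_def by (intro linear_subspace_image L) (simp add: matrix_vector_mul_linear)
  have "inj_on ((*v) J) L"
  proof (rule inj_onI)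
    fix x y assume xy: "x \<in> L" "y \<in> L" "J *v x = J *v y"
    have "x - y = 0"
      by (rule nondeg) (use xy L subspace_diff[OF E] in \<open>auto simp: matrix_vector_mult_diff_distrib\<close>)
    then show "x = y" by simp
  qed
  then have dimZ: "dim Z = dim L"
    unfolding Z_def by (intro dim_image_eq) (use L(1) in \<open>simp_all add: matrix_vector_mul_linear span_eq_iff[THEN iffD2]\<close>)
  have "Z \<inter> P \<subseteq> {0}"
  proof
    fix z assume "z \<in> Z \<inter> P"
    then obtain x where x: "x \<in> L" "z = J *v x" "\<And>w. w \<in> E \<Longrightarrow> w \<bullet> (J *v x) = 0"
      by (auto simp: Z_def P_def orthogonal_def)
    then have "x = 0" using nondeg L(2) by blast
    then show "z \<in> {0}" using x by simp
  qed
  then have "dim (Z \<inter> P) = 0" by (simp only: dim_eq_0)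
  then have "dim {x + y |x y. x \<in> Z \<and> y \<in> P} = dim L + dim P"
    using dim_sums_Int[OF Z P(1)] dimZ by linarith
  moreover have "{x + y |x y. x \<in> Z \<and> y \<in> P} \<subseteq> Q"
  proof -
    have "Z \<subseteq> Q" using iso by (auto simp: Z_def Q_def orthogonal_def)
    moreover have "P \<subseteq> Q" using L(2) by (auto simp: P_def Q_def)
    ultimately show ?thesis using subspace_add[OF Q(1)] by blast
  qed
  then have "dim {x + y |x y. x \<in> Z \<and> y \<in> P} \<le> dim Q" by (rule dim_subset)
  ultimately show ?thesis using P(2) Q(2) by linarith
qed

text \<open>
  Adding \<open>v\<close> to \<open>L\<close> would give an isotropic subspace that is too large.
\<close>

lemma lagrangian_maximal:
  fixes J :: "real ^ 'n ^ 'n"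
  assumes E: "subspace E" and L: "subspace L" "L \<subseteq> E" and dim: "dim E \<le> 2 * dim L"
    and anti: "\<And>x y. x \<bullet> (J *v y) = - (y \<bullet> (J *v x))"
    and iso: "\<And>x y. x \<in> L \<Longrightarrow> y \<in> L \<Longrightarrow> x \<bullet> (J *v y) = 0"
    and nondeg: "\<And>x. x \<in> E \<Longrightarrow> (\<And>w. w \<in> E \<Longrightarrow> w \<bullet> (J *v x) = 0) \<Longrightarrow> x = 0"
    and v: "v \<in> E" "\<And>x. x \<in> L \<Longrightarrow> v \<bullet> (J *v x) = 0"
  shows "v \<in> L"
proof (rule ccontr)
  assume "v \<notin> L"
  then have "v \<notin> span L" using L(1) by (simp add: span_eq_iff[THEN iffD2])
  then have "dim (span (insert v L)) = dim L + 1" by (simp add: dim_insert)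
  moreover have "2 * dim (span (insert v L)) \<le> dim E"
  proof (rule isotropic_dim_le[OF E subspace_span _ _ nondeg])
    show "span (insert v L) \<subseteq> E" using E L(2) v(1) by (intro span_minimal) auto
    fix x y assume "x \<in> span (insert v L)" "y \<in> span (insert v L)"
    then obtain a b where "x - a *\<^sub>R v \<in> L" "y - b *\<^sub>R v \<in> L"
      using L(1) by (auto simp: span_breakdown_eq span_eq_iff[THEN iffD2])
    then obtain p q where pq: "x = a *\<^sub>R v + p" "y = b *\<^sub>R v + q" "p \<in> L" "q \<in> L"
      by (metis add.commute diff_add_cancel)
    have "v \<bullet> (J *v v) = 0" using anti[of v v] by simp
    moreover have "p \<bullet> (J *v v) = 0" using anti[of p v] v(2)[OF pq(3)] by simp
    ultimately show "x \<bullet> (J *v y) = 0"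
      using v(2)[OF pq(4)] iso[OF pq(3,4)]
      by (simp add: pq(1,2) algebra_simps inner_add_left inner_add_right matrix_vector_right_distrib
          matrix_vector_mult_scaleR)
  qed
  ultimately show False using dim by linarith
qed

section \<open>Symplectic cocycles with a spectral splitting\<close>

definition cmat :: "real ^ 'n ^ 'm \<Rightarrow> complex ^ 'n ^ 'm" where
  "cmat A = (\<chi> i j. complex_of_real (A $ i $ j))"

definition vec_re :: "complex ^ 'n \<Rightarrow> real ^ 'n" where
  "vec_re v = (\<chi> i. Re (v $ i))"

definition vec_cnj :: "complex ^ 'n \<Rightarrow> complex ^ 'n" where
  "vec_cnj v = (\<chi> i. cnj (v $ i))"

lemma cmat_mult: "cmat (A ** B) = cmat A ** cmat B"
  by (simp add: cmat_def matrix_matrix_mult_def vec_eq_iff)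

lemma cmat_invertible:
  fixes A :: "real ^ 'n ^ 'n"
  assumes "invertible A"
  shows "invertible (cmat A)"
proof -
  obtain B where "A ** B = mat 1" "B ** A = mat 1" using assms by (auto simp: invertible_def)
  moreover have "cmat (mat 1 :: real ^ 'n ^ 'n) = mat 1" by (simp add: cmat_def mat_def vec_eq_iff)
  ultimately show ?thesis unfolding invertible_def using cmat_mult by metis
qed

lemma cmat_cvec: "cmat A *v cvec v = cvec (A *v v)"
  by (simp add: cmat_def cvec_def matrix_vector_mult_def vec_eq_iff)

lemma vec_re_cmat: "vec_re (cmat A *v v) = A *v vec_re v"
  by (simp add: cmat_def vec_re_def matrix_vector_mult_def vec_eq_iff)

lemma vec_cnj_cmat: "vec_cnj (cmat A *v v) = cmat A *v vec_cnj v"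
  by (simp add: cmat_def vec_cnj_def matrix_vector_mult_def vec_eq_iff)

lemma norm_vec_cnj [simp]: "norm (vec_cnj v) = norm v"
  by (simp add: vec_cnj_def norm_vec_def)

lemma norm_cvec [simp]: "norm (cvec v) = norm v"
  by (simp add: cvec_def norm_vec_def)

lemma norm_vec_re: "norm (vec_re v) \<le> norm v"
  by (auto simp: vec_re_def norm_vec_def abs_Re_le_cmod intro!: L2_set_mono)

lemma vec_re_cvec [simp]: "vec_re (cvec v) = v"
  by (simp add: vec_re_def cvec_def vec_eq_iff)

lemma vec_re_add: "vec_re (v + w) = vec_re v + vec_re w"
  by (simp add: vec_re_def vec_eq_iff)

lemma cvec_vec_re: "cvec (vec_re v) = (1/2) *s (v + vec_cnj v)"
  by (simp add: vec_re_def vec_cnj_def cvec_def vec_eq_iff complex_eq_iff)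

lemma cvec_add: "cvec (x + y) = cvec x + cvec y"
  by (simp add: cvec_def vec_eq_iff)

lemma cvec_scaleR: "cvec (c *\<^sub>R x) = complex_of_real c *s cvec x"
  by (simp add: cvec_def vec_eq_iff)

lemma cvec_diff: "cvec (x - y) = cvec x - cvec y"
  by (simp add: cvec_def vec_eq_iff)

lemma cvec_sum_zero_iff:
  assumes "finite B" "(\<Sum>b\<in>B. u b *s cvec b) = 0"
  shows "(\<Sum>b\<in>B. Re (u b) *\<^sub>R b) = 0" "(\<Sum>b\<in>B. Im (u b) *\<^sub>R b) = 0"
proof -
  have "(\<Sum>b\<in>B. u b * complex_of_real (b $ i)) = 0" for i
    using assms(2) by (simp add: vec_eq_iff cvec_def)
  then have "Re (\<Sum>b\<in>B. u b * complex_of_real (b $ i)) = 0" "Im (\<Sum>b\<in>B. u b * complex_of_real (b $ i)) = 0" for i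
    by simp_all
  then show "(\<Sum>b\<in>B. Re (u b) *\<^sub>R b) = 0" "(\<Sum>b\<in>B. Im (u b) *\<^sub>R b) = 0"
    by (simp_all add: vec_eq_iff)
qed

lemma inj_cvec: "inj cvec"
  by (rule injI) (metis vec_re_cvec)

text \<open>
  Real vectors that are independent over \<open>\<real>\<close> remain independent over \<open>\<complex>\<close>. The centre spaces
  are complex, while the symplectic linear algebra is done with their real points, whose
  dimension is bounded in this way.
\<close>

lemma dim_real_points_le:
  fixes V :: "(complex ^ 'n) set"
  shows "dim {x. cvec x \<in> V} \<le> vec.dim V"
proof -
  obtain B where B: "B \<subseteq> {x. cvec x \<in> V}" "independent B" "card B = dim {x. cvec x \<in> V}"
    using basis_exists[of "{x. cvec x \<in> V}"] by metis
  have fin: "finite B" using B(2) independent_imp_finite by blast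
  have "vec.independent (cvec ` B)"
  proof (rule vec.independent_if_scalars_zero)
    fix u v assume 0: "(\<Sum>x\<in>cvec ` B. u x *s x) = 0" and v: "v \<in> cvec ` B"
    have "(\<Sum>b\<in>B. u (cvec b) *s cvec b) = 0"
      using 0 by (simp add: sum.reindex[OF inj_on_subset[OF inj_cvec subset_UNIV]] o_def)
    from cvec_sum_zero_iff[OF fin this]
    have "Re (u (cvec b)) = 0" "Im (u (cvec b)) = 0" if "b \<in> B" for b
      using that independentD[OF B(2) fin order.refl, of "\<lambda>b. Re (u (cvec b))"]
        independentD[OF B(2) fin order.refl, of "\<lambda>b. Im (u (cvec b))"] by simp_all
    then show "u v = 0" using v by (auto simp: complex_eq_iff)
  qed (use fin in simp)
  moreover have "card (cvec ` B) = card B" by (rule card_image[OF inj_on_subset[OF inj_cvec subset_UNIV]])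
  moreover have "cvec ` B \<subseteq> V" using B(1) by auto
  ultimately show ?thesis using vec.independent_card_le_dim B(3) by metis
qed

lemma matrix_inv_inverse:
  fixes A :: "'a::field ^ 'n ^ 'n"
  assumes "invertible A"
  shows "A ** matrix_inv A = mat 1" "matrix_inv A ** A = mat 1"
proof -
  have "\<exists>B. A ** B = mat 1 \<and> B ** A = mat 1" using assms by (simp add: invertible_def)
  then have "A ** matrix_inv A = mat 1 \<and> matrix_inv A ** A = mat 1"
    unfolding matrix_inv_def by (rule someI_ex)
  then show "A ** matrix_inv A = mat 1" "matrix_inv A ** A = mat 1" by auto
qed

lemma eq_0_if_geometrically_small:
  fixes a B q :: real
  assumes "0 \<le> q" "q < 1" "\<And>n. n \<ge> 1 \<Longrightarrow> \<bar>a\<bar> \<le> B * q ^ n"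
  shows "a = 0"
proof -
  have "(\<lambda>n. B * q ^ n) \<longlonglongrightarrow> B * 0"
    by (intro tendsto_mult tendsto_const LIMSEQ_realpow_zero assms)
  moreover have "eventually (\<lambda>n. \<bar>a\<bar> \<le> B * q ^ n) sequentially"
    using assms(3) by (auto simp: eventually_sequentially)
  ultimately have "\<bar>a\<bar> \<le> B * 0" by (rule tendsto_lowerbound) simp
  then show ?thesis by simp
qed

text \<open>
  \<open>R\<close> stands for \<open>DF \<circ> K\<close> at real points, \<open>J\<close> for the matrix of the symplectic form along
  \<open>K\<close>, and \<open>A\<close> for the complex cocycle that carries the spectral splitting. At real points
  \<open>A\<close> commutes with complex conjugation and hence with taking real parts, so statements
  about the complex bundles can be tested against the real form \<open>J\<close>.
\<close>

locale symplectic_cocycle =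
  fixes A :: "complex ^ 'l::finite \<Rightarrow> complex ^ 'n::finite ^ 'n"
    and R J :: "real ^ 'l \<Rightarrow> real ^ 'n ^ 'n" and \<omega> :: "real ^ 'l" and \<rho> :: real
    and Es Ec Eu :: "complex ^ 'l \<Rightarrow> (complex ^ 'n) set" and M :: real
  assumes A_real: "\<And>\<theta>. A (cvec \<theta>) = cmat (R \<theta>)"
    and symplectic: "\<And>\<theta> x y. (R \<theta> *v x) \<bullet> (J (\<theta> + \<omega>) *v (R \<theta> *v y)) = x \<bullet> (J \<theta> *v y)"
    and J_invertible: "\<And>\<theta>. invertible (J \<theta>)"
    and J_bounded: "\<And>\<theta> x y. \<bar>x \<bullet> (J \<theta> *v y)\<bar> \<le> M * norm x * norm y"
    and spectral: "spectral_condition A \<omega> \<rho> Es Ec Eu"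
    and \<rho>_nonneg: "\<rho> \<ge> 0"
begin

lemma real_in_strip: "cvec \<theta> \<in> strip \<rho>"
  using \<rho>_nonneg by (simp add: strip_def cvec_def)

lemma J_nondegenerate:
  assumes "\<And>w. w \<bullet> (J \<theta> *v x) = 0"
  shows "x = 0"
proof -
  have "J \<theta> *v x = 0" using assms[of "J \<theta> *v x"] by simp
  then show ?thesis
    using J_invertible[of \<theta>] by (metis invertible_def matrix_vector_mul_assoc matrix_vector_mul_lid matrix_vector_mult_0_right)
qed

text \<open>
  The spectral condition speaks of inverses of the cocycle; they are genuine inverses
  because a map preserving a nondegenerate form is injective.
\<close>

lemma R_invertible: "invertible (R \<theta>)"
proof -
  have "x = 0" if "R \<theta> *v x = 0" for x
  proof (rule J_nondegenerate)
    show "w \<bullet> (J \<theta> *v x) = 0" for w using symplectic[of \<theta> w x] that by simp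
  qed
  then show ?thesis
    using matrix_left_invertible_ker[of "R \<theta>"] invertible_left_inverse[of "R \<theta>"] by blast
qed

lemma A_inverse:
  "matrix_inv (A (cvec \<theta>)) *v (A (cvec \<theta>) *v v) = v"
  "A (cvec \<theta>) *v (matrix_inv (A (cvec \<theta>)) *v v) = v"
  using matrix_inv_inverse[OF cmat_invertible[OF R_invertible, of \<theta>]]
  by (simp_all add: A_real matrix_vector_mul_assoc)

definition fwd :: "nat \<Rightarrow> real ^ 'l \<Rightarrow> complex ^ 'n \<Rightarrow> complex ^ 'n" where
  "fwd n \<theta> v = cocycle_fwd A \<omega> n (cvec \<theta>) *v v"

definition bwd :: "nat \<Rightarrow> real ^ 'l \<Rightarrow> complex ^ 'n \<Rightarrow> complex ^ 'n" where
  "bwd n \<theta> v = cocycle_bwd A \<omega> n (cvec \<theta>) *v v"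

lemma fwd_0 [simp]: "fwd 0 \<theta> v = v" and bwd_0 [simp]: "bwd 0 \<theta> v = v"
  by (simp_all add: fwd_def bwd_def)

lemma fwd_Suc: "fwd (Suc n) \<theta> v = A (cvec (\<theta> + real n *\<^sub>R \<omega>)) *v fwd n \<theta> v"
  by (simp add: fwd_def cvec_add matrix_vector_mul_assoc)

lemma bwd_Suc: "bwd (Suc n) \<theta> v = matrix_inv (A (cvec (\<theta> - real (Suc n) *\<^sub>R \<omega>))) *v bwd n \<theta> v"
  by (simp add: bwd_def cvec_diff matrix_vector_mul_assoc del: of_nat_Suc)

lemma A_bwd_Suc: "A (cvec (\<theta> - real (Suc n) *\<^sub>R \<omega>)) *v bwd (Suc n) \<theta> v = bwd n \<theta> v"
  by (simp only: bwd_Suc A_inverse)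

lemma fwd_add: "fwd n \<theta> (v + w) = fwd n \<theta> v + fwd n \<theta> w"
  and bwd_add: "bwd n \<theta> (v + w) = bwd n \<theta> v + bwd n \<theta> w"
  by (simp_all add: fwd_def bwd_def matrix_vector_right_distrib)

text \<open>
  The recursion of the cocycle peels off its last factor. To cancel the backward cocycle,
  whose first factor inverts the first one of the forward cocycle, that factor has to be
  peeled off instead.
\<close>

lemma fwd_Suc': "fwd (Suc n) \<theta> v = fwd n (\<theta> + \<omega>) (A (cvec \<theta>) *v v)"
proof (induction n)
  case (Suc n)
  have "\<theta> + real (Suc n) *\<^sub>R \<omega> = \<theta> + \<omega> + real n *\<^sub>R \<omega>" by (simp add: algebra_simps)
  then show ?case by (simp only: fwd_Suc[of "Suc n"] Suc fwd_Suc[of n "\<theta> + \<omega>"])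
qed (simp add: fwd_Suc)

lemma fwd_bwd: "fwd n (\<theta> - real n *\<^sub>R \<omega>) (bwd n \<theta> v) = v"
proof (induction n)
  case (Suc n)
  have "\<theta> - real (Suc n) *\<^sub>R \<omega> + \<omega> = \<theta> - real n *\<^sub>R \<omega>" by (simp add: algebra_simps)
  then show ?case by (simp only: fwd_Suc' A_bwd_Suc Suc)
qed simp

text \<open>
  A right inverse of a square matrix is a left inverse.
\<close>

lemma bwd_fwd: "bwd n (\<theta> + real n *\<^sub>R \<omega>) (fwd n \<theta> v) = v"
proof -
  have "cocycle_fwd A \<omega> n (cvec \<theta>) ** cocycle_bwd A \<omega> n (cvec (\<theta> + real n *\<^sub>R \<omega>)) = mat 1"
    using fwd_bwd[of n "\<theta> + real n *\<^sub>R \<omega>"]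
    by (intro matrix_eq[THEN iffD2]) (simp add: fwd_def bwd_def matrix_vector_mul_assoc)
  then have "cocycle_bwd A \<omega> n (cvec (\<theta> + real n *\<^sub>R \<omega>)) ** cocycle_fwd A \<omega> n (cvec \<theta>) = mat 1"
    using matrix_left_right_inverse by blast
  then show ?thesis by (simp add: fwd_def bwd_def matrix_vector_mul_assoc)
qed

lemma fwd_vec_cnj: "fwd n \<theta> (vec_cnj v) = vec_cnj (fwd n \<theta> v)"
  by (induction n) (simp_all add: fwd_Suc A_real vec_cnj_cmat)

lemma bwd_vec_cnj: "bwd n \<theta> (vec_cnj v) = vec_cnj (bwd n \<theta> v)"
proof (induction n)
  case (Suc n)
  let ?\<theta> = "\<theta> - real (Suc n) *\<^sub>R \<omega>"
  have "A (cvec ?\<theta>) *v vec_cnj (bwd (Suc n) \<theta> v) = vec_cnj (bwd n \<theta> v)"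
    by (metis A_real vec_cnj_cmat A_bwd_Suc)
  then show ?case by (metis Suc bwd_Suc A_inverse(1))
qed simp

lemma fwd_symplectic:
  "vec_re (fwd n \<theta> v) \<bullet> (J (\<theta> + real n *\<^sub>R \<omega>) *v vec_re (fwd n \<theta> w)) = vec_re v \<bullet> (J \<theta> *v vec_re w)"
proof (induction n)
  case (Suc n)
  have "\<theta> + real (Suc n) *\<^sub>R \<omega> = \<theta> + real n *\<^sub>R \<omega> + \<omega>" by (simp add: algebra_simps)
  then show ?case using Suc by (simp only: fwd_Suc A_real vec_re_cmat symplectic)
qed simp

lemma bwd_symplectic:
  "vec_re (bwd n \<theta> v) \<bullet> (J (\<theta> - real n *\<^sub>R \<omega>) *v vec_re (bwd n \<theta> w)) = vec_re v \<bullet> (J \<theta> *v vec_re w)"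
  using fwd_symplectic[of n "\<theta> - real n *\<^sub>R \<omega>" "bwd n \<theta> v" "bwd n \<theta> w"]
  by (simp add: fwd_bwd)

lemma splitting3_at_real_point:
  obtains Ps Pc Pu where "splitting3 (Es (cvec \<theta>)) (Ec (cvec \<theta>)) (Eu (cvec \<theta>)) Ps Pc Pu"
proof -
  have "\<exists>Ps Pc Pu. \<forall>i j.
        strip_analytic \<rho> (\<lambda>\<theta>. Ps \<theta> $ i $ j) \<and> strip_analytic \<rho> (\<lambda>\<theta>. Pc \<theta> $ i $ j) \<and>
        strip_analytic \<rho> (\<lambda>\<theta>. Pu \<theta> $ i $ j) \<and>
        (\<forall>\<theta>\<in>strip \<rho>. splitting3 (Es \<theta>) (Ec \<theta>) (Eu \<theta>) (Ps \<theta>) (Pc \<theta>) (Pu \<theta>))"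
    using spectral unfolding spectral_condition_def by (elim conjE)
  then show thesis
    by (elim exE) (rule that, use real_in_strip[of \<theta>] in blast)
qed

lemma splitting:
  obtains vs vc vu where "vs \<in> Es (cvec \<theta>)" "vc \<in> Ec (cvec \<theta>)" "vu \<in> Eu (cvec \<theta>)" "v = vs + vc + vu"
proof (rule splitting3_at_real_point[of \<theta>])
  fix Ps Pc Pu assume "splitting3 (Es (cvec \<theta>)) (Ec (cvec \<theta>)) (Eu (cvec \<theta>)) Ps Pc Pu"
  then have "Ps *v v \<in> Es (cvec \<theta>)" "Pc *v v \<in> Ec (cvec \<theta>)" "Pu *v v \<in> Eu (cvec \<theta>)"
    "v = Ps *v v + Pc *v v + Pu *v v" unfolding splitting3_def by blast+
  then show thesis by (rule that)
qed

lemma Ec_subspace: "vec.subspace (Ec (cvec \<theta>))"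
  by (rule splitting3_at_real_point[of \<theta>]) (simp add: splitting3_def)

lemma A_image:
  "(\<lambda>v. A (cvec \<theta>) *v v) ` Es (cvec \<theta>) = Es (cvec (\<theta> + \<omega>))"
  "(\<lambda>v. A (cvec \<theta>) *v v) ` Eu (cvec \<theta>) = Eu (cvec (\<theta> + \<omega>))"
proof -
  have "\<forall>\<theta>\<in>strip \<rho>. \<forall>E\<in>{Es, Ec, Eu}. (\<lambda>v. A \<theta> *v v) ` E \<theta> = E (\<theta> + cvec \<omega>)"
    using spectral unfolding spectral_condition_def by (elim conjE)
  from bspec[OF this real_in_strip[of \<theta>]]
  show "(\<lambda>v. A (cvec \<theta>) *v v) ` Es (cvec \<theta>) = Es (cvec (\<theta> + \<omega>))"
    "(\<lambda>v. A (cvec \<theta>) *v v) ` Eu (cvec \<theta>) = Eu (cvec (\<theta> + \<omega>))"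
    by (simp_all add: cvec_add)
qed

lemma fwd_Eu: "v \<in> Eu (cvec \<theta>) \<Longrightarrow> fwd n \<theta> v \<in> Eu (cvec (\<theta> + real n *\<^sub>R \<omega>))"
proof (induction n)
  case (Suc n)
  have "\<theta> + real (Suc n) *\<^sub>R \<omega> = \<theta> + real n *\<^sub>R \<omega> + \<omega>" by (simp add: algebra_simps)
  then show ?case using Suc A_image(2)[of "\<theta> + real n *\<^sub>R \<omega>"] by (simp only: fwd_Suc) blast
qed simp

lemma bwd_Es: "v \<in> Es (cvec \<theta>) \<Longrightarrow> bwd n \<theta> v \<in> Es (cvec (\<theta> - real n *\<^sub>R \<omega>))"
proof (induction n)
  case (Suc n)
  let ?\<theta> = "\<theta> - real (Suc n) *\<^sub>R \<omega>"
  have "?\<theta> + \<omega> = \<theta> - real n *\<^sub>R \<omega>" by (simp add: algebra_simps)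
  then obtain w where w: "w \<in> Es (cvec ?\<theta>)" "bwd n \<theta> v = A (cvec ?\<theta>) *v w"
    using A_image(1)[of ?\<theta>] Suc by (metis (no_types, lifting) imageE)
  then have "bwd (Suc n) \<theta> v = w" by (simp only: bwd_Suc A_inverse)
  with w show ?case by simp
qed simp

lemma growth_rates:
  obtains \<mu>1 \<mu>2 \<mu>3 C :: real where "0 < \<mu>1" "\<mu>1 < 1" "0 < \<mu>2" "\<mu>2 < 1" "1 < \<mu>3" "\<mu>1 * \<mu>3 < 1" "\<mu>2 * \<mu>3 < 1" "0 < C"
    "\<And>\<theta> v. v \<in> Es (cvec \<theta>) \<longleftrightarrow> (\<forall>n\<ge>1. norm (fwd n \<theta> v) \<le> C * \<mu>1 ^ n * norm v)"
    "\<And>\<theta> v. v \<in> Eu (cvec \<theta>) \<longleftrightarrow> (\<forall>n\<ge>1. norm (bwd n \<theta> v) \<le> C * \<mu>2 ^ n * norm v)"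
    "\<And>\<theta> v. v \<in> Ec (cvec \<theta>) \<longleftrightarrow> (\<forall>n\<ge>1. norm (fwd n \<theta> v) \<le> C * \<mu>3 ^ n * norm v \<and> norm (bwd n \<theta> v) \<le> C * \<mu>3 ^ n * norm v)"
proof -
  have "\<exists>\<mu>1 \<mu>2 \<mu>3 C :: real.
        0 < \<mu>1 \<and> \<mu>1 < 1 \<and> 0 < \<mu>2 \<and> \<mu>2 < 1 \<and> 1 < \<mu>3 \<and> \<mu>1 * \<mu>3 < 1 \<and> \<mu>2 * \<mu>3 < 1 \<and> 0 < C \<and>
        (\<forall>\<theta>\<in>strip \<rho>. \<forall>v.
           (v \<in> Es \<theta> \<longleftrightarrow> (\<forall>n\<ge>1. norm (cocycle_fwd A \<omega> n \<theta> *v v) \<le> C * \<mu>1 ^ n * norm v)) \<and>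
           (v \<in> Eu \<theta> \<longleftrightarrow> (\<forall>n\<ge>1. norm (cocycle_bwd A \<omega> n \<theta> *v v) \<le> C * \<mu>2 ^ n * norm v)) \<and>
           (v \<in> Ec \<theta> \<longleftrightarrow>
              (\<forall>n\<ge>1. norm (cocycle_fwd A \<omega> n \<theta> *v v) \<le> C * \<mu>3 ^ n * norm v \<and>
                     norm (cocycle_bwd A \<omega> n \<theta> *v v) \<le> C * \<mu>3 ^ n * norm v)))"
    using spectral unfolding spectral_condition_def by (elim conjE)
  then show thesis
    by (elim exE conjE) (rule that; (assumption | (unfold fwd_def bwd_def, use real_in_strip in blast)))
qed

lemma vec_cnj_Ec: "v \<in> Ec (cvec \<theta>) \<Longrightarrow> vec_cnj v \<in> Ec (cvec \<theta>)"
  by (rule growth_rates) (simp add: fwd_vec_cnj bwd_vec_cnj)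

text \<open>
  The centre space at a real point is characterized by norms of its orbits, which
  conjugation does not change. So the centre space is the complexification of its real
  points.
\<close>

lemma vec_re_Ec: "v \<in> Ec (cvec \<theta>) \<Longrightarrow> cvec (vec_re v) \<in> Ec (cvec \<theta>)"
  unfolding cvec_vec_re
  by (intro vec.subspace_scale vec.subspace_add Ec_subspace vec_cnj_Ec)

text \<open>
  The form is preserved, while along the orbit one factor decays at rate \<open>\<mu>\<^sub>1\<close> (or \<open>\<mu>\<^sub>2\<close> in
  backward time) and the other grows at most at rate \<open>\<mu>\<^sub>3\<close>; the product of the two rates is
  below \<open>1\<close>.
\<close>

lemma hyperbolic_orthogonal_Ec:
  assumes x: "cvec x \<in> Ec (cvec \<theta>)" and v: "v \<in> Es (cvec \<theta>) \<or> v \<in> Eu (cvec \<theta>)"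
  shows "vec_re v \<bullet> (J \<theta> *v x) = 0"
proof (rule growth_rates)
  fix \<mu>1 \<mu>2 \<mu>3 C :: real
  assume \<mu>: "0 < \<mu>1" "\<mu>1 < 1" "0 < \<mu>2" "\<mu>2 < 1" "1 < \<mu>3" "\<mu>1 * \<mu>3 < 1" "\<mu>2 * \<mu>3 < 1" "0 < C"
    and Es: "\<And>\<theta> v. v \<in> Es (cvec \<theta>) \<longleftrightarrow> (\<forall>n\<ge>1. norm (fwd n \<theta> v) \<le> C * \<mu>1 ^ n * norm v)"
    and Eu: "\<And>\<theta> v. v \<in> Eu (cvec \<theta>) \<longleftrightarrow> (\<forall>n\<ge>1. norm (bwd n \<theta> v) \<le> C * \<mu>2 ^ n * norm v)"
    and Ec: "\<And>\<theta> v. v \<in> Ec (cvec \<theta>) \<longleftrightarrow> (\<forall>n\<ge>1. norm (fwd n \<theta> v) \<le> C * \<mu>3 ^ n * norm v \<and> norm (bwd n \<theta> v) \<le> C * \<mu>3 ^ n * norm v)"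
  have M: "M \<ge> 0"
    using J_bounded[of "axis undefined 1" 0 "axis undefined 1"] by (smt (verit) mult_cancel_left1 norm_axis_1)
  have est: "\<bar>vec_re v' \<bullet> (J \<theta>' *v vec_re w')\<bar> \<le> M * (C * norm v) * (C * norm x) * (q * \<mu>3) ^ n"
    if "norm v' \<le> C * q ^ n * norm v" "norm w' \<le> C * \<mu>3 ^ n * norm x" "q > 0" for v' w' \<theta>' q n
  proof -
    have "\<bar>vec_re v' \<bullet> (J \<theta>' *v vec_re w')\<bar> \<le> M * norm (vec_re v') * norm (vec_re w')" by (rule J_bounded)
    also have "\<dots> \<le> M * (C * q ^ n * norm v) * (C * \<mu>3 ^ n * norm x)"
      using that M \<mu> norm_vec_re[of v'] norm_vec_re[of w']
      by (intro mult_mono) (auto intro!: mult_nonneg_nonneg)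
    finally show ?thesis by (simp add: power_mult_distrib algebra_simps)
  qed
  show ?thesis
  proof (cases "v \<in> Es (cvec \<theta>)")
    case True
    show ?thesis
    proof (rule eq_0_if_geometrically_small)
      fix n :: nat assume "n \<ge> 1"
      then show "\<bar>vec_re v \<bullet> (J \<theta> *v x)\<bar> \<le> M * (C * norm v) * (C * norm x) * (\<mu>1 * \<mu>3) ^ n"
        using est[of "fwd n \<theta> v" \<mu>1 n "fwd n \<theta> (cvec x)"] fwd_symplectic[of n \<theta> v "cvec x"] True x \<mu> Es Ec
        by (metis norm_cvec vec_re_cvec)
    qed (use \<mu> in auto)
  next
    case False
    then have v: "v \<in> Eu (cvec \<theta>)" using v by blast
    show ?thesis
    proof (rule eq_0_if_geometrically_small)
      fix n :: nat assume "n \<ge> 1"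
      then show "\<bar>vec_re v \<bullet> (J \<theta> *v x)\<bar> \<le> M * (C * norm v) * (C * norm x) * (\<mu>2 * \<mu>3) ^ n"
        using est[of "bwd n \<theta> v" \<mu>2 n "bwd n \<theta> (cvec x)"] bwd_symplectic[of n \<theta> v "cvec x"] v x \<mu> Eu Ec
        by (metis norm_cvec vec_re_cvec)
    qed (use \<mu> in auto)
  qed
qed

text \<open>
  A central vector orthogonal to the centre space is orthogonal to all three summands of the
  splitting.
\<close>

lemma Ec_nondegenerate:
  assumes x: "cvec x \<in> Ec (cvec \<theta>)"
    and 0: "\<And>w. cvec w \<in> Ec (cvec \<theta>) \<Longrightarrow> w \<bullet> (J \<theta> *v x) = 0"
  shows "x = 0"
proof (rule J_nondegenerate)
  fix w
  obtain vs vc vu where v: "vs \<in> Es (cvec \<theta>)" "vc \<in> Ec (cvec \<theta>)" "vu \<in> Eu (cvec \<theta>)" "cvec w = vs + vc + vu"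
    by (rule splitting)
  then have "w = vec_re vs + vec_re vc + vec_re vu" by (metis vec_re_add vec_re_cvec)
  then show "w \<bullet> (J \<theta> *v x) = 0"
    using hyperbolic_orthogonal_Ec[OF x] v 0[OF vec_re_Ec[OF v(2)]] by (simp add: inner_add_left)
qed

lemma fwd_section:
  assumes "\<And>\<theta>. R \<theta> *v W \<theta> = W (\<theta> + \<omega>)"
  shows "fwd n \<theta> (cvec (W \<theta>)) = cvec (W (\<theta> + real n *\<^sub>R \<omega>))"
proof (induction n)
  case (Suc n)
  have "\<theta> + real (Suc n) *\<^sub>R \<omega> = \<theta> + real n *\<^sub>R \<omega> + \<omega>" by (simp add: algebra_simps)
  then show ?case by (simp only: fwd_Suc Suc A_real cmat_cvec assms)
qed simp

lemma bwd_section: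
  assumes "\<And>\<theta>. R \<theta> *v W \<theta> = W (\<theta> + \<omega>)"
  shows "bwd n \<theta> (cvec (W \<theta>)) = cvec (W (\<theta> - real n *\<^sub>R \<omega>))"
  using bwd_fwd[of n "\<theta> - real n *\<^sub>R \<omega>" "cvec (W (\<theta> - real n *\<^sub>R \<omega>))"]
  by (simp add: fwd_section[OF assms])

text \<open>
  The stable component \<open>vs\<close> of \<open>W \<theta>\<close> must vanish. In backward time \<open>W\<close> is bounded and the
  central and unstable components grow at most like \<open>\<mu>\<^sub>3\<^sup>n\<close>, so the same holds for the
  backward orbit of \<open>vs\<close>. That orbit stays in the stable bundle, and going forward again
  contracts it by \<open>\<mu>\<^sub>1\<^sup>n\<close>. Hence \<open>\<parallel>vs\<parallel> \<le> const (\<mu>\<^sub>1 \<mu>\<^sub>3)\<^sup>n\<close> for all \<open>n\<close>. The unstable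
  component vanishes by the same argument in reversed time.
\<close>

lemma bounded_section_in_Ec:
  assumes W: "\<And>\<theta>. R \<theta> *v W \<theta> = W (\<theta> + \<omega>)" and b: "\<And>\<theta>. norm (W \<theta>) \<le> b"
  shows "cvec (W \<theta>) \<in> Ec (cvec \<theta>)"
proof (rule growth_rates)
  fix \<mu>1 \<mu>2 \<mu>3 C :: real
  assume \<mu>: "0 < \<mu>1" "\<mu>1 < 1" "0 < \<mu>2" "\<mu>2 < 1" "1 < \<mu>3" "\<mu>1 * \<mu>3 < 1" "\<mu>2 * \<mu>3 < 1" "0 < C"
    and Es: "\<And>\<theta> v. v \<in> Es (cvec \<theta>) \<longleftrightarrow> (\<forall>n\<ge>1. norm (fwd n \<theta> v) \<le> C * \<mu>1 ^ n * norm v)"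
    and Eu: "\<And>\<theta> v. v \<in> Eu (cvec \<theta>) \<longleftrightarrow> (\<forall>n\<ge>1. norm (bwd n \<theta> v) \<le> C * \<mu>2 ^ n * norm v)"
    and Ec: "\<And>\<theta> v. v \<in> Ec (cvec \<theta>) \<longleftrightarrow> (\<forall>n\<ge>1. norm (fwd n \<theta> v) \<le> C * \<mu>3 ^ n * norm v \<and> norm (bwd n \<theta> v) \<le> C * \<mu>3 ^ n * norm v)"
  obtain vs vc vu where v: "vs \<in> Es (cvec \<theta>)" "vc \<in> Ec (cvec \<theta>)" "vu \<in> Eu (cvec \<theta>)" "cvec (W \<theta>) = vs + vc + vu"
    by (rule splitting)
  have b0: "b \<ge> 0" using b[of 0] norm_ge_zero order_trans by blast
  have \<mu>3: "1 \<le> \<mu>3 ^ n" for n using \<mu> by simp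
  have pow: "\<mu>1 ^ n \<le> \<mu>3 ^ n" "\<mu>2 ^ n \<le> \<mu>3 ^ n" for n using \<mu> by (auto intro!: power_mono)
  \<comment> \<open>\<open>B \<mu>3\<^sup>n\<close> dominates \<open>W\<close> together with the central and either one of the hyperbolic components.\<close>
  define B where "B = b + C * norm vc + C * (norm vs + norm vu)"
  have tri: "norm z \<le> B * \<mu>3 ^ n"
    if "z = w - y - x" "norm w \<le> b" "norm y \<le> C * \<mu>3 ^ n * norm vc"
       "norm x \<le> C * \<mu>3 ^ n * (norm vs + norm vu)" for z w y x :: "complex ^ 'n" and n
  proof -
    have "norm z \<le> norm w + norm y + norm x"
      using that(1) norm_triangle_ineq4[of "w - y" x] norm_triangle_ineq4[of w y] by simp
    also have "\<dots> \<le> b * \<mu>3 ^ n + C * \<mu>3 ^ n * norm vc + C * \<mu>3 ^ n * (norm vs + norm vu)"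
      using that(2-) mult_left_mono[OF \<mu>3[of n] b0] by linarith
    finally show ?thesis by (simp add: B_def algebra_simps)
  qed
  have grow: "C * q ^ n * norm u \<le> C * \<mu>3 ^ n * (norm vs + norm vu)"
    if "q ^ n \<le> \<mu>3 ^ n" "norm u \<le> norm vs + norm vu" "0 < q" for q n and u :: "complex ^ 'n"
    using that \<mu> by (intro mult_mono) auto
  have "norm vs = 0"
  proof (rule eq_0_if_geometrically_small)
    fix n :: nat assume n: "n \<ge> 1"
    have "norm (bwd n \<theta> vs) \<le> B * \<mu>3 ^ n"
    proof (rule tri)
      show "bwd n \<theta> vs = cvec (W (\<theta> - real n *\<^sub>R \<omega>)) - bwd n \<theta> vc - bwd n \<theta> vu"
        using bwd_section[OF W, of n \<theta>] by (simp add: v(4) bwd_add algebra_simps)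
      show "norm (bwd n \<theta> vc) \<le> C * \<mu>3 ^ n * norm vc" using v(2) Ec n by blast
      show "norm (bwd n \<theta> vu) \<le> C * \<mu>3 ^ n * (norm vs + norm vu)"
        by (rule order_trans[OF _ grow[OF pow(2)]]) (use v(3) Eu n \<mu>(3) in auto)
    qed (simp add: b)
    moreover have "norm vs \<le> C * \<mu>1 ^ n * norm (bwd n \<theta> vs)"
      using Es[of "bwd n \<theta> vs" "\<theta> - real n *\<^sub>R \<omega>"] bwd_Es[OF v(1), of n] fwd_bwd[of n \<theta> vs] n by auto
    ultimately have "norm vs \<le> C * \<mu>1 ^ n * (B * \<mu>3 ^ n)"
      using \<mu> by (elim order_trans) (intro mult_left_mono, auto)
    then show "\<bar>norm vs\<bar> \<le> (C * B) * (\<mu>1 * \<mu>3) ^ n" by (simp add: power_mult_distrib algebra_simps)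
  qed (use \<mu> in auto)
  moreover have "norm vu = 0"
  proof (rule eq_0_if_geometrically_small)
    fix n :: nat assume n: "n \<ge> 1"
    have "norm (fwd n \<theta> vu) \<le> B * \<mu>3 ^ n"
    proof (rule tri)
      show "fwd n \<theta> vu = cvec (W (\<theta> + real n *\<^sub>R \<omega>)) - fwd n \<theta> vc - fwd n \<theta> vs"
        using fwd_section[OF W, of n \<theta>] by (simp add: v(4) fwd_add algebra_simps)
      show "norm (fwd n \<theta> vc) \<le> C * \<mu>3 ^ n * norm vc" using v(2) Ec n by blast
      show "norm (fwd n \<theta> vs) \<le> C * \<mu>3 ^ n * (norm vs + norm vu)"
        by (rule order_trans[OF _ grow[OF pow(1)]]) (use v(1) Es n \<mu>(1) in auto)
    qed (simp add: b)
    moreover have "norm vu \<le> C * \<mu>2 ^ n * norm (fwd n \<theta> vu)"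
      using Eu[of "fwd n \<theta> vu" "\<theta> + real n *\<^sub>R \<omega>"] fwd_Eu[OF v(3), of n] bwd_fwd[of n \<theta> vu] n by auto
    ultimately have "norm vu \<le> C * \<mu>2 ^ n * (B * \<mu>3 ^ n)"
      using \<mu> by (elim order_trans) (intro mult_left_mono, auto)
    then show "\<bar>norm vu\<bar> \<le> (C * B) * (\<mu>2 * \<mu>3) ^ n" by (simp add: power_mult_distrib algebra_simps)
  qed (use \<mu> in auto)
  ultimately show ?thesis using v by simp
qed

text \<open>
  \<open>D\<close> is the derivative of an embedding and \<open>V\<close> a vector field along it. The real points of
  the centre space have dimension at most \<open>2 l\<close>, so the range of \<open>D\<close> is Lagrangian in them
  and contains every central vector orthogonal to it.
\<close>

lemma section_in_lagrangian_tangent: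
  fixes D :: "real ^ 'l \<Rightarrow> real ^ 'l \<Rightarrow> real ^ 'n" and V :: "real ^ 'l \<Rightarrow> real ^ 'n"
  assumes anti: "\<And>\<theta> x y. x \<bullet> (J \<theta> *v y) = - (y \<bullet> (J \<theta> *v x))"
    and dim: "vec.dim (Ec (cvec \<theta>)) = 2 * CARD('l)"
    and lin: "linear (D \<theta>)" and inj: "inj (D \<theta>)"
    and D: "\<And>\<theta> \<xi>. R \<theta> *v D \<theta> \<xi> = D (\<theta> + \<omega>) \<xi>" and Db: "\<And>\<xi>. \<exists>b. \<forall>\<theta>. norm (D \<theta> \<xi>) \<le> b"
    and V: "\<And>\<theta>. R \<theta> *v V \<theta> = V (\<theta> + \<omega>)" and Vb: "\<And>\<theta>. norm (V \<theta>) \<le> b"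
    and iso: "\<And>\<xi> \<eta>. D \<theta> \<xi> \<bullet> (J \<theta> *v D \<theta> \<eta>) = 0" and VD: "\<And>\<xi>. V \<theta> \<bullet> (J \<theta> *v D \<theta> \<xi>) = 0"
  shows "V \<theta> \<in> range (D \<theta>)"
proof (rule lagrangian_maximal[where E="{x. cvec x \<in> Ec (cvec \<theta>)}" and J="J \<theta>"])
  show "subspace {x. cvec x \<in> Ec (cvec \<theta>)}"
    using vec.subspace_0[OF Ec_subspace[of \<theta>]] vec.subspace_add[OF Ec_subspace[of \<theta>]] vec.subspace_scale[OF Ec_subspace[of \<theta>]]
    by (auto intro!: subspaceI simp: cvec_add cvec_scaleR) (simp add: cvec_def zero_vec_def)
  show "subspace (range (D \<theta>))" by (rule linear_subspace_image[OF lin subspace_UNIV])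
  show "range (D \<theta>) \<subseteq> {x. cvec x \<in> Ec (cvec \<theta>)}"
  proof clarify
    fix \<xi>
    obtain b where "\<And>\<theta>. norm (D \<theta> \<xi>) \<le> b" using Db by blast
    then show "cvec (D \<theta> \<xi>) \<in> Ec (cvec \<theta>)"
      using bounded_section_in_Ec[of "\<lambda>\<theta>. D \<theta> \<xi>"] D by blast
  qed
  have "dim (range (D \<theta>)) = CARD('l)"
    using dim_image_eq[OF lin, of UNIV] inj by simp
  then show "dim {x. cvec x \<in> Ec (cvec \<theta>)} \<le> 2 * dim (range (D \<theta>))"
    using dim_real_points_le[of "Ec (cvec \<theta>)"] dim by simp
  show "V \<theta> \<in> {x. cvec x \<in> Ec (cvec \<theta>)}" using bounded_section_in_Ec[OF V Vb] by simp
qed (use anti iso VD Ec_nondegenerate in blast)+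

end

section \<open>Invariant tori of exact symplectic flows\<close>

lemma cvec_in_interior_strip:
  assumes "\<rho> > 0"
  shows "cvec (x :: real ^ 'l) \<in> interior (strip \<rho>)"
proof -
  have "ball (cvec x) \<rho> \<subseteq> strip \<rho>"
  proof
    fix z assume "z \<in> ball (cvec x) \<rho>"
    then have z: "norm (z - cvec x) < \<rho>" by (simp add: dist_norm norm_minus_commute)
    have "\<bar>Im (z $ i)\<bar> \<le> \<rho>" for i
    proof -
      have "\<bar>Im (z $ i)\<bar> = \<bar>Im ((z - cvec x) $ i)\<bar>" by (simp add: cvec_def)
      also have "\<dots> \<le> norm ((z - cvec x) $ i)" by (rule abs_Im_le_cmod)
      also have "\<dots> \<le> norm (z - cvec x)" by (rule Finite_Cartesian_Product.norm_nth_le)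
      finally show ?thesis using z by simp
    qed
    then show "z \<in> strip \<rho>" by (simp add: strip_def)
  qed
  then show ?thesis using assms by (meson centre_in_ball interior_maximal open_ball subsetD)
qed

lemma strip_extension_smooth:
  assumes "strip_extension ang \<rho> K Kc" "\<rho> > 0"
  shows "smooth_fun K"
proof (rule smooth_fun_vec, rule real_analytic_imp_smooth)
  fix i
  have "holomorphic_several (\<lambda>z. Kc z $ i) (interior (strip \<rho>))" "\<And>x. Kc (cvec x) $ i = complex_of_real (K x $ i)"
    using assms(1) by (auto simp: strip_extension_def strip_analytic_def cvec_def)
  then show "real_analytic (\<lambda>x. K x $ i)"
    unfolding real_analytic_def using cvec_in_interior_strip[OF assms(2)] by blast
qed

lemma complex_extension_smooth:
  assumes "complex_extension ang F U Fc"
  shows "smooth_fun F"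
proof (rule smooth_fun_vec, rule real_analytic_imp_smooth)
  fix i
  have "holomorphic_several (\<lambda>z. Fc z $ i) U" "range cvec \<subseteq> U" "\<And>x. Fc (cvec x) $ i = complex_of_real (F x $ i)"
    using assms by (auto simp: complex_extension_def cvec_def)
  then show "real_analytic (\<lambda>x. F x $ i)"
    unfolding real_analytic_def by blast
qed

text \<open>
  A complex matrix is determined by its action on the standard basis, which consists of real
  vectors; on real vectors the chain rule identifies the derivative of the extension with
  the real one.
\<close>

lemma complex_extension_jacobian:
  assumes ext: "complex_extension ang F U Fc"
  shows "jacobian Fc (at (cvec x)) = cmat (jacobian F (at x))"
proof -
  have U: "cvec x \<in> U" and FcF: "\<And>x. Fc (cvec x) = cvec (F x)"
    and hol: "\<And>i. holomorphic_several (\<lambda>z. Fc z $ i) U"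
    using ext by (auto simp: complex_extension_def)
  have "((\<lambda>z. \<chi> i. Fc z $ i) has_derivative (\<lambda>v. \<chi> i. frechet_derivative (\<lambda>z. Fc z $ i) (at (cvec x)) v)) (at (cvec x))"
    by (rule has_derivative_vec) (rule holomorphic_several_has_derivative(1)[OF hol U])
  then have D: "(Fc has_derivative frechet_derivative Fc (at (cvec x))) (at (cvec x))"
    using frechet_derivative_at by fastforce
  have "((\<lambda>x. Fc (cvec x)) has_derivative (\<lambda>v. frechet_derivative Fc (at (cvec x)) (cvec v))) (at x)"
    by (rule has_derivative_compose[OF bounded_linear.has_derivative[OF bounded_linear_cvec has_derivative_ident] D])
  moreover have "((\<lambda>x. Fc (cvec x)) has_derivative (\<lambda>v. cvec (frechet_derivative F (at x) v))) (at x)"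
    unfolding FcF
    by (rule bounded_linear.has_derivative[OF bounded_linear_cvec smooth_fun_has_derivative[OF complex_extension_smooth[OF ext]]])
  ultimately have eq: "frechet_derivative Fc (at (cvec x)) (cvec v) = cvec (frechet_derivative F (at x) v)" for v
    using has_derivative_unique by metis
  have "axis j 1 = cvec (axis j 1)" for j
    by (simp add: cvec_def axis_def vec_eq_iff)
  then have "frechet_derivative Fc (at (cvec x)) (axis j 1) = cvec (frechet_derivative F (at x) (axis j 1))" for j
    using eq by metis
  then show ?thesis
    by (simp add: jacobian_def matrix_def cmat_def vec_eq_iff) (simp add: cvec_def)
qed

lemma jacobian_mult:
  assumes "smooth_fun (F :: real ^ 'n \<Rightarrow> real ^ 'm)"
  shows "jacobian F (at x) *v v = frechet_derivative F (at x) v"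
  unfolding jacobian_def
  by (rule fun_cong[OF matrix_vector_mul(2)[OF has_derivative_linear[OF smooth_fun_has_derivative[OF assms]]]])

text \<open>
  The real side of the problem: an exact symplectic flow whose time-one map acts on the
  torus \<open>K\<close> as an irrational rotation.
\<close>

locale invariant_torus =
  fixes ang :: "'n::finite set"
    and \<alpha> f :: "real ^ 'n \<Rightarrow> real ^ 'n" and J :: "real ^ 'n \<Rightarrow> real ^ 'n ^ 'n"
    and W :: "real ^ 'n \<Rightarrow> real"
    and S :: "real \<Rightarrow> real ^ 'n \<Rightarrow> real ^ 'n"
    and K :: "real ^ 'l::finite \<Rightarrow> real ^ 'n" and \<omega> :: "real ^ 'l"
  assumes smooth: "smooth_fun \<alpha>" "smooth_fun f" "smooth_fun J" "smooth_fun W" "smooth_fun (S 1)" "smooth_fun K"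
    and inv: "invariant_fun ang \<alpha>" "invariant_fun ang f" "invariant_fun ang W"
    and form: "\<And>z \<xi> \<eta>. ext_deriv \<alpha> z \<xi> \<eta> = \<xi> \<bullet> (J z *v \<eta>)"
    and lie: "\<And>z \<eta>. lie_deriv f \<alpha> z \<eta> = frechet_derivative W (at z) \<eta>"
    and flow: "is_flow f S"
    and torus: "torus_map ang K"
    and irrational: "rationally_independent \<omega>"
    and conjugacy: "\<And>\<theta>. same_point ang (S 1 (K \<theta>)) (K (\<theta> + \<omega>))"
begin

abbreviation "D \<theta> \<equiv> frechet_derivative K (at \<theta>)"
abbreviation "DF \<theta> \<equiv> frechet_derivative (S 1) (at (K \<theta>))"

lemma J_antisymmetric: "x \<bullet> (J z *v y) = - (y \<bullet> (J z *v x))"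
  by (simp add: ext_deriv_def flip: form)

lemma J_invariant:
  assumes "same_point ang x y"
  shows "J x = J y"
proof -
  have "frechet_derivative \<alpha> (at x) = frechet_derivative \<alpha> (at y)"
    using invariant_fun_derivative[OF smooth(1) inv(1)] assms by (auto simp: invariant_fun_def)
  then have "\<xi> \<bullet> (J x *v \<eta>) = \<xi> \<bullet> (J y *v \<eta>)" for \<xi> \<eta>
    by (simp add: ext_deriv_def flip: form)
  then show ?thesis by (metis matrix_eq vector_eq_ldot)
qed

lemma field_J_at_image:
  "f (S 1 (K \<theta>)) = f (K (\<theta> + \<omega>))" "J (S 1 (K \<theta>)) = J (K (\<theta> + \<omega>))"
  using conjugacy[of \<theta>] inv J_invariant by (auto simp: invariant_fun_def)

lemma DK_has_derivative: "(K has_derivative D \<theta>) (at \<theta>)"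
  by (rule smooth_fun_has_derivative[OF smooth(6)])

lemma DK_linear: "linear (D \<theta>)"
  by (rule has_derivative_linear[OF DK_has_derivative])

lemma K_continuous: "continuous_on UNIV K"
  by (rule smooth_fun_continuous_on[OF smooth(6)])

lemma DK_continuous: "continuous_on UNIV (\<lambda>\<theta>. D \<theta> \<xi>)"
  by (rule smooth_fun_continuous_on[OF smooth_fun_derivative[OF smooth(6)]])

lemma DK_periodic: "same_point UNIV x y \<Longrightarrow> D x = D y"
  by (rule torus_map_derivative_periodic[OF smooth(6) torus])

lemma invariant_on_torus_periodic:
  assumes "invariant_fun ang g" "same_point UNIV x y"
  shows "g (K x) = g (K y)"
  using assms torus by (auto simp: invariant_fun_def torus_map_def)

text \<open>
  The conjugacy, lifted to the cover with a constant discrepancy \<open>m\<close>, is differentiated.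
\<close>

lemma tangent_invariant: "DF \<theta> (D \<theta> \<xi>) = D (\<theta> + \<omega>) \<xi>"
proof -
  have contF: "continuous_on UNIV (\<lambda>\<theta>. S 1 (K \<theta>))"
    by (rule continuous_on_compose2[OF smooth_fun_continuous_on[OF smooth(5), of UNIV] K_continuous]) simp
  have contT: "continuous_on UNIV (\<lambda>\<theta>. K (\<theta> + \<omega>))"
    by (rule continuous_on_compose2[OF K_continuous]) (auto intro!: continuous_intros)
  \<comment> \<open>The discrepancy \<open>m\<close> is an integer vector in the angular directions and drops out.\<close>
  obtain m where m: "\<And>\<theta>. S 1 (K \<theta>) = K (\<theta> + \<omega>) + m"
    by (rule continuous_lifts_differ_by_constant[OF contF contT conjugacy]) blast
  have "((\<lambda>\<theta>. S 1 (K \<theta>)) has_derivative (\<lambda>\<xi>. DF \<theta> (D \<theta> \<xi>))) (at \<theta>)"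
    by (rule has_derivative_compose[OF DK_has_derivative smooth_fun_has_derivative[OF smooth(5)]])
  moreover have "((\<lambda>\<theta>. S 1 (K \<theta>)) has_derivative D (\<theta> + \<omega>)) (at \<theta>)"
  proof -
    have 1: "((\<lambda>\<theta>. \<theta> + \<omega>) has_derivative (\<lambda>v. v)) (at \<theta>)"
      by (auto intro!: derivative_eq_intros)
    show ?thesis
      unfolding m using has_derivative_compose[OF 1 DK_has_derivative]
      by (auto intro!: derivative_eq_intros)
  qed
  ultimately have "(\<lambda>\<xi>. DF \<theta> (D \<theta> \<xi>)) = D (\<theta> + \<omega>)" by (rule has_derivative_unique)
  then show ?thesis by metis
qed

text \<open>
  The time-one map commutes with the flow, so it maps the velocity of the orbit through
  \<open>K \<theta>\<close> to the velocity of the image orbit.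
\<close>

lemma field_invariant: "DF \<theta> (f (K \<theta>)) = f (K (\<theta> + \<omega>))"
proof -
  have S0: "S 0 x = x" for x using flow by (simp add: is_flow_def)
  have "((\<lambda>t. S 1 (S t (K \<theta>))) has_vector_derivative
      frechet_derivative (S 1) (at (S 0 (K \<theta>))) (f (S 0 (K \<theta>)))) (at 0)"
    using vector_derivative_diff_chain_within[OF flow_has_derivative[OF flow]
        has_derivative_at_withinI[OF smooth_fun_has_derivative[OF smooth(5)]], of "K \<theta>" 0]
    by (simp add: o_def)
  moreover have "((\<lambda>t. S 1 (S t (K \<theta>))) has_vector_derivative f (S 0 (S 1 (K \<theta>)))) (at 0)"
    using flow_has_derivative[OF flow, of "S 1 (K \<theta>)" 0]
    by (simp add: flow_add[OF smooth_fun_lipschitz_on_balls[OF smooth(2)] flow] add.commute)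
  ultimately show ?thesis
    using vector_derivative_unique_at by (metis S0 field_J_at_image(1))
qed

lemma symplectic_along_torus:
  "DF \<theta> x \<bullet> (J (K (\<theta> + \<omega>)) *v DF \<theta> y) = x \<bullet> (J (K \<theta>) *v y)"
proof -
  have "DF \<theta> x \<bullet> (J (S 1 (K \<theta>)) *v DF \<theta> y) = x \<bullet> (J (K \<theta>) *v y)"
    by (rule flow_map_symplectic[OF smooth(2,3) flow
          lie_derivative_of_exterior_derivative_eq_0[OF smooth(1,2,4,3) form lie] smooth_fun_has_derivative[OF smooth(5)]])
  then show ?thesis by (simp add: field_J_at_image)
qed

text \<open>
  The energy is constant on the torus, because it is preserved by a minimal rotation; its
  derivative in the direction \<open>D \<theta> \<xi>\<close> is the left-hand side.
\<close>

lemma field_orthogonal_to_torus: "f (K \<theta>) \<bullet> (J (K \<theta>) *v D \<theta> \<xi>) = 0"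
proof -
  let ?H = "hamiltonian W \<alpha> f"
  have H: "(?H has_derivative ext_deriv \<alpha> z (f z)) (at z)" for z
    by (rule hamiltonian_has_derivative[OF smooth(1,2,4) lie])
  have invH: "invariant_fun ang ?H"
    using inv by (auto simp: invariant_fun_def hamiltonian_def)
  have "((\<lambda>\<theta>. ?H (K \<theta>)) has_derivative (\<lambda>\<xi>. ext_deriv \<alpha> (K \<theta>) (f (K \<theta>)) (D \<theta> \<xi>))) (at \<theta>)" for \<theta>
    by (rule has_derivative_compose[OF DK_has_derivative H])
  moreover have "?H (K x) = ?H (K y)" for x y
  proof (rule rotation_invariant_constant[OF irrational, where g="\<lambda>\<theta>. ?H (K \<theta>)"])
    show "continuous_on UNIV (\<lambda>\<theta>. ?H (K \<theta>))"
      using calculation has_derivative_continuous by (blast intro: continuous_at_imp_continuous_on)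
    show "?H (K x) = ?H (K y)" if "same_point UNIV x y" for x y
      by (rule invariant_on_torus_periodic[OF invH that])
    show "?H (K (x + \<omega>)) = ?H (K x)" for x
      using conjugacy[of x] invH hamiltonian_conserved[OF H flow, of 1 "K x"] by (auto simp: invariant_fun_def)
  qed
  then have "(\<lambda>\<theta>. ?H (K \<theta>)) = (\<lambda>_. ?H (K 0))" by blast
  ultimately have "((\<lambda>_. ?H (K 0)) has_derivative (\<lambda>\<xi>. ext_deriv \<alpha> (K \<theta>) (f (K \<theta>)) (D \<theta> \<xi>))) (at \<theta>)" by metis
  then have "(\<lambda>\<xi>. ext_deriv \<alpha> (K \<theta>) (f (K \<theta>)) (D \<theta> \<xi>)) = (\<lambda>_. 0)"
    by (rule has_derivative_unique) simp
  then show ?thesis unfolding form by metis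
qed

lemma pullback_form_constant:
  "D x \<xi> \<bullet> (J (K x) *v D x \<eta>) = D y \<xi> \<bullet> (J (K y) *v D y \<eta>)"
proof (rule rotation_invariant_constant[OF irrational, where g="\<lambda>x. D x \<xi> \<bullet> (J (K x) *v D x \<eta>)"])
  have "continuous_on UNIV (\<lambda>x. J (K x))"
    by (rule continuous_on_compose2[OF smooth_fun_continuous_on[OF smooth(3), of UNIV] K_continuous]) simp
  then show "continuous_on UNIV (\<lambda>x. D x \<xi> \<bullet> (J (K x) *v D x \<eta>))"
    by (intro continuous_on_inner DK_continuous bounded_bilinear.continuous_on[OF bounded_bilinear_matrix_vector])
  show "D x \<xi> \<bullet> (J (K x) *v D x \<eta>) = D y \<xi> \<bullet> (J (K y) *v D y \<eta>)" if "same_point UNIV x y" for x y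
    using DK_periodic[OF that] J_invariant[of "K x" "K y"] torus that by (simp add: torus_map_def)
  show "D (x + \<omega>) \<xi> \<bullet> (J (K (x + \<omega>)) *v D (x + \<omega>) \<eta>) = D x \<xi> \<bullet> (J (K x) *v D x \<eta>)" for x
    using symplectic_along_torus[of x "D x \<xi>" "D x \<eta>"] by (simp add: tangent_invariant)
qed

text \<open>
  \<open>g v\<close> is the \<open>v\<close>-component of the pull-back of \<open>\<alpha>\<close>. Its exterior derivative is the
  pull-back of \<open>\<Omega>\<close>, which is constant, and along coordinate axes the components are
  1-periodic.
\<close>

lemma isotropic_on_axes:
  "D \<theta> (axis i 1) \<bullet> (J (K \<theta>) *v D \<theta> (axis j 1)) = 0"
proof -
  let ?DD = "\<lambda>v \<theta>. frechet_derivative (\<lambda>\<theta>. D \<theta> v) (at \<theta>)"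
  let ?\<alpha>' = "\<lambda>\<theta>. frechet_derivative \<alpha> (at (K \<theta>))"
  define g where "g = (\<lambda>v \<theta>. \<alpha> (K \<theta>) \<bullet> D \<theta> v)"
  define g' where "g' = (\<lambda>v \<theta> \<xi>. \<alpha> (K \<theta>) \<bullet> ?DD v \<theta> \<xi> + ?\<alpha>' \<theta> (D \<theta> \<xi>) \<bullet> D \<theta> v)"
  have g: "(g v has_derivative g' v \<theta>) (at \<theta>)" for v \<theta>
    unfolding g_def g'_def
    by (intro has_derivative_inner has_derivative_compose[OF DK_has_derivative smooth_fun_has_derivative[OF smooth(1)]]
        smooth_fun_has_derivative smooth_fun_derivative smooth(6))
  have cont: "continuous_on UNIV (\<lambda>\<theta>. g' v \<theta> \<xi>)" for v \<xi>
  proof -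
    obtain \<alpha>' where \<alpha>': "continuous_on UNIV \<alpha>'" "\<And>x. blinfun_apply (\<alpha>' x) = frechet_derivative \<alpha> (at x)"
      using smooth_fun_blinfun_derivative[OF smooth(1)] by metis
    have 1: "continuous_on UNIV (\<lambda>\<theta>. blinfun_apply (\<alpha>' (K \<theta>)) (D \<theta> \<xi>))"
      by (intro continuous_intros DK_continuous continuous_on_compose2[OF \<alpha>'(1) K_continuous]) simp
    have 2: "continuous_on UNIV (\<lambda>\<theta>. \<alpha> (K \<theta>))"
      by (rule continuous_on_compose2[OF smooth_fun_continuous_on[OF smooth(1), of UNIV] K_continuous]) simp
    show ?thesis
      unfolding g'_def
      by (intro continuous_intros 2 DK_continuous 1[unfolded \<alpha>'(2)] smooth_fun_continuous_on smooth_fun_derivative smooth(6))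
  qed
  have per: "g v (x + axis k 1) = g v x" for v x k
  proof -
    have "same_point UNIV (x + axis k 1) x"
      by (simp add: same_point_def axis_def)
    from DK_periodic[OF this] invariant_on_torus_periodic[OF inv(1) this]
    show ?thesis by (simp add: g_def)
  qed
  have "g' v x u - g' u x v = D x u \<bullet> (J (K x) *v D x v)" for u v x
    using symmetric_second_derivative[OF smooth(6), of v x u]
    by (simp add: g'_def ext_deriv_def flip: form)
  then have "g' v x u - g' u x v = D \<theta> u \<bullet> (J (K \<theta>) *v D \<theta> v)" for u v x
    using pullback_form_constant[of x u v \<theta>] by simp
  from constant_exterior_derivative_eq_0[OF g g cont per per this]
  show ?thesis .
qed

lemma isotropic: "D \<theta> \<xi> \<bullet> (J (K \<theta>) *v D \<theta> \<eta>) = 0"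
proof -
  have axes: "\<exists>i. b = axis i 1" if "b \<in> Basis" for b :: "real ^ 'l"
    using that by (auto simp: Basis_vec_def)
  have linl: "linear (\<lambda>\<xi>. D \<theta> \<xi> \<bullet> (J (K \<theta>) *v D \<theta> \<eta>))" for \<eta>
    by (rule linearI) (simp_all add: linear_add[OF DK_linear] linear_scale[OF DK_linear] inner_add_left)
  have linr: "linear (\<lambda>\<eta>. D \<theta> \<xi> \<bullet> (J (K \<theta>) *v D \<theta> \<eta>))" for \<xi>
    by (rule linearI) (simp_all add: linear_add[OF DK_linear] linear_scale[OF DK_linear] inner_add_right
        matrix_vector_right_distrib matrix_vector_mult_scaleR)
  have zero: "linear (\<lambda>_ :: real ^ 'l. 0 :: real)" by (rule linearI) auto
  have "(\<lambda>\<eta>. D \<theta> (axis i 1) \<bullet> (J (K \<theta>) *v D \<theta> \<eta>)) = (\<lambda>_. 0)" for i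
    by (rule linear_eq_stdbasis[OF linr zero]) (use axes isotropic_on_axes in metis)
  then have "(\<lambda>\<xi>. D \<theta> \<xi> \<bullet> (J (K \<theta>) *v D \<theta> \<eta>)) = (\<lambda>_. 0)" for \<eta>
    by (intro linear_eq_stdbasis[OF linl zero]) (use axes in metis)
  then show ?thesis by metis
qed

text \<open>
  The same vector \<open>a\<close> works at all points: the two sections \<open>f \<circ> K\<close> and \<open>D \<cdot> a\<close> are
  transported by the same injective cocycle, so their coincidence set is closed and
  invariant under the rotation, and the rotation is minimal.
\<close>

lemma field_tangent_everywhere:
  assumes inj: "\<And>\<theta>. inj (DF \<theta>)" and 0: "f (K \<theta>0) = D \<theta>0 a"
  shows "f (K \<theta>) = D \<theta> a"
proof -
  have contf: "continuous_on UNIV (\<lambda>\<theta>. f (K \<theta>))"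
    by (rule continuous_on_compose2[OF smooth_fun_continuous_on[OF smooth(2), of UNIV] K_continuous]) simp
  have "{\<theta>. f (K \<theta>) = D \<theta> a} = UNIV"
  proof (rule closed_rotation_invariant_eq_UNIV[OF irrational])
    show "closed {\<theta>. f (K \<theta>) = D \<theta> a}"
      by (intro closed_Collect_eq contf DK_continuous)
    show "\<theta>0 \<in> {\<theta>. f (K \<theta>) = D \<theta> a}" using 0 by simp
    show "y \<in> {\<theta>. f (K \<theta>) = D \<theta> a}" if "same_point UNIV x y" "x \<in> {\<theta>. f (K \<theta>) = D \<theta> a}" for x y
      using that DK_periodic[OF that(1)] invariant_on_torus_periodic[OF inv(2) that(1)] by simp
    show "x + \<omega> \<in> {\<theta>. f (K \<theta>) = D \<theta> a} \<longleftrightarrow> x \<in> {\<theta>. f (K \<theta>) = D \<theta> a}" for x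
      using inj[of x] by (simp add: inj_eq flip: field_invariant tangent_invariant)
  qed
  then show ?thesis by blast
qed

lemma flow_on_torus_linear:
  assumes "\<And>\<theta>. f (K \<theta>) = D \<theta> a"
  shows "S t (K \<theta>) = K (\<theta> + t *\<^sub>R a)"
proof (rule ode_unique[OF smooth_fun_lipschitz_on_balls[OF smooth(2)], where u="\<lambda>t. S t (K \<theta>)" and v="\<lambda>t. K (\<theta> + t *\<^sub>R a)"])
  show "((\<lambda>t. S t (K \<theta>)) has_vector_derivative f (S t (K \<theta>))) (at t)" for t
    by (rule flow_has_derivative[OF flow])
  show "((\<lambda>t. K (\<theta> + t *\<^sub>R a)) has_vector_derivative f (K (\<theta> + t *\<^sub>R a))) (at t)" for t
  proof -
    have "((\<lambda>t. \<theta> + t *\<^sub>R a) has_vector_derivative a) (at t)"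
      by (auto intro!: derivative_eq_intros simp: has_vector_derivative_def)
    from vector_derivative_diff_chain_within[OF this has_derivative_at_withinI[OF DK_has_derivative]]
    show ?thesis by (simp add: o_def assms)
  qed
  show "S 0 (K \<theta>) = K (\<theta> + 0 *\<^sub>R a)" using flow by (simp add: is_flow_def)
qed

end

theorem theorem3p15:
  fixes ang :: "'n::finite set"
    and \<alpha> f :: "real ^ 'n \<Rightarrow> real ^ 'n"
    and J :: "real ^ 'n \<Rightarrow> real ^ 'n ^ 'n"
    and S :: "real \<Rightarrow> real ^ 'n \<Rightarrow> real ^ 'n"
    and K :: "real ^ 'l::finite \<Rightarrow> real ^ 'n"
    and \<omega> :: "real ^ 'l"
    and \<kappa> \<nu> \<rho> :: real
    and d :: nat
  assumes "CARD('n) = 2 * d" and "CARD('l) \<le> d"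
    and "ang = {} \<or> card ang = CARD('l)"
    and "exact_symplectic_form ang \<alpha> J"
    and "\<kappa> > 0" and "\<nu> \<ge> real CARD('l)" and "\<omega> \<in> diophantine \<kappa> \<nu>"
    and "analytic_vector_field ang f" and "exact_symplectic_field ang \<alpha> f"
    and "is_flow f S"
    and "\<rho> > 0" and "K \<in> ND ang J (S 1) \<omega> \<rho>"
    and "\<forall>\<theta>. same_point ang (S 1 (K \<theta>)) (K (\<theta> + \<omega>))"
  shows "\<exists>\<omega>'. same_point UNIV \<omega>' \<omega> \<and>
           (\<forall>t \<theta>. same_point ang (S t (K \<theta>)) (K (\<theta> + t *\<^sub>R \<omega>')))"
proof -
  obtain W where W: "smooth_fun W" "invariant_fun ang W"
    "\<And>z \<eta>. lie_deriv f \<alpha> z \<eta> = frechet_derivative W (at z) \<eta>"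
    using assms(9) by (auto simp: exact_symplectic_field_def)
  obtain Kc U Fc Es Ec Eu where emb: "torus_embedding ang K"
    and Kc: "strip_extension ang \<rho> K Kc" and Fc: "complex_extension ang (S 1) U Fc"
    and spec: "spectral_condition (\<lambda>\<theta>. jacobian Fc (at (Kc \<theta>))) \<omega> \<rho> Es Ec Eu"
    and dim: "\<forall>\<theta>\<in>strip \<rho>. vec.dim (Ec \<theta>) = 2 * CARD('l)"
    using assms(12) unfolding ND_def by blast
  have \<alpha>: "smooth_fun \<alpha>" "invariant_fun ang \<alpha>" "\<And>z \<xi> \<eta>. ext_deriv \<alpha> z \<xi> \<eta> = \<xi> \<bullet> (J z *v \<eta>)"
    and J: "\<And>i j. real_analytic (\<lambda>z. J z $ i $ j)" "\<And>z. invertible (J z)"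
    using assms(4) by (auto simp: exact_symplectic_form_def)
  have f: "invariant_fun ang f" "\<And>i. real_analytic (\<lambda>z. f z $ i)"
    using assms(8) by (auto simp: analytic_vector_field_def)
  have smF: "smooth_fun (S 1)" by (rule complex_extension_smooth[OF Fc])
  interpret invariant_torus ang \<alpha> f J W S K \<omega>
  proof unfold_locales
    show "smooth_fun f" "smooth_fun J"
      by (intro smooth_fun_vec real_analytic_imp_smooth f J)+
    show "smooth_fun K" by (rule strip_extension_smooth[OF Kc assms(11)])
    show "torus_map ang K" using emb by (simp add: torus_embedding_def)
    show "rationally_independent \<omega>" by (rule diophantine_rationally_independent[OF assms(7)])
  qed (use \<alpha> f W smF assms(10,13) in auto)
  have contJ: "continuous_on UNIV (\<lambda>\<theta>. J (K \<theta>))"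
    by (rule continuous_on_compose2[OF smooth_fun_continuous_on[OF smooth(3), of UNIV] K_continuous]) simp
  have invJ: "invariant_fun ang J" using J_invariant by (simp add: invariant_fun_def)
  obtain B where B: "B > 0" "\<And>\<theta>. norm (J (K \<theta>)) \<le> B"
    using periodic_bounded[OF contJ invariant_on_torus_periodic[OF invJ]] by blast
  \<comment> \<open>\<open>J\<close> is continuous and periodic along the torus, hence uniformly bounded there.\<close>
  obtain C where C: "C > 0" "\<And>A (v :: real ^ 'n). norm ((A :: real ^ 'n ^ 'n) *v v) \<le> norm A * norm v * C"
    using bounded_bilinear.pos_bounded[OF bounded_bilinear_matrix_vector] by blast
  have J_bound: "\<bar>x \<bullet> (J (K \<theta>) *v y)\<bar> \<le> (B * C) * norm x * norm y" for \<theta> x y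
  proof -
    have "\<bar>x \<bullet> (J (K \<theta>) *v y)\<bar> \<le> norm x * norm (J (K \<theta>) *v y)" by (rule Cauchy_Schwarz_ineq2)
    also have "\<dots> \<le> norm x * (norm (J (K \<theta>)) * norm y * C)" by (intro mult_left_mono C) auto
    also have "\<dots> \<le> norm x * (B * norm y * C)"
      using B(2) C(1) by (intro mult_left_mono mult_right_mono) auto
    finally show ?thesis by (simp add: algebra_simps)
  qed
  interpret cocycle: symplectic_cocycle "\<lambda>\<theta>. jacobian Fc (at (Kc \<theta>))" "\<lambda>\<theta>. jacobian (S 1) (at (K \<theta>))"
    "\<lambda>\<theta>. J (K \<theta>)" \<omega> \<rho> Es Ec Eu "B * C"
  proof unfold_locales
    show "jacobian Fc (at (Kc (cvec \<theta>))) = cmat (jacobian (S 1) (at (K \<theta>)))" for \<theta>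
      using Kc complex_extension_jacobian[OF Fc] by (simp add: strip_extension_def)
  qed (use symplectic_along_torus J(2) J_bound spec assms(11) in \<open>simp_all add: jacobian_mult[OF smF]\<close>)
  have contf: "continuous_on UNIV (\<lambda>\<theta>. f (K \<theta>))"
    by (rule continuous_on_compose2[OF smooth_fun_continuous_on[OF smooth(2), of UNIV] K_continuous]) simp
  have perf: "f (K x) = f (K y)" if "same_point UNIV x y" for x y
    by (rule invariant_on_torus_periodic[OF inv(2) that])
  obtain b where b: "\<And>\<theta>. norm (f (K \<theta>)) \<le> b"
    using periodic_bounded[OF contf perf] by blast
  have "f (K 0) \<in> range (D 0)"
  proof (rule cocycle.section_in_lagrangian_tangent[where V="\<lambda>\<theta>. f (K \<theta>)"])
    show "vec.dim (Ec (cvec 0)) = 2 * CARD('l)" using dim cocycle.real_in_strip by blast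
    show "inj (D 0)" using emb by (simp add: torus_embedding_def)
    show "\<exists>b. \<forall>\<theta>. norm (D \<theta> \<xi>) \<le> b" for \<xi>
      using periodic_bounded[OF DK_continuous, of \<xi>] DK_periodic by metis
    show "x \<bullet> (J (K \<theta>) *v y) = - (y \<bullet> (J (K \<theta>) *v x))" for \<theta> x y by (rule J_antisymmetric)
    show "norm (f (K \<theta>)) \<le> b" for \<theta> by (rule b)
  qed (simp_all add: DK_linear jacobian_mult[OF smF] tangent_invariant field_invariant isotropic
      field_orthogonal_to_torus)
  then obtain a where a: "f (K 0) = D 0 a" by blast
  have "inj (DF \<theta>)" for \<theta>
  proof -
    have "(*v) (jacobian (S 1) (at (K \<theta>))) = DF \<theta>" by (simp add: fun_eq_iff jacobian_mult[OF smF])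
    then show ?thesis
      using cocycle.R_invertible[of \<theta>] invertible_eq_bij[of "jacobian (S 1) (at (K \<theta>))"]
      by (simp add: bij_is_inj)
  qed
  from field_tangent_everywhere[OF this a]
  have S: "S t (K \<theta>) = K (\<theta> + t *\<^sub>R a)" for t \<theta> by (rule flow_on_torus_linear)
  have "same_point ang (K (0 + a)) (K (0 + \<omega>))"
    using assms(13) S[of 1 0] by (metis scaleR_one)
  then have "same_point UNIV (0 + a) (0 + \<omega>)"
    using emb unfolding torus_embedding_def by blast
  moreover have "same_point ang (K (\<theta> + t *\<^sub>R a)) (K (\<theta> + t *\<^sub>R a))" for t \<theta>
    by (simp add: same_point_def)
  ultimately show ?thesis unfolding S by auto
qed

end
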